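(* There exists a finitely generated, residually finite, infinite group $\Gamma$ with $\rho(\Gamma)=0$.
   Context: For a group $\Gamma$, let $r_n(\Gamma)$ be the number of isomorphism classes of irreducible complex representations of $\Gamma$ of dimension $n$, and $R_n(\Gamma)=\sum_{i=1}^n r_i(\Gamma)$. Then $\rho(\Gamma)=\limsup_{n\to\infty}\frac{\log R_n(\Gamma)}{\log n}$, with the convention $\rho(\Gamma)=\infty$ if some $R_n(\Gamma)$ is infinite or $R_n(\Gamma)$ is not polynomially bounded. *)

theory Defs
  imports "Jordan_Normal_Form.Matrix" "HOL-Algebra.Coset" "HOL-Algebra.Generated_Groups"
    "HOL-Library.Extended_Real" "HOL-Library.Liminf_Limsup" "HOL-Library.FuncSet"
begin

text \<open>Complex representations of dimension n of a group G (HOL-Algebra), as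
  homomorphisms into invertible n x n complex matrices; functions are taken
  extensional on the carrier so that equality of representations is meaningful.\<close>

definition is_rep :: "('g, 'b) monoid_scheme \<Rightarrow> nat \<Rightarrow> ('g \<Rightarrow> complex mat) \<Rightarrow> bool" where
  "is_rep G n r \<longleftrightarrow> r \<in> carrier G \<rightarrow> carrier_mat n n \<and> r \<in> extensional (carrier G)
     \<and> r \<one>\<^bsub>G\<^esub> = 1\<^sub>m n
     \<and> (\<forall>x\<in>carrier G. \<forall>y\<in>carrier G. r (x \<otimes>\<^bsub>G\<^esub> y) = r x * r y)"

definition invariant_subspace :: "('g, 'b) monoid_scheme \<Rightarrow> nat \<Rightarrow> ('g \<Rightarrow> complex mat) \<Rightarrow> complex vec set \<Rightarrow> bool" where
  "invariant_subspace G n r W \<longleftrightarrow> W \<subseteq> carrier_vec n \<and> 0\<^sub>v n \<in> W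
     \<and> (\<forall>v\<in>W. \<forall>w\<in>W. v + w \<in> W) \<and> (\<forall>c. \<forall>v\<in>W. c \<cdot>\<^sub>v v \<in> W)
     \<and> (\<forall>g\<in>carrier G. \<forall>w\<in>W. r g *\<^sub>v w \<in> W)"

definition irred_rep :: "('g, 'b) monoid_scheme \<Rightarrow> nat \<Rightarrow> ('g \<Rightarrow> complex mat) \<Rightarrow> bool" where
  "irred_rep G n r \<longleftrightarrow> is_rep G n r \<and> n \<ge> 1 \<and>
     (\<forall>W. invariant_subspace G n r W \<longrightarrow> W = {0\<^sub>v n} \<or> W = carrier_vec n)"

definition rep_iso :: "('g, 'b) monoid_scheme \<Rightarrow> nat \<Rightarrow> ('g \<Rightarrow> complex mat) rel" where
  "rep_iso G n = {(r, s). \<exists>P \<in> carrier_mat n n. invertible_mat P \<and>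
     (\<forall>g\<in>carrier G. P * r g = s g * P)}"

definition irr_classes :: "('g, 'b) monoid_scheme \<Rightarrow> nat \<Rightarrow> ('g \<Rightarrow> complex mat) set set" where
  "irr_classes G n = {r. irred_rep G n r} // rep_iso G n"

definition r_count :: "('g, 'b) monoid_scheme \<Rightarrow> nat \<Rightarrow> nat" where
  "r_count G n = card (irr_classes G n)"

definition R_count :: "('g, 'b) monoid_scheme \<Rightarrow> nat \<Rightarrow> nat" where
  "R_count G n = (\<Sum>i=1..n. r_count G i)"

definition rep_growth :: "('g, 'b) monoid_scheme \<Rightarrow> ereal" where
  "rep_growth G =
     (if (\<forall>n\<ge>1. finite (irr_classes G n)) \<and>
         (\<exists>C d::real. \<forall>n\<ge>1. real (R_count G n) \<le> C * real n powr d)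
      then limsup (\<lambda>n. ereal (ln (real (R_count G n)) / ln (real n)))
      else \<infinity>)"

definition finitely_generated_group :: "('g, 'b) monoid_scheme \<Rightarrow> bool" where
  "finitely_generated_group G \<longleftrightarrow> (\<exists>S. finite S \<and> S \<subseteq> carrier G \<and> generate G S = carrier G)"

definition residually_finite :: "('g, 'b) monoid_scheme \<Rightarrow> bool" where
  "residually_finite G \<longleftrightarrow> (\<forall>g\<in>carrier G. g \<noteq> \<one>\<^bsub>G\<^esub> \<longrightarrow>
     (\<exists>N. N \<lhd> G \<and> finite (rcosets\<^bsub>G\<^esub> N) \<and> g \<notin> N))"

end

theory Submission
  imports Defs "Jordan_Normal_Form.Char_Poly" "Jordan_Normal_Form.Gauss_Jordan_Elimination" "HOL-Library.Z2"
    "HOL-Computational_Algebra.Fundamental_Theorem_Algebra" "HOL-Library.Countable_Set"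
    "HOL-Combinatorics.Transposition" "HOL-Algebra.Weak_Morphisms"
begin

text \<open>
  The group \<open>\<Gamma>\<close> is the elementary group \<open>EL\<^sub>3(R)\<close> of a finitely generated ring \<open>R\<close> of sequences of
  matrices over the field with two elements, the \<open>c\<close>-th of size \<open>block_size c\<close>. It contains every
  finite product of the groups \<open>GL(N\<^sub>c)\<close>, \<open>N\<^sub>c = 3 * block_size c\<close>, and it is residually finite as a subgroup of
  the full product. For a representation of dimension \<open>d\<close> the elements of \<open>R\<close> whose elementary matrices
  act trivially form an ideal. More than \<open>2^d\<close> commuting involutions of dimension \<open>d\<close> cannot be
  distinct, so the ideal contains the difference of two shifts of a diagonal matrix with aperiodic entries,
  and aperiodicity puts the idempotent of a tail of the sequence into the ideal. Thus the
  representation factors through finitely many components, and the irreducible ones of dimension less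
  than \<open>2^(N\<^sub>c - 2)\<close> are trivial on component \<open>c\<close>.

  It remains to count the irreducible representations of a product of \<open>GL(N)\<close>, \<open>N = N\<^sub>c\<close>, and a finite
  group \<open>H\<close>. As \<open>N\<^sub>c\<close> grows fast, \<open>|H| \<le> N\<close>. By Schur orthogonality,
  inequivalent irreducibles have linearly independent coefficient functions, which gives
  at most \<open>|H|\<close> times the number of conjugacy classes of \<open>GL(N)\<close>, and this number is at most
  \<open>4^N\<close>. If the dimension is less than \<open>2^((m + 1) * (N - 2 * (m + 1)))\<close>, then a rank argument for the characters of
  abelian unipotent subgroups yields a nonzero vector fixed by \<open>GL(N - 2 * m)\<close>, and
  double cosets of that subgroup may be used instead of conjugacy classes; their number is bounded in terms of \<open>m\<close>.
  Taking \<open>m\<close> of order \<open>1 / \<epsilon>\<close>, both bounds are at most \<open>D powr \<epsilon>\<close> for dimension \<open>D\<close> large.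
\<close>

section \<open>Schur orthogonality and counting\<close>

text \<open>The obstacle is quantitative. Let N be the size of the last component that can act
  nontrivially in dimension at most D, so that 2^(N - 2) <= D. Conjugacy classes alone bound the
  count by N * 4^N, which is only roughly D^2. This suffices once D exceeds 2^(C * N) with C large;
  for smaller D the count has to be independent of N up to one factor N. Double cosets achieve this:
  a vector fixed by GL(N - 2m) leaves only blocks whose size depends on m. The threshold 2^((m + 1)
  * (N - 2(m + 1))) counts the extensions of a character of rank m + 1, all of which occur together,
  so below it only ranks up to m occur. Nothing is known in advance about the image of a
  representation, which might be infinite. The pigeonhole gets around this: in characteristic 2
  every elementary matrix is an involution, and there are at most 2^d commuting involutions of size
  d. Block sizes are powers of two because reduction modulo the block size then respects small
  2-adic valuations, which gives both the aperiodic diagonal and a way to isolate single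
  components.\<close>

lemma homogeneous_system_nontrivial:
  fixes a :: "'i \<Rightarrow> 'j \<Rightarrow> 'k::field"
  assumes "finite J" "finite I" "card J < card I"
  shows "\<exists>c. (\<exists>i\<in>I. c i \<noteq> 0) \<and> (\<forall>j\<in>J. (\<Sum>i\<in>I. c i * a i j) = 0)"
  using assms
proof (induction J arbitrary: I a rule: finite_induct)
  case empty
  then have "I \<noteq> {}" by auto
  then show ?case by (intro exI[of _ "\<lambda>_. 1"]) auto
next
  case (insert j J)
  show ?case
  proof (cases "\<forall>i\<in>I. a i j = 0")
    case True
    have "card J < card I" using insert by simp
    from insert.IH[OF \<open>finite I\<close> this, of a] obtain c where
      "\<exists>i\<in>I. c i \<noteq> 0" "\<forall>j\<in>J. (\<Sum>i\<in>I. c i * a i j) = 0" by blast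
    then show ?thesis using True by (intro exI[of _ c]) auto
  next
    case False
    then obtain i0 where i0: "i0 \<in> I" "a i0 j \<noteq> 0" by blast
    \<comment> \<open>Pivot step: equation j is solved for the unknown i0, and \<open>b\<close> is
      the coefficient array of the other equations after substituting.\<close>
    define b where "b i k = a i k - a i j / a i0 j * a i0 k" for i k
    have "card J < card (I - {i0})" using insert i0 by simp
    from insert.IH[OF _ this, of b] insert.prems(1) obtain c where
      c: "\<exists>i\<in>I - {i0}. c i \<noteq> 0" "\<forall>j\<in>J. (\<Sum>i\<in>I - {i0}. c i * b i j) = 0" by blast
    define d where "d i = (if i = i0 then - (\<Sum>i\<in>I - {i0}. c i * a i j / a i0 j) else c i)" for i
    have split: "(\<Sum>i\<in>I. d i * a i k) = (\<Sum>i\<in>I - {i0}. c i * b i k)" for k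
    proof -
      have "(\<Sum>i\<in>I. d i * a i k) = d i0 * a i0 k + (\<Sum>i\<in>I - {i0}. d i * a i k)"
        using insert.prems(1) i0 by (simp add: sum.remove)
      also have "(\<Sum>i\<in>I - {i0}. d i * a i k) = (\<Sum>i\<in>I - {i0}. c i * a i k)"
        by (intro sum.cong) (auto simp: d_def)
      also have "d i0 * a i0 k = - (\<Sum>i\<in>I - {i0}. c i * (a i j / a i0 j * a i0 k))"
        by (simp add: d_def sum_distrib_right mult.assoc)
      finally show ?thesis by (simp add: b_def right_diff_distrib sum_subtractf)
    qed
    have "b i j = 0" for i using i0 by (simp add: b_def)
    then have "(\<Sum>i\<in>I. d i * a i j) = 0" unfolding split by simp
    moreover have "\<exists>i\<in>I. d i \<noteq> 0" using c(1) by (auto simp: d_def)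
    ultimately show ?thesis using c(2) split by (intro exI[of _ d]) auto
  qed
qed

text \<open>Unlike \<open>is_rep\<close> this does not ask for extensionality, so restricting to a
  subgroup or composing with a homomorphism gives a representation without redefining it outside the
  carrier.\<close>

definition mat_rep :: "('g, 'b) monoid_scheme \<Rightarrow> nat \<Rightarrow> ('g \<Rightarrow> 'a::semiring_1 mat) \<Rightarrow> bool" where
  "mat_rep G n r \<longleftrightarrow> r \<in> carrier G \<rightarrow> carrier_mat n n \<and> r \<one>\<^bsub>G\<^esub> = 1\<^sub>m n
     \<and> (\<forall>x\<in>carrier G. \<forall>y\<in>carrier G. r (x \<otimes>\<^bsub>G\<^esub> y) = r x * r y)"

definition irr_mat_rep :: "('g, 'b) monoid_scheme \<Rightarrow> nat \<Rightarrow> ('g \<Rightarrow> complex mat) \<Rightarrow> bool" where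
  "irr_mat_rep G n r \<longleftrightarrow> mat_rep G n r \<and> n \<ge> 1 \<and>
     (\<forall>W. invariant_subspace G n r W \<longrightarrow> W = {0\<^sub>v n} \<or> W = carrier_vec n)"

definition equiv_reps :: "('g, 'b) monoid_scheme \<Rightarrow> nat \<Rightarrow> ('g \<Rightarrow> complex mat) \<Rightarrow> ('g \<Rightarrow> complex mat) \<Rightarrow> bool" where
  "equiv_reps G n r s \<longleftrightarrow> (\<exists>P \<in> carrier_mat n n. invertible_mat P \<and> (\<forall>g\<in>carrier G. P * r g = s g * P))"

lemma mat_repD:
  assumes "mat_rep G n r"
  shows "g \<in> carrier G \<Longrightarrow> r g \<in> carrier_mat n n" "r \<one>\<^bsub>G\<^esub> = 1\<^sub>m n"
    "g \<in> carrier G \<Longrightarrow> h \<in> carrier G \<Longrightarrow> r (g \<otimes>\<^bsub>G\<^esub> h) = r g * r h"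
  using assms by (auto simp: mat_rep_def)

lemma index_mult_mat_sum:
  assumes "A \<in> carrier_mat a n" "B \<in> carrier_mat n b" "i < a" "j < b"
  shows "(A * B) $$ (i, j) = (\<Sum>k<n. A $$ (i, k) * B $$ (k, j))"
  using assms by (auto simp: scalar_prod_def lessThan_atLeast0 intro!: sum.cong)

lemma index_mult_vec_sum:
  assumes "A \<in> carrier_mat a n" "v \<in> carrier_vec n" "i < a"
  shows "(A *\<^sub>v v) $ i = (\<Sum>k<n. A $$ (i, k) * v $ k)"
  using assms by (auto simp: scalar_prod_def lessThan_atLeast0 intro!: sum.cong)

lemma invertible_matI:
  assumes "A \<in> carrier_mat n n" "B \<in> carrier_mat n n" "A * B = 1\<^sub>m n" "B * A = 1\<^sub>m n"
  shows "invertible_mat A"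
  using assms unfolding invertible_mat_def inverts_mat_def by auto

text \<open>Kernel and image of an intertwiner are invariant. For nonzero T the kernel is zero and
  the image is everything, so T has a two-sided inverse \<open>B\<close>, assembled from preimages
  of the unit vectors.\<close>

lemma schur:
  assumes r: "irr_mat_rep G n r" and s: "irr_mat_rep G m s"
    and T: "T \<in> carrier_mat m n" and comm: "\<And>g. g \<in> carrier G \<Longrightarrow> s g * T = T * r g"
  shows "T = 0\<^sub>m m n \<or> (m = n \<and> invertible_mat T)"
proof (cases "T = 0\<^sub>m m n")
  case False
  have rr: "mat_rep G n r" and ss: "mat_rep G m s" using r s by (auto simp: irr_mat_rep_def)
  have move: "s g *\<^sub>v (T *\<^sub>v v) = T *\<^sub>v (r g *\<^sub>v v)" if "g \<in> carrier G" "v \<in> carrier_vec n" for g v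
    using comm[OF that(1)] T that mat_repD(1)[OF rr that(1)] mat_repD(1)[OF ss that(1)]
    by (metis assoc_mult_mat_vec)
  define K where "K = {v \<in> carrier_vec n. T *\<^sub>v v = 0\<^sub>v m}"
  define R where "R = (\<lambda>v. T *\<^sub>v v) ` carrier_vec n"
  have "invariant_subspace G n r K"
    unfolding invariant_subspace_def
  proof (intro conjI allI ballI)
    fix g w assume g: "g \<in> carrier G" and w: "w \<in> K"
    have "s g *\<^sub>v (0\<^sub>v m) = 0\<^sub>v m" using mat_repD(1)[OF ss g] by auto
    then show "r g *\<^sub>v w \<in> K" using w g move[OF g, of w, symmetric] mat_repD(1)[OF rr g] by (auto simp: K_def)
  qed (use T in \<open>auto simp: K_def mult_add_distrib_mat_vec mult_mat_vec\<close>)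
  then have K: "K = {0\<^sub>v n} \<or> K = carrier_vec n" using r by (auto simp: irr_mat_rep_def)
  have "invariant_subspace G m s R"
    unfolding invariant_subspace_def
  proof (intro conjI allI ballI)
    show "R \<subseteq> carrier_vec m" using T by (auto simp: R_def)
    show "0\<^sub>v m \<in> R" unfolding R_def using T by (intro image_eqI[of _ _ "0\<^sub>v n"]) auto
  next
    fix v w assume "v \<in> R" "w \<in> R"
    then obtain v' w' where "v' \<in> carrier_vec n" "w' \<in> carrier_vec n" "v = T *\<^sub>v v'" "w = T *\<^sub>v w'"
      by (auto simp: R_def)
    then show "v + w \<in> R" unfolding R_def using T
      by (intro image_eqI[of _ _ "v' + w'"]) (auto simp: mult_add_distrib_mat_vec)
  next
    fix c v assume "v \<in> R"
    then obtain v' where "v' \<in> carrier_vec n" "v = T *\<^sub>v v'" by (auto simp: R_def)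
    then show "c \<cdot>\<^sub>v v \<in> R" unfolding R_def using T
      by (intro image_eqI[of _ _ "c \<cdot>\<^sub>v v'"]) (auto simp: mult_mat_vec)
  next
    fix g v assume g: "g \<in> carrier G" and "v \<in> R"
    then obtain v' where "v' \<in> carrier_vec n" "v = T *\<^sub>v v'" by (auto simp: R_def)
    then show "s g *\<^sub>v v \<in> R" unfolding R_def using move[OF g] mat_repD(1)[OF rr g]
      by (intro image_eqI[of _ _ "r g *\<^sub>v v'"]) auto
  qed
  then have R: "R = {0\<^sub>v m} \<or> R = carrier_vec m" using s by (auto simp: irr_mat_rep_def)
  obtain i j where ij: "i < m" "j < n" "T $$ (i, j) \<noteq> 0"
  proof (rule ccontr)
    assume "\<not> thesis"
    with that have "T = 0\<^sub>m m n" using T by (intro eq_matI) auto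
    with False show False ..
  qed
  have Tj: "T *\<^sub>v unit_vec n j \<noteq> 0\<^sub>v m"
  proof
    assume "T *\<^sub>v unit_vec n j = 0\<^sub>v m"
    then have "(T *\<^sub>v unit_vec n j) $ i = 0" using ij by simp
    then show False using ij T by simp
  qed
  then have "unit_vec n j \<notin> K" by (auto simp: K_def)
  then have K0: "K = {0\<^sub>v n}" using K by auto
  have "T *\<^sub>v unit_vec n j \<in> R" by (auto simp: R_def)
  then have R1: "R = carrier_vec m" using R Tj by auto
  have inj: "v = 0\<^sub>v n" if "v \<in> carrier_vec n" "T *\<^sub>v v = 0\<^sub>v m" for v
    using K0 that by (auto simp: K_def)
  have "\<forall>k<m. \<exists>w. w \<in> carrier_vec n \<and> T *\<^sub>v w = unit_vec m k"
  proof (intro allI impI)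
    fix k assume "k < m"
    have "unit_vec m k \<in> R" unfolding R1 by simp
    then show "\<exists>w. w \<in> carrier_vec n \<and> T *\<^sub>v w = unit_vec m k" by (auto simp: R_def)
  qed
  then obtain w where w: "\<And>k. k < m \<Longrightarrow> w k \<in> carrier_vec n" "\<And>k. k < m \<Longrightarrow> T *\<^sub>v w k = unit_vec m k"
    by metis
  define B where "B = mat n m (\<lambda>(i, k). w k $ i)"
  have B: "B \<in> carrier_mat n m" by (simp add: B_def)
  have colB: "col B k = w k" if "k < m" for k using that w(1)[OF that] by (auto simp: B_def)
  have TB: "T * B = 1\<^sub>m m"
  proof (rule mat_col_eqI)
    fix k assume "k < dim_col (1\<^sub>m m :: complex mat)"
    then have k: "k < m" by simp
    have "col (T * B) k = T *\<^sub>v col B k" using T B k by (intro eq_vecI) auto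
    then show "col (T * B) k = col (1\<^sub>m m) k" using k by (simp add: colB w(2))
  qed (use T B in auto)
  have BT: "B * T = 1\<^sub>m n"
  proof (rule mat_col_eqI)
    fix k assume "k < dim_col (1\<^sub>m n :: complex mat)"
    then have k: "k < n" by simp
    have cBT: "col (B * T) k \<in> carrier_vec n" using B T k by auto
    have "T *\<^sub>v col (B * T) k = col (T * (B * T)) k" using T B k by (metis col_mult2 mult_carrier_mat)
    also have "T * (B * T) = T" using T B TB by (metis assoc_mult_mat left_mult_one_mat)
    finally have e: "T *\<^sub>v col (B * T) k = col T k" .
    have "T *\<^sub>v (col (B * T) k - unit_vec n k) = 0\<^sub>v m"
      using e T cBT k by (subst mult_minus_distrib_mat_vec[of _ m n]) auto
    then have "col (B * T) k - unit_vec n k = 0\<^sub>v n" by (intro inj) (use cBT in auto)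
    then have "\<And>i. i < n \<Longrightarrow> col (B * T) k $ i - unit_vec n k $ i = 0"
      using cBT by (metis index_minus_vec(1) index_zero_vec(1) unit_vec_carrier carrier_vecD)
    then show "col (B * T) k = col (1\<^sub>m n) k" using cBT k B by (intro eq_vecI) auto
  qed (use T B in auto)
  \<comment> \<open>The traces of \<open>T * B\<close> and \<open>B * T\<close> agree and equal m
    and n; in characteristic zero this gives m = n.\<close>
  have "(of_nat m :: complex) = (\<Sum>i<m. (T * B) $$ (i, i))" by (simp add: TB)
  also have "\<dots> = (\<Sum>i<m. \<Sum>k<n. T $$ (i, k) * B $$ (k, i))"
    using T B by (intro sum.cong refl index_mult_mat_sum) auto
  also have "\<dots> = (\<Sum>k<n. \<Sum>i<m. B $$ (k, i) * T $$ (i, k))"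
    by (subst sum.swap) (simp add: mult.commute)
  also have "\<dots> = (\<Sum>k<n. (B * T) $$ (k, k))"
    using T B by (intro sum.cong refl index_mult_mat_sum[symmetric]) auto
  also have "\<dots> = of_nat n" by (simp add: BT)
  finally have "m = n" by simp
  then show ?thesis using invertible_matI[of T n B] T B TB BT by simp
qed simp

text \<open>T has a complex eigenvalue c, and T - c is an intertwiner with nontrivial kernel, so
  Schur's lemma leaves only zero.\<close>

lemma schur_scalar:
  assumes r: "irr_mat_rep G n r" and T: "T \<in> carrier_mat n n"
    and comm: "\<And>g. g \<in> carrier G \<Longrightarrow> r g * T = T * r g"
  obtains c where "T = c \<cdot>\<^sub>m 1\<^sub>m n"
proof -
  have rr: "mat_rep G n r" and n: "n \<ge> 1" using r by (auto simp: irr_mat_rep_def)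
  have "degree (char_poly T) = n" using degree_monic_char_poly[OF T] by simp
  then obtain c where c: "poly (char_poly T) c = 0"
    using n fundamental_theorem_of_algebra[of "char_poly T"] by (auto simp: constant_degree)
  then obtain v where v: "v \<in> carrier_vec n" "v \<noteq> 0\<^sub>v n" "T *\<^sub>v v = c \<cdot>\<^sub>v v"
    using T eigenvalue_root_char_poly[OF T, of c] unfolding eigenvalue_def eigenvector_def by auto
  define S where "S = T - c \<cdot>\<^sub>m 1\<^sub>m n"
  have S: "S \<in> carrier_mat n n" using T by (auto simp: S_def intro: minus_carrier_mat)
  have "r g * S = S * r g" if g: "g \<in> carrier G" for g
  proof -
    have rg: "r g \<in> carrier_mat n n" using mat_repD(1)[OF rr g] .
    have "r g * S = r g * T - r g * (c \<cdot>\<^sub>m 1\<^sub>m n)" unfolding S_def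
      by (rule mult_minus_distrib_mat[OF rg T]) simp
    also have "r g * (c \<cdot>\<^sub>m 1\<^sub>m n) = (c \<cdot>\<^sub>m 1\<^sub>m n) * r g"
      using rg mult_smult_distrib[OF rg one_carrier_mat] mult_smult_assoc_mat[OF one_carrier_mat rg] by simp
    also have "r g * T - (c \<cdot>\<^sub>m 1\<^sub>m n) * r g = S * r g" unfolding S_def comm[OF g]
      by (rule minus_mult_distrib_mat[OF T _ rg, symmetric]) simp
    finally show ?thesis .
  qed
  from schur[OF r r S this] have "S = 0\<^sub>m n n \<or> invertible_mat S" by blast
  moreover have "\<not> invertible_mat S"
  proof
    assume "invertible_mat S"
    then obtain B where B: "B * S = 1\<^sub>m (dim_row B)" "inverts_mat S B"
      unfolding invertible_mat_def inverts_mat_def by auto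
    then have BC: "B \<in> carrier_mat n n" using S unfolding inverts_mat_def
      by (metis carrier_mat_triv carrier_matD(2) index_mult_mat(2,3) index_one_mat(2,3) carrier_matD(1))
    have "S *\<^sub>v v = 0\<^sub>v n"
    proof -
      have "(c \<cdot>\<^sub>m 1\<^sub>m n) *\<^sub>v v = c \<cdot>\<^sub>v v"
      proof (rule eq_vecI)
        fix i assume "i < dim_vec (c \<cdot>\<^sub>v v)"
        then have i: "i < n" using v(1) by simp
        have "((c \<cdot>\<^sub>m 1\<^sub>m n) *\<^sub>v v) $ i = (\<Sum>k<n. (c \<cdot>\<^sub>m 1\<^sub>m n) $$ (i, k) * v $ k)"
          by (rule index_mult_vec_sum[OF _ v(1) i]) simp
        also have "\<dots> = (\<Sum>k<n. if k = i then c * v $ i else 0)"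
          using i by (intro sum.cong) auto
        finally show "((c \<cdot>\<^sub>m 1\<^sub>m n) *\<^sub>v v) $ i = (c \<cdot>\<^sub>v v) $ i" using i v(1) by simp
      qed (use v(1) in auto)
      then show ?thesis using v T by (simp add: S_def minus_mult_distrib_mat_vec[of _ n n])
    qed
    then have "B *\<^sub>v (S *\<^sub>v v) = 0\<^sub>v n" using BC by auto
    then have "v = 0\<^sub>v n" using B BC S v(1) by (metis assoc_mult_mat_vec carrier_matD(1) one_mult_mat_vec)
    then show False using v by simp
  qed
  ultimately have S0: "S = 0\<^sub>m n n" by blast
  have "T = c \<cdot>\<^sub>m 1\<^sub>m n"
  proof (rule eq_matI)
    fix i j assume "i < dim_row (c \<cdot>\<^sub>m 1\<^sub>m n)" "j < dim_col (c \<cdot>\<^sub>m 1\<^sub>m n)"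
    moreover from this have "S $$ (i, j) = 0" by (simp add: S0)
    ultimately show "T $$ (i, j) = (c \<cdot>\<^sub>m 1\<^sub>m n) $$ (i, j)" using T by (simp add: S_def)
  qed (use T in auto)
  then show ?thesis by (rule that)
qed

text \<open>The sums are the entries of an averaged matrix unit: \<open>T\<close> below is the sum
  over g of s(g^-1) E r(g), where E has its only nonzero entry at (q, i). It intertwines r and s,
  and Schur's lemma determines it.\<close>

lemma schur_orthogonality:
  assumes G: "group G" and fin: "finite (carrier G)"
    and r: "irr_mat_rep G n r" and s: "irr_mat_rep G m s"
    and ij: "i < n" "j < n" and pq: "p < m" "q < m"
  defines "S \<equiv> (\<Sum>g\<in>carrier G. s (inv\<^bsub>G\<^esub> g) $$ (p, q) * r g $$ (i, j))"
  shows schur_orthogonality_neq: "\<not> (m = n \<and> equiv_reps G n r s) \<Longrightarrow> S = 0"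
    and schur_orthogonality_eq: "m = n \<Longrightarrow> s = r \<Longrightarrow>
      S = (if p = j \<and> i = q then of_nat (card (carrier G)) / of_nat n else 0)"
proof -
  interpret group G by fact
  have rr: "mat_rep G n r" and ss: "mat_rep G m s" using r s by (auto simp: irr_mat_rep_def)
  define T where "T = mat m n (\<lambda>(p, j). \<Sum>g\<in>carrier G. s (inv\<^bsub>G\<^esub> g) $$ (p, q) * r g $$ (i, j))"
  have T: "T \<in> carrier_mat m n" by (simp add: T_def)
  have comm: "s h * T = T * r h" if h: "h \<in> carrier G" for h
  proof (rule eq_matI)
    note c = mat_repD(1)[OF ss h] mat_repD(1)[OF rr h] T
    fix p j assume "p < dim_row (T * r h)" "j < dim_col (T * r h)"
    then have p: "p < m" and j: "j < n" using c by auto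
    have "(s h * T) $$ (p, j) = (\<Sum>k<m. s h $$ (p, k) * (\<Sum>g\<in>carrier G. s (inv\<^bsub>G\<^esub> g) $$ (k, q) * r g $$ (i, j)))"
      using index_mult_mat_sum[OF c(1) T p j] j by (simp add: T_def)
    also have "\<dots> = (\<Sum>g\<in>carrier G. (\<Sum>k<m. s h $$ (p, k) * s (inv\<^bsub>G\<^esub> g) $$ (k, q)) * r g $$ (i, j))"
      unfolding sum_distrib_left sum_distrib_right by (subst sum.swap) (simp add: mult.assoc)
    also have "\<dots> = (\<Sum>g\<in>carrier G. s (h \<otimes>\<^bsub>G\<^esub> inv\<^bsub>G\<^esub> g) $$ (p, q) * r g $$ (i, j))"
      using h p pq by (intro sum.cong refl)
        (simp add: mat_repD(3)[OF ss] index_mult_mat_sum[OF mat_repD(1)[OF ss] mat_repD(1)[OF ss]])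
    also have "\<dots> = (\<Sum>g\<in>carrier G. s (inv\<^bsub>G\<^esub> g) $$ (p, q) * r (g \<otimes>\<^bsub>G\<^esub> h) $$ (i, j))"
    proof (rule sum.reindex_bij_witness[of _ "\<lambda>g. g \<otimes>\<^bsub>G\<^esub> h" "\<lambda>g. g \<otimes>\<^bsub>G\<^esub> inv\<^bsub>G\<^esub> h"])
      fix g assume g: "g \<in> carrier G"
      show "s (inv\<^bsub>G\<^esub> (g \<otimes>\<^bsub>G\<^esub> inv\<^bsub>G\<^esub> h)) $$ (p, q) * r (g \<otimes>\<^bsub>G\<^esub> inv\<^bsub>G\<^esub> h \<otimes>\<^bsub>G\<^esub> h) $$ (i, j) =
        s (h \<otimes>\<^bsub>G\<^esub> inv\<^bsub>G\<^esub> g) $$ (p, q) * r g $$ (i, j)"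
        using g h by (simp add: inv_mult_group m_assoc)
    qed (use h in \<open>auto simp: m_assoc\<close>)
    also have "\<dots> = (\<Sum>g\<in>carrier G. \<Sum>k<n. s (inv\<^bsub>G\<^esub> g) $$ (p, q) * (r g $$ (i, k) * r h $$ (k, j)))"
      using h j ij by (intro sum.cong refl)
        (simp add: mat_repD(3)[OF rr] index_mult_mat_sum[OF mat_repD(1)[OF rr] mat_repD(1)[OF rr]] sum_distrib_left)
    also have "\<dots> = (\<Sum>k<n. T $$ (p, k) * r h $$ (k, j))"
      using p by (subst sum.swap) (simp add: T_def sum_distrib_right mult.assoc)
    also have "\<dots> = (T * r h) $$ (p, j)" using index_mult_mat_sum[OF T c(2) p j] by simp
    finally show "(s h * T) $$ (p, j) = (T * r h) $$ (p, j)" .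
  qed (use T mat_repD(1)[OF ss h] mat_repD(1)[OF rr h] in auto)
  have ST: "S = T $$ (p, j)" using pq ij by (simp add: T_def S_def)
  show "S = 0" if "\<not> (m = n \<and> equiv_reps G n r s)"
  proof -
    have "T = 0\<^sub>m m n"
      using schur[OF r s T comm] that T comm unfolding equiv_reps_def by metis
    then show ?thesis using ST pq ij by simp
  qed
  show "S = (if p = j \<and> i = q then of_nat (card (carrier G)) / of_nat n else 0)"
    if mn: "m = n" and sr: "s = r"
  proof -
    have n: "n \<ge> 1" using r by (simp add: irr_mat_rep_def)
    from schur_scalar[OF r, of T] T comm mn sr obtain c where c: "T = c \<cdot>\<^sub>m 1\<^sub>m n" by auto
    \<comment> \<open>The scalar is read off from the trace: summing along the diagonal turns each
      summand into an entry of r(g g^-1), the identity matrix.\<close>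
    have "of_nat n * c = (\<Sum>k<n. T $$ (k, k))" by (simp add: c)
    also have "\<dots> = (\<Sum>g\<in>carrier G. \<Sum>k<n. r g $$ (i, k) * r (inv\<^bsub>G\<^esub> g) $$ (k, q))"
      unfolding T_def mn sr by (subst sum.swap) (simp add: mult.commute)
    also have "\<dots> = (\<Sum>g\<in>carrier G. r (g \<otimes>\<^bsub>G\<^esub> inv\<^bsub>G\<^esub> g) $$ (i, q))"
    proof (intro sum.cong refl)
      fix g assume "g \<in> carrier G"
      then have "r (g \<otimes>\<^bsub>G\<^esub> inv\<^bsub>G\<^esub> g) = r g * r (inv\<^bsub>G\<^esub> g)"
        by (intro mat_repD(3)[OF rr]) auto
      moreover from \<open>g \<in> carrier G\<close> have "r g \<in> carrier_mat n n" "r (inv\<^bsub>G\<^esub> g) \<in> carrier_mat n n"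
        using mat_repD(1)[OF rr] by auto
      ultimately show "(\<Sum>k<n. r g $$ (i, k) * r (inv\<^bsub>G\<^esub> g) $$ (k, q)) = r (g \<otimes>\<^bsub>G\<^esub> inv\<^bsub>G\<^esub> g) $$ (i, q)"
        using ij pq mn by (simp add: index_mult_mat_sum del: r_inv index_mult_mat)
    qed
    also have "\<dots> = (if i = q then of_nat (card (carrier G)) else 0)"
      using ij pq mn by (simp add: mat_repD(2)[OF rr])
    finally have "c = (if i = q then of_nat (card (carrier G)) / of_nat n else 0)"
      using n by (auto simp: field_simps)
    then show ?thesis using ST c pq ij mn by auto
  qed
qed

text \<open>Each \<open>Y k\<close> is a nonzero functional on matrices and so turns
  \<open>r k\<close> into a function on G, a combination of its coefficients. Orthogonality makes
  these functions linearly independent, while \<open>key\<close> says that all of them factor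
  through \<kappa>. With \<open>Y\<close> the identity they are the characters; a \<open>Y\<close>
  of rank one will give functions that are bi-invariant under a subgroup.\<close>

lemma card_irreps_le:
  assumes G: "group G" and fin: "finite (carrier G)" and I: "finite I"
    and irr: "\<And>k. k \<in> I \<Longrightarrow> irr_mat_rep G (n k) (r k)"
    and ineq: "\<And>k l. k \<in> I \<Longrightarrow> l \<in> I \<Longrightarrow> k \<noteq> l \<Longrightarrow> n k = n l \<Longrightarrow> \<not> equiv_reps G (n k) (r k) (r l)"
    and Y: "\<And>k. k \<in> I \<Longrightarrow> \<exists>i<n k. \<exists>j<n k. Y k i j \<noteq> 0"
    and key: "\<And>k g h. k \<in> I \<Longrightarrow> g \<in> carrier G \<Longrightarrow> h \<in> carrier G \<Longrightarrow> \<kappa> g = \<kappa> h \<Longrightarrow>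
      (\<Sum>i<n k. \<Sum>j<n k. r k g $$ (i, j) * Y k i j) = (\<Sum>i<n k. \<Sum>j<n k. r k h $$ (i, j) * Y k i j)"
  shows "card I \<le> card (\<kappa> ` carrier G)"
proof (rule ccontr)
  interpret group G by fact
  define f where "f k g = (\<Sum>i<n k. \<Sum>j<n k. r k g $$ (i, j) * Y k i j)" for k g
  define rep where "rep z = (SOME g. g \<in> carrier G \<and> \<kappa> g = z)" for z
  have rep: "rep (\<kappa> g) \<in> carrier G \<and> \<kappa> (rep (\<kappa> g)) = \<kappa> g" if "g \<in> carrier G" for g
    unfolding rep_def by (rule someI[of _ g]) (use that in auto)
  assume "\<not> card I \<le> card (\<kappa> ` carrier G)"
  then obtain c where c: "\<exists>k\<in>I. c k \<noteq> 0" "\<forall>z\<in>\<kappa> ` carrier G. (\<Sum>k\<in>I. c k * f k (rep z)) = 0"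
    using homogeneous_system_nontrivial[of "\<kappa> ` carrier G" I "\<lambda>k z. f k (rep z)"] fin I by auto
  have c0: "(\<Sum>k\<in>I. c k * f k g) = 0" if g: "g \<in> carrier G" for g
  proof -
    have "(\<Sum>k\<in>I. c k * f k g) = (\<Sum>k\<in>I. c k * f k (rep (\<kappa> g)))"
      unfolding f_def using rep[OF g] g by (intro sum.cong refl arg_cong2[of _ _ _ _ "(*)"] key) auto
    then show ?thesis using c(2) g by simp
  qed
  obtain l where l: "l \<in> I" "c l \<noteq> 0" using c(1) by blast
  obtain q p where qp: "q < n l" "p < n l" "Y l q p \<noteq> 0" using Y[OF l(1)] by blast
  \<comment> \<open>Multiplying the relation by the (p, q) coefficient of r_l(g^-1) and summing over
    g isolates the single entry \<open>Y l q p\<close>, chosen nonzero.\<close>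
  define orth where "orth k i j = (\<Sum>g\<in>carrier G. r l (inv\<^bsub>G\<^esub> g) $$ (p, q) * r k g $$ (i, j))" for k i j
  have o1: "orth k i j = 0" if "k \<in> I" "k \<noteq> l" "i < n k" "j < n k" for k i j
    unfolding orth_def
    by (rule schur_orthogonality_neq[OF G fin irr irr]) (use that l qp ineq[OF that(1) l(1)] in auto)
  have o2: "orth l i j = (if p = j \<and> i = q then of_nat (card (carrier G)) / of_nat (n l) else 0)"
    if "i < n l" "j < n l" for i j
    unfolding orth_def
    by (rule schur_orthogonality_eq[OF G fin irr irr]) (use that l qp in auto)
  have "0 = (\<Sum>g\<in>carrier G. r l (inv\<^bsub>G\<^esub> g) $$ (p, q) * (\<Sum>k\<in>I. c k * f k g))"
    by (simp add: c0)
  also have "\<dots> = (\<Sum>g\<in>carrier G. \<Sum>k\<in>I. c k * (\<Sum>i<n k. \<Sum>j<n k. (r l (inv\<^bsub>G\<^esub> g) $$ (p, q) * r k g $$ (i, j)) * Y k i j))"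
    unfolding f_def by (simp add: sum_distrib_left mult_ac)
  also have "\<dots> = (\<Sum>k\<in>I. c k * (\<Sum>g\<in>carrier G. \<Sum>i<n k. \<Sum>j<n k. (r l (inv\<^bsub>G\<^esub> g) $$ (p, q) * r k g $$ (i, j)) * Y k i j))"
    by (subst sum.swap) (simp add: sum_distrib_left)
  also have "\<dots> = (\<Sum>k\<in>I. c k * (\<Sum>i<n k. \<Sum>j<n k. orth k i j * Y k i j))"
  proof (intro sum.cong refl arg_cong2[of _ _ _ _ "(*)"])
    fix k
    show "(\<Sum>g\<in>carrier G. \<Sum>i<n k. \<Sum>j<n k. (r l (inv\<^bsub>G\<^esub> g) $$ (p, q) * r k g $$ (i, j)) * Y k i j)
      = (\<Sum>i<n k. \<Sum>j<n k. orth k i j * Y k i j)"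
      unfolding orth_def sum_distrib_right
      by (subst sum.swap, intro sum.cong refl, subst sum.swap, rule refl)
  qed
  also have "\<dots> = c l * (\<Sum>i<n l. \<Sum>j<n l. orth l i j * Y l i j)"
  proof -
    have "c k * (\<Sum>i<n k. \<Sum>j<n k. orth k i j * Y k i j) = 0" if "k \<in> I - {l}" for k
      using that o1[of k] by simp
    then have "(\<Sum>k\<in>I - {l}. c k * (\<Sum>i<n k. \<Sum>j<n k. orth k i j * Y k i j)) = 0"
      by (intro sum.neutral) auto
    then show ?thesis using I l(1) by (simp add: sum.remove)
  qed
  also have "(\<Sum>i<n l. \<Sum>j<n l. orth l i j * Y l i j) = of_nat (card (carrier G)) / of_nat (n l) * Y l q p"
  proof -
    have "(\<Sum>i<n l. \<Sum>j<n l. orth l i j * Y l i j) = (\<Sum>i<n l. \<Sum>j<n l. if j = p then if i = q then of_nat (card (carrier G)) / of_nat (n l) * Y l q p else 0 else 0)"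
      by (intro sum.cong refl) (auto simp: o2)
    also have "\<dots> = of_nat (card (carrier G)) / of_nat (n l) * Y l q p"
      using qp by simp
    finally show ?thesis .
  qed
  finally have "c l * (of_nat (card (carrier G)) / of_nat (n l) * Y l q p) = 0" by simp
  moreover have "card (carrier G) \<noteq> 0" using fin by auto
  ultimately show False using l qp by auto
qed

section \<open>Characters of commuting involutions\<close>

text \<open>Signs are coded by truth values so that a weight is a set of indices and multiplication
  of signs is exclusive or.\<close>

definition sg :: "bool \<Rightarrow> complex" where "sg s = (if s then -1 else 1)"

lemma sg_simps [simp]: "sg True = -1" "sg False = 1" "sg a * sg b = sg (a \<noteq> b)" "sg a \<noteq> 0"
  by (auto simp: sg_def)

lemma sg_inject [simp]: "sg a = sg b \<longleftrightarrow> a = b"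
  by (auto simp: sg_def)

lemma smult_vec_eq_cancel:
  fixes v :: "'a::field vec"
  assumes "v \<in> carrier_vec d" "v \<noteq> 0\<^sub>v d" "a \<cdot>\<^sub>v v = b \<cdot>\<^sub>v v"
  shows "a = b"
proof -
  obtain i where "i < d" "v $ i \<noteq> 0" using assms(1,2) by (metis carrier_vecD eq_vecI index_zero_vec)
  moreover from this have "(a \<cdot>\<^sub>v v) $ i = (b \<cdot>\<^sub>v v) $ i" using assms by simp
  ultimately show ?thesis using assms(1) by simp
qed

text \<open>The last clause keeps what has been achieved before: any eigenvalue that a matrix
  commuting with the family has at v is inherited by w. The vector is adjusted to one involution at
  a time, replacing w by w + g w unless g w = -w.\<close>

lemma common_eigenvector:
  fixes g :: "'i \<Rightarrow> complex mat"
  assumes "finite I" and v: "v \<in> carrier_vec d" "v \<noteq> 0\<^sub>v d"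
    and "\<And>i. i \<in> I \<Longrightarrow> g i \<in> carrier_mat d d" "\<And>i. i \<in> I \<Longrightarrow> g i * g i = 1\<^sub>m d"
    and "\<And>i j. i \<in> I \<Longrightarrow> j \<in> I \<Longrightarrow> g i * g j = g j * g i"
  shows "\<exists>w\<in>carrier_vec d. w \<noteq> 0\<^sub>v d \<and> (\<forall>i\<in>I. \<exists>s. g i *\<^sub>v w = sg s \<cdot>\<^sub>v w) \<and>
    (\<forall>h c. h \<in> carrier_mat d d \<longrightarrow> (\<forall>i\<in>I. h * g i = g i * h) \<longrightarrow> h *\<^sub>v v = c \<cdot>\<^sub>v v \<longrightarrow> h *\<^sub>v w = c \<cdot>\<^sub>v w)"
  using assms(1,4-)
proof (induction I rule: finite_induct)
  case empty
  then show ?case using v by auto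
next
  case (insert i I)
  from insert.IH insert.prems obtain w where w: "w \<in> carrier_vec d" "w \<noteq> 0\<^sub>v d"
    "\<And>i. i \<in> I \<Longrightarrow> \<exists>s. g i *\<^sub>v w = sg s \<cdot>\<^sub>v w"
    "\<And>h c. h \<in> carrier_mat d d \<Longrightarrow> (\<And>i. i \<in> I \<Longrightarrow> h * g i = g i * h) \<Longrightarrow> h *\<^sub>v v = c \<cdot>\<^sub>v v \<Longrightarrow> h *\<^sub>v w = c \<cdot>\<^sub>v w"
    by (metis insert_iff)
  have gi: "g i \<in> carrier_mat d d" "g i * g i = 1\<^sub>m d" using insert.prems by auto
  show ?case
  proof (cases "g i *\<^sub>v w = - w")
    case True
    then have "g i *\<^sub>v w = sg True \<cdot>\<^sub>v w" by auto
    then show ?thesis using w by (intro bexI[of _ w]) blast+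
  next
    case False
    define u where "u = w + g i *\<^sub>v w"
    have u: "u \<in> carrier_vec d" using w(1) gi by (auto simp: u_def)
    have gw: "g i *\<^sub>v w \<in> carrier_vec d" using w(1) gi by auto
    have u0: "u \<noteq> 0\<^sub>v d"
    proof
      assume u0: "u = 0\<^sub>v d"
      have "(g i *\<^sub>v w) $ k = (- w) $ k" if "k < d" for k
      proof -
        have "u $ k = 0" using u0 that by simp
        then have "w $ k + (g i *\<^sub>v w) $ k = 0" using gw that unfolding u_def
          by (metis carrier_vecD index_add_vec(1))
        then show ?thesis using w(1) that by (simp add: eq_neg_iff_add_eq_0 add.commute)
      qed
      then have "g i *\<^sub>v w = - w" using gw w(1) gi(1) by (intro eq_vecI) auto
      with False show False ..
    qed
    have eig: "h *\<^sub>v u = c \<cdot>\<^sub>v u" if h: "h \<in> carrier_mat d d" "h * g i = g i * h" "h *\<^sub>v w = c \<cdot>\<^sub>v w" for h c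
    proof -
      have "h *\<^sub>v (g i *\<^sub>v w) = g i *\<^sub>v (h *\<^sub>v w)" using h gi w(1) by (metis assoc_mult_mat_vec)
      also have "\<dots> = c \<cdot>\<^sub>v (g i *\<^sub>v w)" unfolding h(3) by (rule mult_mat_vec[OF gi(1) w(1)])
      finally show ?thesis unfolding u_def using h(1,3) w(1) gw
        by (simp add: mult_add_distrib_mat_vec smult_add_distrib_vec)
    qed
    have giu: "g i *\<^sub>v u = sg False \<cdot>\<^sub>v u"
    proof -
      have "g i *\<^sub>v (g i *\<^sub>v w) = w" using gi w(1) by (metis assoc_mult_mat_vec one_mult_mat_vec)
      then show ?thesis unfolding u_def using gi(1) w(1) gw
        by (auto simp: mult_add_distrib_mat_vec comm_add_vec)
    qed
    show ?thesis
    proof (intro bexI[of _ u] conjI u u0 ballI allI impI)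
      fix k assume "k \<in> insert i I"
      then show "\<exists>s. g k *\<^sub>v u = sg s \<cdot>\<^sub>v u"
        using giu eig[of "g k"] w(3)[of k] insert.prems by (cases "k = i") (metis insert_iff)+
    next
      fix h c assume "h \<in> carrier_mat d d" "\<forall>k\<in>insert i I. h * g k = g k * h" "h *\<^sub>v v = c \<cdot>\<^sub>v v"
      then show "h *\<^sub>v u = c \<cdot>\<^sub>v u" using eig w(4) by auto
    qed
  qed
qed

text \<open>Eigenvectors with distinct systems of signs are linearly independent, since a relation
  of least support could be shortened.\<close>

lemma card_weights_le:
  fixes g :: "'i \<Rightarrow> complex mat" and v :: "'k \<Rightarrow> complex vec"
  assumes K: "finite K" and g: "\<And>i. i \<in> I \<Longrightarrow> g i \<in> carrier_mat d d"
    and v: "\<And>k. k \<in> K \<Longrightarrow> v k \<in> carrier_vec d" "\<And>k. k \<in> K \<Longrightarrow> v k \<noteq> 0\<^sub>v d"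
    and eig: "\<And>k i. k \<in> K \<Longrightarrow> i \<in> I \<Longrightarrow> g i *\<^sub>v v k = sg (\<sigma> k i) \<cdot>\<^sub>v v k"
    and sep: "\<And>k l. k \<in> K \<Longrightarrow> l \<in> K \<Longrightarrow> k \<noteq> l \<Longrightarrow> \<exists>i\<in>I. \<sigma> k i \<noteq> \<sigma> l i"
  shows "card K \<le> d"
proof (rule ccontr)
  define rel where "rel c \<longleftrightarrow> (\<exists>k\<in>K. c k \<noteq> 0) \<and> (\<forall>j<d. (\<Sum>k\<in>K. c k * v k $ j) = 0)" for c
  assume "\<not> card K \<le> d"
  then obtain c0 where "rel c0"
    using homogeneous_system_nontrivial[of "{..<d}" K "\<lambda>k j. v k $ j"] K by (auto simp: rel_def)
  from ex_has_least_nat[of rel c0 "\<lambda>c. card {k \<in> K. c k \<noteq> 0}", OF this]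
  obtain c where c: "rel c" "\<And>c'. rel c' \<Longrightarrow> card {k \<in> K. c k \<noteq> 0} \<le> card {k \<in> K. c' k \<noteq> 0}" by blast
  obtain k where k: "k \<in> K" "c k \<noteq> 0" using c(1) by (auto simp: rel_def)
  obtain l where l: "l \<in> K" "c l \<noteq> 0" "l \<noteq> k"
  proof (rule ccontr)
    assume "\<not> thesis"
    then have o: "c m = 0" if "m \<in> K" "m \<noteq> k" for m using that \<open>\<And>l. l \<in> K \<Longrightarrow> c l \<noteq> 0 \<Longrightarrow> l \<noteq> k \<Longrightarrow> thesis\<close> by blast
    have "v k $ j = 0" if "j < d" for j
    proof -
      have "0 = (\<Sum>m\<in>K. c m * v m $ j)" using c(1) that by (simp add: rel_def)
      also have "\<dots> = (\<Sum>m\<in>K. if m = k then c k * v k $ j else 0)" by (intro sum.cong) (auto simp: o)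
      also have "\<dots> = c k * v k $ j" using K k by simp
      finally show ?thesis using k by simp
    qed
    then have "v k = 0\<^sub>v d" using v(1)[OF k(1)] by (intro eq_vecI) auto
    then show False using v(2)[OF k(1)] by simp
  qed
  obtain i where i: "i \<in> I" "\<sigma> k i \<noteq> \<sigma> l i" using sep[OF k(1) l(1)] l(3) by blast
  \<comment> \<open>Applying g i to the relation and subtracting its multiple by the sign of k
    removes the term k and keeps the term l, whose sign differs.\<close>
  define c' where "c' m = c m * (sg (\<sigma> m i) - sg (\<sigma> k i))" for m
  have "rel c'"
    unfolding rel_def
  proof (intro conjI bexI[of _ l] allI impI)
    show "c' l \<noteq> 0" using l i by (simp add: c'_def)
    fix j assume j: "j < d"
    have "(\<Sum>m\<in>K. c m * sg (\<sigma> m i) * v m $ j) = (\<Sum>m\<in>K. c m * (g i *\<^sub>v v m) $ j)"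
    proof (intro sum.cong refl)
      fix m assume "m \<in> K"
      then show "c m * sg (\<sigma> m i) * v m $ j = c m * (g i *\<^sub>v v m) $ j"
        using eig[OF _ i(1)] carrier_vecD[OF v(1)] j by simp
    qed
    also have "\<dots> = (\<Sum>m\<in>K. \<Sum>p<d. g i $$ (j, p) * (c m * v m $ p))"
      using index_mult_vec_sum[OF g[OF i(1)] v(1) j] by (simp add: sum_distrib_left mult_ac)
    also have "\<dots> = (\<Sum>p<d. g i $$ (j, p) * (\<Sum>m\<in>K. c m * v m $ p))"
      by (subst sum.swap) (simp add: sum_distrib_left)
    also have "\<dots> = 0" using c(1) by (simp add: rel_def)
    finally have "(\<Sum>m\<in>K. c m * sg (\<sigma> m i) * v m $ j) = 0" .
    moreover have "(\<Sum>m\<in>K. c m * sg (\<sigma> k i) * v m $ j) = sg (\<sigma> k i) * (\<Sum>m\<in>K. c m * v m $ j)"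
      by (simp add: sum_distrib_left mult_ac)
    ultimately show "(\<Sum>m\<in>K. c' m * v m $ j) = 0"
      using c(1) j by (simp add: c'_def rel_def algebra_simps sum_subtractf)
  qed (rule l(1))
  from c(2)[OF this] have "card {k \<in> K. c k \<noteq> 0} \<le> card {k \<in> K. c' k \<noteq> 0}" .
  moreover have "{m \<in> K. c' m \<noteq> 0} \<subset> {k \<in> K. c k \<noteq> 0}" using k by (auto simp: c'_def)
  then have "card {m \<in> K. c' m \<noteq> 0} < card {k \<in> K. c k \<noteq> 0}" using K by (intro psubset_card_mono) auto
  ultimately show False by simp
qed

text \<open>At most d weights occur, so there are at most 2^d possible sets of weights on which an
  involution is -1, and two of the involutions share this set. Instead of diagonalising, such a pair
  is shown to be equal by finding, if not, a common eigenvector on which their product is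
  -1.\<close>

lemma commuting_involutions_pigeonhole:
  fixes g :: "nat \<Rightarrow> complex mat"
  assumes n: "2 ^ d < n" and g: "\<And>i. i < n \<Longrightarrow> g i \<in> carrier_mat d d"
    and inv: "\<And>i. i < n \<Longrightarrow> g i * g i = 1\<^sub>m d"
    and comm: "\<And>i j. i < n \<Longrightarrow> j < n \<Longrightarrow> g i * g j = g j * g i"
  shows "\<exists>i<n. \<exists>j<n. i \<noteq> j \<and> g i = g j"
proof (rule ccontr)
  assume neg: "\<not> ?thesis"
  define wt where "wt S w \<longleftrightarrow> w \<in> carrier_vec d \<and> w \<noteq> 0\<^sub>v d \<and> (\<forall>i<n. g i *\<^sub>v w = sg (i \<in> S) \<cdot>\<^sub>v w)" for S w
  define \<Lambda> where "\<Lambda> = {S. S \<subseteq> {..<n} \<and> (\<exists>w. wt S w)}"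
  have fin: "finite \<Lambda>" by (rule finite_subset[of _ "Pow {..<n}"]) (auto simp: \<Lambda>_def)
  have "\<forall>S\<in>\<Lambda>. \<exists>w. wt S w" by (auto simp: \<Lambda>_def)
  then obtain w where w: "\<And>S. S \<in> \<Lambda> \<Longrightarrow> wt S (w S)" by metis
  have "card \<Lambda> \<le> d"
    using fin g w by (intro card_weights_le[of \<Lambda> "{..<n}" g d w "\<lambda>S i. i \<in> S"]) (auto simp: wt_def \<Lambda>_def)
  have "\<not> inj_on (\<lambda>i. {S \<in> \<Lambda>. i \<in> S}) {..<n}"
  proof
    assume "inj_on (\<lambda>i. {S \<in> \<Lambda>. i \<in> S}) {..<n}"
    then have "card {..<n} \<le> card (Pow \<Lambda>)" using fin by (intro card_inj_on_le) auto
    also have "\<dots> \<le> 2 ^ d" using fin \<open>card \<Lambda> \<le> d\<close> by (simp add: card_Pow)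
    finally show False using n by simp
  qed
  then obtain i j where ij: "i < n" "j < n" "i \<noteq> j" "{S \<in> \<Lambda>. i \<in> S} = {S \<in> \<Lambda>. j \<in> S}"
    by (auto simp: inj_on_def)
  have "g i \<noteq> g j" using neg ij by blast
  then obtain k where k: "k < d" "col (g i) k \<noteq> col (g j) k"
    using g[OF ij(1)] g[OF ij(2)] by (metis carrier_matD mat_col_eqI)
  \<comment> \<open>The product g i g j exchanges the k-th columns of g i and g j, so their
    difference is a nonzero vector with eigenvalue -1.\<close>
  define u where "u = col (g i) k - col (g j) k"
  note gi = g[OF ij(1)] and gj = g[OF ij(2)]
  have c: "col (g i) k \<in> carrier_vec d" "col (g j) k \<in> carrier_vec d" using gi gj by auto
  have u: "u \<in> carrier_vec d" using c by (simp add: u_def)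
  have u0: "u \<noteq> 0\<^sub>v d"
  proof
    assume u0: "u = 0\<^sub>v d"
    have "col (g i) k $ l = col (g j) k $ l" if "l < d" for l
    proof -
      have "u $ l = 0" using u0 that by simp
      then show ?thesis using c that unfolding u_def by (metis carrier_vecD eq_iff_diff_eq_0 index_minus_vec(1))
    qed
    then have "col (g i) k = col (g j) k" using c gi gj by (intro eq_vecI) auto
    with k show False by simp
  qed
  have ii: "g i *\<^sub>v col (g i) k = unit_vec d k"
    using gi k inv[OF ij(1)] by (metis carrier_matD(2) col_mult2 col_one)
  have jj: "g j *\<^sub>v col (g j) k = unit_vec d k"
    using gj k inv[OF ij(2)] by (metis carrier_matD(2) col_mult2 col_one)
  have ge: "g i *\<^sub>v unit_vec d k = col (g i) k" "g j *\<^sub>v unit_vec d k = col (g j) k"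
    using gi gj k by (auto intro!: eq_vecI)
  have hu: "(g i * g j) *\<^sub>v u = (-1) \<cdot>\<^sub>v u"
  proof -
    have "(g i * g j) *\<^sub>v col (g j) k = col (g i) k" using gi gj c jj ge by simp
    moreover have "(g i * g j) *\<^sub>v col (g i) k = col (g j) k"
      unfolding comm[OF ij(1,2)] using gi gj c ii ge by simp
    ultimately have "(g i * g j) *\<^sub>v u = col (g j) k - col (g i) k"
      unfolding u_def using gi gj c by (subst mult_minus_distrib_mat_vec[of _ d d]) auto
    also have "\<dots> = (-1) \<cdot>\<^sub>v u" unfolding u_def using c gi gj by (intro eq_vecI) auto
    finally show ?thesis .
  qed
  have hc: "(g i * g j) * g m = g m * (g i * g j)" if "m < n" for m
  proof -
    have "(g i * g j) * g m = g i * (g m * g j)" using gi gj g[OF that] comm[OF ij(2) that] by simp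
    also have "\<dots> = (g m * g i) * g j" using assoc_mult_mat[OF gi g[OF that] gj] comm[OF ij(1) that] by simp
    also have "\<dots> = g m * (g i * g j)" using gi gj g[OF that] by simp
    finally show ?thesis .
  qed
  obtain z where z: "z \<in> carrier_vec d" "z \<noteq> 0\<^sub>v d" "\<And>i. i < n \<Longrightarrow> \<exists>s. g i *\<^sub>v z = sg s \<cdot>\<^sub>v z"
    "(g i * g j) *\<^sub>v z = (-1) \<cdot>\<^sub>v z"
  proof -
    have "\<exists>w\<in>carrier_vec d. w \<noteq> 0\<^sub>v d \<and> (\<forall>i\<in>{..<n}. \<exists>s. g i *\<^sub>v w = sg s \<cdot>\<^sub>v w) \<and>
      (\<forall>h c. h \<in> carrier_mat d d \<longrightarrow> (\<forall>i\<in>{..<n}. h * g i = g i * h) \<longrightarrow> h *\<^sub>v u = c \<cdot>\<^sub>v u \<longrightarrow> h *\<^sub>v w = c \<cdot>\<^sub>v w)"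
      by (rule common_eigenvector[OF _ u u0]) (use g inv comm in auto)
    then obtain w where w: "w \<in> carrier_vec d" "w \<noteq> 0\<^sub>v d" "\<forall>i\<in>{..<n}. \<exists>s. g i *\<^sub>v w = sg s \<cdot>\<^sub>v w"
      "\<forall>h c. h \<in> carrier_mat d d \<longrightarrow> (\<forall>i\<in>{..<n}. h * g i = g i * h) \<longrightarrow> h *\<^sub>v u = c \<cdot>\<^sub>v u \<longrightarrow> h *\<^sub>v w = c \<cdot>\<^sub>v w"
      by blast
    have "(g i * g j) *\<^sub>v w = (-1) \<cdot>\<^sub>v w"
      using w(4)[rule_format, OF mult_carrier_mat[OF gi gj] hc hu] by simp
    then show ?thesis using w by (intro that[of w]) auto
  qed
  obtain \<sigma> where \<sigma>: "\<And>i. i < n \<Longrightarrow> g i *\<^sub>v z = sg (\<sigma> i) \<cdot>\<^sub>v z" using z(3) by metis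
  have "wt {i. i < n \<and> \<sigma> i} z" using z(1,2) \<sigma> by (auto simp: wt_def)
  then have "{i. i < n \<and> \<sigma> i} \<in> \<Lambda>" by (auto simp: \<Lambda>_def)
  moreover have "{i. i < n \<and> \<sigma> i} \<in> {S \<in> \<Lambda>. i \<in> S} \<longleftrightarrow> {i. i < n \<and> \<sigma> i} \<in> {S \<in> \<Lambda>. j \<in> S}"
    unfolding ij(4) ..
  ultimately have "\<sigma> i = \<sigma> j" using ij(1,2) by simp
  have "(g i * g j) *\<^sub>v z = sg (\<sigma> i) \<cdot>\<^sub>v (sg (\<sigma> j) \<cdot>\<^sub>v z)"
    using gi gj z(1) \<sigma>[OF ij(1)] \<sigma>[OF ij(2)] by (simp add: mult_mat_vec smult_smult_assoc mult.commute)
  also have "\<dots> = 1 \<cdot>\<^sub>v z" using \<open>\<sigma> i = \<sigma> j\<close> by (simp add: smult_smult_assoc)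
  finally have "(-1::complex) = 1" using z by (intro smult_vec_eq_cancel[OF z(1,2)]) auto
  then show False by simp
qed

lemma common_eigenvectorE:
  fixes g :: "'i \<Rightarrow> complex mat"
  assumes "finite I" "v \<in> carrier_vec d" "v \<noteq> 0\<^sub>v d"
    and "\<And>i. i \<in> I \<Longrightarrow> g i \<in> carrier_mat d d" "\<And>i. i \<in> I \<Longrightarrow> g i * g i = 1\<^sub>m d"
    and "\<And>i j. i \<in> I \<Longrightarrow> j \<in> I \<Longrightarrow> g i * g j = g j * g i"
  obtains w s where "w \<in> carrier_vec d" "w \<noteq> 0\<^sub>v d" "\<And>i. i \<in> I \<Longrightarrow> g i *\<^sub>v w = sg (s i) \<cdot>\<^sub>v w"
    and "\<And>h c. h \<in> carrier_mat d d \<Longrightarrow> (\<And>i. i \<in> I \<Longrightarrow> h * g i = g i * h) \<Longrightarrow> h *\<^sub>v v = c \<cdot>\<^sub>v v \<Longrightarrow> h *\<^sub>v w = c \<cdot>\<^sub>v w"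
proof -
  from common_eigenvector[of I v d g, OF assms] obtain w where w: "w \<in> carrier_vec d" and
    "w \<noteq> 0\<^sub>v d \<and> (\<forall>i\<in>I. \<exists>s. g i *\<^sub>v w = sg s \<cdot>\<^sub>v w) \<and>
    (\<forall>h c. h \<in> carrier_mat d d \<longrightarrow> (\<forall>i\<in>I. h * g i = g i * h) \<longrightarrow> h *\<^sub>v v = c \<cdot>\<^sub>v v \<longrightarrow> h *\<^sub>v w = c \<cdot>\<^sub>v w)"
    by (rule bexE)
  then have w': "w \<noteq> 0\<^sub>v d" "\<forall>i\<in>I. \<exists>s. g i *\<^sub>v w = sg s \<cdot>\<^sub>v w"
    "\<forall>h c. h \<in> carrier_mat d d \<longrightarrow> (\<forall>i\<in>I. h * g i = g i * h) \<longrightarrow> h *\<^sub>v v = c \<cdot>\<^sub>v v \<longrightarrow> h *\<^sub>v w = c \<cdot>\<^sub>v w"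
    by simp_all
  from bchoice[OF w'(2)] obtain s where "\<forall>i\<in>I. g i *\<^sub>v w = sg (s i) \<cdot>\<^sub>v w" by (rule exE)
  then show thesis using w w'(1,3) by (intro that[of w s]) simp_all
qed

section \<open>Fixed vectors from the Steinberg relations\<close>

text \<open>The rank argument uses only the Steinberg relations over the field with two elements and
  conjugation by transpositions of coordinates. Every root subgroup has order two there, so the
  commutator relation is written without inverses.\<close>

locale steinberg =
  fixes N d :: nat and t :: "nat \<Rightarrow> nat \<Rightarrow> complex mat"
  assumes carrier: "\<And>i j. i < N \<Longrightarrow> j < N \<Longrightarrow> i \<noteq> j \<Longrightarrow> t i j \<in> carrier_mat d d"
    and involution: "\<And>i j. i < N \<Longrightarrow> j < N \<Longrightarrow> i \<noteq> j \<Longrightarrow> t i j * t i j = 1\<^sub>m d"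
    and commute: "\<And>i j k l. i < N \<Longrightarrow> j < N \<Longrightarrow> k < N \<Longrightarrow> l < N \<Longrightarrow> i \<noteq> j \<Longrightarrow> k \<noteq> l \<Longrightarrow> j \<noteq> k \<Longrightarrow> i \<noteq> l
      \<Longrightarrow> t i j * t k l = t k l * t i j"
    and commutator: "\<And>i j k. i < N \<Longrightarrow> j < N \<Longrightarrow> k < N \<Longrightarrow> i \<noteq> j \<Longrightarrow> j \<noteq> k \<Longrightarrow> i \<noteq> k
      \<Longrightarrow> t i j * t j k = t j k * (t i j * t i k)"
    and transposition: "\<And>a b. a < N \<Longrightarrow> b < N \<Longrightarrow> \<exists>P\<in>carrier_mat d d. P * P = 1\<^sub>m d \<and>
      (\<forall>i<N. \<forall>j<N. i \<noteq> j \<longrightarrow> P * t i j = t (transpose a b i) (transpose a b j) * P)"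
begin

section \<open>The Steinberg relations acting on vectors\<close>

lemma act_carrier [simp]: "i < N \<Longrightarrow> j < N \<Longrightarrow> i \<noteq> j \<Longrightarrow> v \<in> carrier_vec d \<Longrightarrow> t i j *\<^sub>v v \<in> carrier_vec d"
  using carrier by (meson mult_mat_vec_carrier)

lemma act_involution [simp]:
  "i < N \<Longrightarrow> j < N \<Longrightarrow> i \<noteq> j \<Longrightarrow> v \<in> carrier_vec d \<Longrightarrow> t i j *\<^sub>v (t i j *\<^sub>v v) = v"
  by (metis assoc_mult_mat_vec carrier involution one_mult_mat_vec)

lemma act_commute:
  assumes "i < N" "j < N" "k < N" "l < N" "i \<noteq> j" "k \<noteq> l" "j \<noteq> k" "i \<noteq> l" "v \<in> carrier_vec d"
  shows "t i j *\<^sub>v (t k l *\<^sub>v v) = t k l *\<^sub>v (t i j *\<^sub>v v)"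
  using assms commute carrier by (metis assoc_mult_mat_vec)

lemma act_commutator:
  assumes "i < N" "j < N" "k < N" "i \<noteq> j" "j \<noteq> k" "i \<noteq> k" "v \<in> carrier_vec d"
  shows "t i j *\<^sub>v (t j k *\<^sub>v v) = t j k *\<^sub>v (t i j *\<^sub>v (t i k *\<^sub>v v))"
proof -
  note c = carrier[OF assms(1,2,4)] carrier[OF assms(2,3,5)] carrier[OF assms(1,3,6)]
  have "t i j *\<^sub>v (t j k *\<^sub>v v) = (t i j * t j k) *\<^sub>v v"
    using assoc_mult_mat_vec[OF c(1,2) assms(7)] by simp
  also have "\<dots> = (t j k * (t i j * t i k)) *\<^sub>v v" using commutator assms by simp
  also have "\<dots> = t j k *\<^sub>v ((t i j * t i k) *\<^sub>v v)"
    by (rule assoc_mult_mat_vec[OF c(2) mult_carrier_mat[OF c(1,3)] assms(7)])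
  also have "(t i j * t i k) *\<^sub>v v = t i j *\<^sub>v (t i k *\<^sub>v v)"
    by (rule assoc_mult_mat_vec[OF c(1,3) assms(7)])
  finally show ?thesis .
qed

lemma act_commutator':
  assumes a: "i < N" "j < N" "k < N" "i \<noteq> j" "j \<noteq> k" "i \<noteq> k" and v: "v \<in> carrier_vec d"
  shows "t j k *\<^sub>v (t i j *\<^sub>v v) = t i j *\<^sub>v (t j k *\<^sub>v (t i k *\<^sub>v v))"
proof -
  have "t i j *\<^sub>v (t j k *\<^sub>v (t i k *\<^sub>v v)) = t j k *\<^sub>v (t i j *\<^sub>v (t i k *\<^sub>v (t i k *\<^sub>v v)))"
    using a v by (intro act_commutator) auto
  then show ?thesis using a v by simp
qed

lemma act_smult:
  "i < N \<Longrightarrow> j < N \<Longrightarrow> i \<noteq> j \<Longrightarrow> v \<in> carrier_vec d \<Longrightarrow> t i j *\<^sub>v (c \<cdot>\<^sub>v v) = c \<cdot>\<^sub>v (t i j *\<^sub>v v)"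
  using carrier by (metis mult_mat_vec)

lemma act_nonzero:
  assumes "i < N" "j < N" "i \<noteq> j" "v \<in> carrier_vec d" "v \<noteq> 0\<^sub>v d"
  shows "t i j *\<^sub>v v \<noteq> 0\<^sub>v d"
proof
  assume "t i j *\<^sub>v v = 0\<^sub>v d"
  moreover have "0\<^sub>v d = 0 \<cdot>\<^sub>v v" using assms(4) by (intro eq_vecI) auto
  moreover have "0 \<cdot>\<^sub>v (t i j *\<^sub>v v) = 0\<^sub>v d" using act_carrier[OF assms(1-4)] carrier[OF assms(1-3)] by (intro eq_vecI) auto
  ultimately have "t i j *\<^sub>v (t i j *\<^sub>v v) = t i j *\<^sub>v (0 \<cdot>\<^sub>v v)" by simp
  also have "\<dots> = 0 \<cdot>\<^sub>v (t i j *\<^sub>v v)" using assms by (intro act_smult) auto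
  finally show False using assms \<open>0 \<cdot>\<^sub>v (t i j *\<^sub>v v) = 0\<^sub>v d\<close> by simp
qed

text \<open>The pairs of coordinates \<open>(2 * j + 1, 2 * j)\<close>, \<open>j < r\<close>, carry a character of rank \<open>r\<close> on
  the abelian group of unipotent matrices mapping the even coordinates to the odd ones.\<close>

definition nondegenerate_weight :: "nat \<Rightarrow> complex vec \<Rightarrow> bool" where
  "nondegenerate_weight r v \<longleftrightarrow> v \<in> carrier_vec d \<and> v \<noteq> 0\<^sub>v d \<and>
     (\<forall>j<r. \<forall>l<r. t (2 * j + 1) (2 * l) *\<^sub>v v = sg (j = l) \<cdot>\<^sub>v v)"

text \<open>The elements mapping the coordinates c >= 2r to the odd ones commute with each other and
  with the nondegenerate block. Their signs b form a further character, which the elements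
  \<open>t c (2 * j)\<close> move around while fixing the block.\<close>

definition extended_weight :: "nat \<Rightarrow> (nat \<times> nat \<Rightarrow> bool) \<Rightarrow> complex vec \<Rightarrow> bool" where
  "extended_weight r b v \<longleftrightarrow> nondegenerate_weight r v \<and>
     (\<forall>j<r. \<forall>c. 2 * r \<le> c \<longrightarrow> c < N \<longrightarrow> t (2 * j + 1) c *\<^sub>v v = sg (b (j, c)) \<cdot>\<^sub>v v)"

lemma extended_weight_exists:
  assumes N: "2 * r \<le> N" and v: "nondegenerate_weight r v"
  shows "\<exists>b w. extended_weight r b w"
proof -
  define I where "I = {..<r} \<times> {2 * r..<N}"
  have v': "v \<in> carrier_vec d" "v \<noteq> 0\<^sub>v d" using v by (auto simp: nondegenerate_weight_def)
  obtain w b where w: "w \<in> carrier_vec d" "w \<noteq> 0\<^sub>v d"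
    and b: "\<And>i. i \<in> I \<Longrightarrow> (case i of (j, c) \<Rightarrow> t (2 * j + 1) c) *\<^sub>v w = sg (b i) \<cdot>\<^sub>v w"
    and w': "\<And>h c. h \<in> carrier_mat d d \<Longrightarrow> (\<And>i. i \<in> I \<Longrightarrow> h * (case i of (j, c) \<Rightarrow> t (2 * j + 1) c) = (case i of (j, c) \<Rightarrow> t (2 * j + 1) c) * h)
      \<Longrightarrow> h *\<^sub>v v = c \<cdot>\<^sub>v v \<Longrightarrow> h *\<^sub>v w = c \<cdot>\<^sub>v w"
  proof (rule common_eigenvectorE[of I v d "\<lambda>(j, c). t (2 * j + 1) c"])
    show "finite I" by (simp add: I_def)
  next
    fix i assume i: "i \<in> I"
    then show "(case i of (j, c) \<Rightarrow> t (2 * j + 1) c) \<in> carrier_mat d d"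
      by (cases i) (auto simp: I_def intro!: carrier)
    from i show "(case i of (j, c) \<Rightarrow> t (2 * j + 1) c) * (case i of (j, c) \<Rightarrow> t (2 * j + 1) c) = 1\<^sub>m d"
      by (cases i) (auto simp: I_def intro!: involution)
  next
    fix i k assume "i \<in> I" "k \<in> I"
    then show "(case i of (j, c) \<Rightarrow> t (2 * j + 1) c) * (case k of (j, c) \<Rightarrow> t (2 * j + 1) c) =
      (case k of (j, c) \<Rightarrow> t (2 * j + 1) c) * (case i of (j, c) \<Rightarrow> t (2 * j + 1) c)"
      by (cases i; cases k) (auto simp: I_def intro!: commute)
  qed (use v' in auto)
  have "t (2 * j + 1) (2 * l) *\<^sub>v w = sg (j = l) \<cdot>\<^sub>v w" if jl: "j < r" "l < r" for j l
  proof (rule w')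
    show "t (2 * j + 1) (2 * l) \<in> carrier_mat d d" using jl N by (intro carrier) presburger+
    fix i assume "i \<in> I"
    then show "t (2 * j + 1) (2 * l) * (case i of (j, c) \<Rightarrow> t (2 * j + 1) c) =
      (case i of (j, c) \<Rightarrow> t (2 * j + 1) c) * t (2 * j + 1) (2 * l)"
      using jl N by (cases i) (auto simp: I_def intro!: commute, presburger+)
  next
    show "t (2 * j + 1) (2 * l) *\<^sub>v v = sg (j = l) \<cdot>\<^sub>v v"
      using v jl by (auto simp: nondegenerate_weight_def)
  qed
  moreover have "t (2 * j + 1) c *\<^sub>v w = sg (b (j, c)) \<cdot>\<^sub>v w" if "j < r" "2 * r \<le> c" "c < N" for j c
    using b[of "(j, c)"] that by (simp add: I_def)
  ultimately have "extended_weight r b w" using w(1,2) by (auto simp: extended_weight_def nondegenerate_weight_def)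
  then show ?thesis by blast
qed

text \<open>Moving \<open>t (2 * l + 1) c0\<close> past \<open>t c0 (2 * j0)\<close> produces
  \<open>t (2 * l + 1) (2 * j0)\<close>, whose sign on v is -1 exactly for l = j0. Hence precisely
  the sign at (j0, c0) changes.\<close>

lemma extended_weight_flip:
  assumes v: "extended_weight r b v" and jc: "j0 < r" "2 * r \<le> c0" "c0 < N"
  shows "extended_weight r (\<lambda>x. b x \<noteq> (x = (j0, c0))) (t c0 (2 * j0) *\<^sub>v v)"
proof -
  have v': "v \<in> carrier_vec d" "v \<noteq> 0\<^sub>v d"
    and e1: "\<And>j l. j < r \<Longrightarrow> l < r \<Longrightarrow> t (2 * j + 1) (2 * l) *\<^sub>v v = sg (j = l) \<cdot>\<^sub>v v"
    and e2: "\<And>j c. j < r \<Longrightarrow> 2 * r \<le> c \<Longrightarrow> c < N \<Longrightarrow> t (2 * j + 1) c *\<^sub>v v = sg (b (j, c)) \<cdot>\<^sub>v v"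
    using v by (auto simp: extended_weight_def nondegenerate_weight_def)
  have other: "t (2 * l + 1) x *\<^sub>v (t c0 (2 * j0) *\<^sub>v v) = s \<cdot>\<^sub>v (t c0 (2 * j0) *\<^sub>v v)"
    if "l < r" "x < N" "x \<noteq> c0" "x \<noteq> 2 * l + 1" "t (2 * l + 1) x *\<^sub>v v = s \<cdot>\<^sub>v v" for l x s
  proof -
    have "t (2 * l + 1) x *\<^sub>v (t c0 (2 * j0) *\<^sub>v v) = t c0 (2 * j0) *\<^sub>v (t (2 * l + 1) x *\<^sub>v v)"
      using that jc v' by (intro act_commute) (auto, presburger+)
    also have "\<dots> = s \<cdot>\<^sub>v (t c0 (2 * j0) *\<^sub>v v)" unfolding that(5)
      using that jc v' by (intro act_smult) auto
    finally show ?thesis .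
  qed
  have same: "t (2 * l + 1) c0 *\<^sub>v (t c0 (2 * j0) *\<^sub>v v) = sg (b (l, c0) \<noteq> (l = j0)) \<cdot>\<^sub>v (t c0 (2 * j0) *\<^sub>v v)"
    if l: "l < r" for l
  proof -
    have "t (2 * l + 1) c0 *\<^sub>v (t c0 (2 * j0) *\<^sub>v v) =
      t c0 (2 * j0) *\<^sub>v (t (2 * l + 1) c0 *\<^sub>v (t (2 * l + 1) (2 * j0) *\<^sub>v v))"
      using l jc v' by (intro act_commutator) (auto, presburger+)
    also have "t (2 * l + 1) (2 * j0) *\<^sub>v v = sg (l = j0) \<cdot>\<^sub>v v" using e1 l jc by simp
    also have "t (2 * l + 1) c0 *\<^sub>v (sg (l = j0) \<cdot>\<^sub>v v) = sg (l = j0) \<cdot>\<^sub>v (t (2 * l + 1) c0 *\<^sub>v v)"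
      using l jc v' by (intro act_smult) auto
    also have "t (2 * l + 1) c0 *\<^sub>v v = sg (b (l, c0)) \<cdot>\<^sub>v v" using e2 l jc by simp
    also have "sg (l = j0) \<cdot>\<^sub>v (sg (b (l, c0)) \<cdot>\<^sub>v v) = sg (b (l, c0) \<noteq> (l = j0)) \<cdot>\<^sub>v v"
      by (auto simp: smult_smult_assoc)
    also have "t c0 (2 * j0) *\<^sub>v (sg (b (l, c0) \<noteq> (l = j0)) \<cdot>\<^sub>v v) = sg (b (l, c0) \<noteq> (l = j0)) \<cdot>\<^sub>v (t c0 (2 * j0) *\<^sub>v v)"
      using l jc v' by (intro act_smult) auto
    finally show ?thesis .
  qed
  show ?thesis
    unfolding extended_weight_def nondegenerate_weight_def
  proof (intro conjI allI impI)
    show "t c0 (2 * j0) *\<^sub>v v \<in> carrier_vec d" using jc v' by simp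
    show "t c0 (2 * j0) *\<^sub>v v \<noteq> 0\<^sub>v d" using jc v' by (intro act_nonzero) auto
  next
    fix j l assume "j < r" "l < r"
    then show "t (2 * j + 1) (2 * l) *\<^sub>v (t c0 (2 * j0) *\<^sub>v v) = sg (j = l) \<cdot>\<^sub>v (t c0 (2 * j0) *\<^sub>v v)"
      using jc e1 by (intro other) (auto, presburger)
  next
    fix j c assume a: "j < r" "2 * r \<le> c" "c < N"
    show "t (2 * j + 1) c *\<^sub>v (t c0 (2 * j0) *\<^sub>v v) = sg (b (j, c) \<noteq> ((j, c) = (j0, c0))) \<cdot>\<^sub>v (t c0 (2 * j0) *\<^sub>v v)"
    proof (cases "c = c0")
      case True
      then show ?thesis using same[OF a(1)] by simp
    next
      case False
      then show ?thesis using other[OF a(1) a(3) False _ e2[OF a]] a by simp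
    qed
  qed
qed

lemma extended_weight_all:
  assumes "2 * r \<le> N" "nondegenerate_weight r v"
  shows "\<exists>w. extended_weight r b w"
proof -
  obtain b0 w0 where 0: "extended_weight r b0 w0" using extended_weight_exists[OF assms] by blast
  have "D \<subseteq> {..<r} \<times> {2 * r..<N} \<Longrightarrow> \<exists>w. extended_weight r (\<lambda>x. b0 x \<noteq> (x \<in> D)) w" if "finite D" for D
    using that
  proof (induction D rule: finite_induct)
    case empty
    then show ?case using 0 by auto
  next
    case (insert x D)
    then obtain w where "extended_weight r (\<lambda>x. b0 x \<noteq> (x \<in> D)) w" by auto
    then have "extended_weight r (\<lambda>y. (b0 y \<noteq> (y \<in> D)) \<noteq> (y = (fst x, snd x))) (t (snd x) (2 * fst x) *\<^sub>v w)"
      using insert.prems by (intro extended_weight_flip) auto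
    moreover have "(\<lambda>y. (b0 y \<noteq> (y \<in> D)) \<noteq> (y = (fst x, snd x))) = (\<lambda>y. b0 y \<noteq> (y \<in> insert x D))"
      using insert.hyps by (intro ext) (metis insert_iff prod.collapse)
    ultimately show ?case by auto
  qed
  from this[of "{x \<in> {..<r} \<times> {2 * r..<N}. b0 x \<noteq> b x}"]
  obtain w where "extended_weight r (\<lambda>x. b0 x \<noteq> (x \<in> {x \<in> {..<r} \<times> {2 * r..<N}. b0 x \<noteq> b x})) w" by auto
  then have "extended_weight r b w" by (auto simp: extended_weight_def)
  then show ?thesis by blast
qed

text \<open>By flips all sign patterns on the block of r times N - 2r places occur, and different
  patterns are different weights.\<close>

lemma nondegenerate_weight_dim:
  assumes N: "2 * r \<le> N" and v: "nondegenerate_weight r v"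
  shows "2 ^ (r * (N - 2 * r)) \<le> d"
proof -
  define I where "I = {..<r} \<times> {2 * r..<N}"
  obtain w where w: "\<And>B. extended_weight r (\<lambda>x. x \<in> B) (w B)"
  proof -
    have "\<forall>B. \<exists>w. extended_weight r (\<lambda>x. x \<in> B) w" using extended_weight_all[OF N v] by blast
    from choice[OF this] show thesis using that by blast
  qed
  have "card (Pow I) \<le> d"
  proof (rule card_weights_le[where g = "\<lambda>(j, c). t (2 * j + 1) c" and I = I and v = w and \<sigma> = "\<lambda>B x. x \<in> B"])
    fix i assume "i \<in> I"
    then show "(case i of (j, c) \<Rightarrow> t (2 * j + 1) c) \<in> carrier_mat d d"
      by (cases i) (auto simp: I_def intro!: carrier)
  next
    fix B i assume "i \<in> I"
    then show "(case i of (j, c) \<Rightarrow> t (2 * j + 1) c) *\<^sub>v w B = sg (i \<in> B) \<cdot>\<^sub>v w B"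
      using w[of B] by (cases i) (simp add: I_def extended_weight_def)
  next
    fix B C assume BC: "B \<in> Pow I" "C \<in> Pow I" "B \<noteq> C"
    then obtain x where "x \<in> B \<and> x \<notin> C \<or> x \<in> C \<and> x \<notin> B" by blast
    then show "\<exists>i\<in>I. (i \<in> B) \<noteq> (i \<in> C)" using BC by (intro bexI[of _ x]) blast+
  next
    fix B
    show "w B \<in> carrier_vec d" "w B \<noteq> 0\<^sub>v d"
      using w[of B] by (simp_all add: extended_weight_def nondegenerate_weight_def)
  next
    show "finite (Pow I)" by (simp add: I_def)
  qed
  then show ?thesis by (simp add: I_def card_Pow)
qed

text \<open>Completes a block of rank r to rank r + 1. The new column has the right signs already;
  the first r places of the new row are arbitrary, so they are first diagonalised and then cleared
  by row operations.\<close>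

lemma nondegenerate_weight_step:
  assumes N: "2 * r + 2 \<le> N"
    and w: "w \<in> carrier_vec d" "w \<noteq> 0\<^sub>v d"
    and e: "\<And>j l. j < r \<Longrightarrow> l \<le> r \<Longrightarrow> t (2 * j + 1) (2 * l) *\<^sub>v w = sg (j = l) \<cdot>\<^sub>v w"
    and er: "t (2 * r + 1) (2 * r) *\<^sub>v w = sg True \<cdot>\<^sub>v w"
  shows "\<exists>v. nondegenerate_weight (Suc r) v"
proof -
  define st where "st s w \<longleftrightarrow> w \<in> carrier_vec d \<and> w \<noteq> 0\<^sub>v d \<and>
    (\<forall>j<r. \<forall>l\<le>r. t (2 * j + 1) (2 * l) *\<^sub>v w = sg (j = l) \<cdot>\<^sub>v w) \<and>
    (\<forall>l\<le>r. t (2 * r + 1) (2 * l) *\<^sub>v w = sg (s l) \<cdot>\<^sub>v w)" for s w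
  obtain u s0 where u: "u \<in> carrier_vec d" "u \<noteq> 0\<^sub>v d"
    and s0: "\<And>i. i \<in> {..<r} \<Longrightarrow> t (2 * r + 1) (2 * i) *\<^sub>v u = sg (s0 i) \<cdot>\<^sub>v u"
    and u': "\<And>h c. h \<in> carrier_mat d d \<Longrightarrow> (\<And>i. i \<in> {..<r} \<Longrightarrow> h * t (2 * r + 1) (2 * i) = t (2 * r + 1) (2 * i) * h)
      \<Longrightarrow> h *\<^sub>v w = c \<cdot>\<^sub>v w \<Longrightarrow> h *\<^sub>v u = c \<cdot>\<^sub>v u"
  proof (rule common_eigenvectorE[of "{..<r}" w d "\<lambda>i. t (2 * r + 1) (2 * i)"])
    fix i j assume "i \<in> {..<r}" "j \<in> {..<r}"
    then have "2 * r + 1 < N" "2 * i < N" "2 * j < N" using N by auto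
    moreover have "2 * r + 1 \<noteq> 2 * i" "2 * r + 1 \<noteq> 2 * j" "2 * i \<noteq> 2 * r + 1" "2 * j \<noteq> 2 * r + 1" by presburger+
    ultimately show "t (2 * r + 1) (2 * i) * t (2 * r + 1) (2 * j) = t (2 * r + 1) (2 * j) * t (2 * r + 1) (2 * i)"
      by (intro commute) assumption+
  next
    fix i assume "i \<in> {..<r}"
    then have "2 * r + 1 < N" "2 * i < N" using N by auto
    moreover have "2 * r + 1 \<noteq> 2 * i" by presburger
    ultimately show "t (2 * r + 1) (2 * i) \<in> carrier_mat d d" "t (2 * r + 1) (2 * i) * t (2 * r + 1) (2 * i) = 1\<^sub>m d"
      by (simp_all add: carrier involution del: One_nat_def)
  qed (use w in auto)
  define s1 where "s1 = s0(r := True)"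
  have t_comm: "t (2 * j + 1) (2 * l) * t (2 * r + 1) (2 * i) = t (2 * r + 1) (2 * i) * t (2 * j + 1) (2 * l)"
    if "j \<le> r" "l \<le> r" "i < r" for i j l
    using that N by (intro commute) presburger+
  have t_carrier: "t (2 * j + 1) (2 * l) \<in> carrier_mat d d" if "j \<le> r" "l \<le> r" for j l
    using that N by (intro carrier) presburger+
  have "t (2 * j + 1) (2 * l) *\<^sub>v u = sg (j = l) \<cdot>\<^sub>v u" if "j < r" "l \<le> r" for j l
    using that by (intro u' e t_carrier t_comm) auto
  moreover have "t (2 * r + 1) (2 * r) *\<^sub>v u = sg True \<cdot>\<^sub>v u"
    by (intro u' er t_carrier t_comm) auto
  ultimately have st1: "st s1 u" using u(1,2) s0 by (auto simp: st_def s1_def)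
  \<comment> \<open>Row operation: \<open>t (2 * l0 + 1) (2 * r + 1)\<close> multiplies the sign at
    (2r + 1, 2l) by the sign at (2 l0 + 1, 2l), which is -1 only for l = l0.\<close>
  have flip: "st (\<lambda>l. s l \<noteq> (l = l0)) (t (2 * l0 + 1) (2 * r + 1) *\<^sub>v v)" if st: "st s v" and l0: "l0 < r" for s v l0
  proof -
    have v: "v \<in> carrier_vec d" "v \<noteq> 0\<^sub>v d" using st by (auto simp: st_def)
    have lt: "2 * l0 + 1 < N" "2 * r + 1 < N" "2 * l0 + 1 \<noteq> 2 * r + 1" using N l0 by auto
    have "t (2 * j + 1) (2 * l) *\<^sub>v (t (2 * l0 + 1) (2 * r + 1) *\<^sub>v v) = sg (j = l) \<cdot>\<^sub>v (t (2 * l0 + 1) (2 * r + 1) *\<^sub>v v)"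
      if jl: "j < r" "l \<le> r" for j l
    proof -
      have "t (2 * j + 1) (2 * l) *\<^sub>v (t (2 * l0 + 1) (2 * r + 1) *\<^sub>v v) = t (2 * l0 + 1) (2 * r + 1) *\<^sub>v (t (2 * j + 1) (2 * l) *\<^sub>v v)"
        using jl l0 N v by (intro act_commute) (auto, presburger+)
      also have "t (2 * j + 1) (2 * l) *\<^sub>v v = sg (j = l) \<cdot>\<^sub>v v" using st jl by (auto simp: st_def)
      also have "t (2 * l0 + 1) (2 * r + 1) *\<^sub>v (sg (j = l) \<cdot>\<^sub>v v) = sg (j = l) \<cdot>\<^sub>v (t (2 * l0 + 1) (2 * r + 1) *\<^sub>v v)"
        using lt v by (intro act_smult) auto
      finally show ?thesis .
    qed
    moreover have "t (2 * r + 1) (2 * l) *\<^sub>v (t (2 * l0 + 1) (2 * r + 1) *\<^sub>v v) = sg (s l \<noteq> (l = l0)) \<cdot>\<^sub>v (t (2 * l0 + 1) (2 * r + 1) *\<^sub>v v)"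
      if l: "l \<le> r" for l
    proof -
      have l': "2 * l < N" "2 * l \<noteq> 2 * r + 1" "2 * l \<noteq> 2 * l0 + 1" using l N by (auto, presburger+)
      have "t (2 * r + 1) (2 * l) *\<^sub>v (t (2 * l0 + 1) (2 * r + 1) *\<^sub>v v) =
        t (2 * l0 + 1) (2 * r + 1) *\<^sub>v (t (2 * r + 1) (2 * l) *\<^sub>v (t (2 * l0 + 1) (2 * l) *\<^sub>v v))"
        using l' lt v by (intro act_commutator') auto
      also have "t (2 * l0 + 1) (2 * l) *\<^sub>v v = sg (l = l0) \<cdot>\<^sub>v v"
        using st l l0 by (auto simp: st_def eq_commute)
      also have "t (2 * r + 1) (2 * l) *\<^sub>v (sg (l = l0) \<cdot>\<^sub>v v) = sg (l = l0) \<cdot>\<^sub>v (t (2 * r + 1) (2 * l) *\<^sub>v v)"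
        using l' lt v by (intro act_smult) auto
      also have "t (2 * r + 1) (2 * l) *\<^sub>v v = sg (s l) \<cdot>\<^sub>v v" using st l by (auto simp: st_def)
      also have "sg (l = l0) \<cdot>\<^sub>v (sg (s l) \<cdot>\<^sub>v v) = sg (s l \<noteq> (l = l0)) \<cdot>\<^sub>v v"
        by (auto simp: smult_smult_assoc)
      also have "t (2 * l0 + 1) (2 * r + 1) *\<^sub>v (sg (s l \<noteq> (l = l0)) \<cdot>\<^sub>v v) = sg (s l \<noteq> (l = l0)) \<cdot>\<^sub>v (t (2 * l0 + 1) (2 * r + 1) *\<^sub>v v)"
        using lt v by (intro act_smult) auto
      finally show ?thesis .
    qed
    ultimately show ?thesis using lt v act_nonzero[OF lt v] by (auto simp: st_def)
  qed
  have "D \<subseteq> {..<r} \<Longrightarrow> \<exists>v. st (\<lambda>l. s1 l \<noteq> (l \<in> D)) v" if "finite D" for D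
    using that
  proof (induction D rule: finite_induct)
    case empty
    then show ?case using st1 by auto
  next
    case (insert x D)
    then obtain v where "st (\<lambda>l. s1 l \<noteq> (l \<in> D)) v" by auto
    from flip[OF this, of x] insert.prems have "\<exists>v. st (\<lambda>l. (s1 l \<noteq> (l \<in> D)) \<noteq> (l = x)) v" by auto
    moreover have "(\<lambda>l. (s1 l \<noteq> (l \<in> D)) \<noteq> (l = x)) = (\<lambda>l. s1 l \<noteq> (l \<in> insert x D))"
      using insert.hyps by auto
    ultimately show ?case by simp
  qed
  from this[of "{l. l < r \<and> s1 l}"] obtain v where v: "st (\<lambda>l. s1 l \<noteq> (l \<in> {l. l < r \<and> s1 l})) v" by auto
  have "nondegenerate_weight (Suc r) v"
    unfolding nondegenerate_weight_def
  proof (intro conjI allI impI)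
    fix j l assume "j < Suc r" "l < Suc r"
    then consider "j < r" "l \<le> r" | "j = r" "l < r" | "j = r" "l = r" by linarith
    then show "t (2 * j + 1) (2 * l) *\<^sub>v v = sg (j = l) \<cdot>\<^sub>v v"
      using v by cases (auto simp: st_def s1_def)
  qed (use v in \<open>auto simp: st_def\<close>)
  then show ?thesis by blast
qed

text \<open>If \<open>t c e\<close> moved v, then u = t c e v - v would have eigenvalue -1 under it
  and still carry the block of rank r with trivial signs to its right. A permutation of coordinates
  moving (c, e) to (2r + 1, 2r) would make it a weight of rank r + 1, against maximality.\<close>

lemma extended_weight_fixed:
  assumes N: "2 * r \<le> N" and max: "2 * r + 2 \<le> N \<Longrightarrow> \<nexists>v. nondegenerate_weight (Suc r) v"
    and v: "extended_weight r (\<lambda>_. False) v"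
    and cd: "2 * r \<le> c" "c < N" "2 * r \<le> e" "e < N" "c \<noteq> e"
  shows "t c e *\<^sub>v v = v"
proof (rule ccontr)
  assume neq: "t c e *\<^sub>v v \<noteq> v"
  have v': "v \<in> carrier_vec d" "v \<noteq> 0\<^sub>v d"
    and e1: "\<And>j l. j < r \<Longrightarrow> l < r \<Longrightarrow> t (2 * j + 1) (2 * l) *\<^sub>v v = sg (j = l) \<cdot>\<^sub>v v"
    and e2: "\<And>j c. j < r \<Longrightarrow> 2 * r \<le> c \<Longrightarrow> c < N \<Longrightarrow> t (2 * j + 1) c *\<^sub>v v = v"
    using v by (auto simp: extended_weight_def nondegenerate_weight_def)
  define u where "u = t c e *\<^sub>v v - v"
  have tv: "t c e *\<^sub>v v \<in> carrier_vec d" using cd v' by simp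
  have u: "u \<in> carrier_vec d" using tv v' by (simp add: u_def)
  have u0: "u \<noteq> 0\<^sub>v d"
  proof
    assume u0: "u = 0\<^sub>v d"
    have "(t c e *\<^sub>v v) $ k = v $ k" if "k < d" for k
    proof -
      have "u $ k = 0" using u0 that by simp
      then show ?thesis using v' that unfolding u_def by (metis carrier_vecD eq_iff_diff_eq_0 index_minus_vec(1))
    qed
    moreover have "dim_vec (t c e *\<^sub>v v) = d" using tv carrier_vecD by blast
    ultimately have "t c e *\<^sub>v v = v" using v' by (intro eq_vecI) auto
    with neq show False by simp
  qed
  have act_u: "t i j *\<^sub>v u = t i j *\<^sub>v (t c e *\<^sub>v v) - t i j *\<^sub>v v" if "i < N" "j < N" "i \<noteq> j" for i j
    unfolding u_def using carrier[OF that] tv v' by (intro mult_minus_distrib_mat_vec)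
  have uce: "t c e *\<^sub>v u = sg True \<cdot>\<^sub>v u"
  proof -
    have "t c e *\<^sub>v u = v - t c e *\<^sub>v v" using act_u cd v' by simp
    also have "\<dots> = sg True \<cdot>\<^sub>v u" unfolding u_def using tv v' carrier[OF cd(2,4,5)] by (intro eq_vecI) (auto simp: sg_def)
    finally show ?thesis .
  qed
  have eig_u: "t (2 * j + 1) x *\<^sub>v u = sg (x = 2 * j) \<cdot>\<^sub>v u"
    if jx: "j < r" "x < N" "x \<in> (\<lambda>l. 2 * l) ` {..<r} \<union> {2 * r..<N}" for j x
  proof -
    have x1: "x \<noteq> 2 * j + 1" using jx by (auto, presburger)
    have xv: "t (2 * j + 1) x *\<^sub>v v = sg (x = 2 * j) \<cdot>\<^sub>v v"
      using jx e1 e2 by auto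
    have "t (2 * j + 1) x *\<^sub>v (t c e *\<^sub>v v) = t c e *\<^sub>v (t (2 * j + 1) x *\<^sub>v v)"
    proof (cases "x = c")
      case False
      then show ?thesis using jx x1 cd v' by (intro act_commute) auto
    next
      \<comment> \<open>Here the commutator contributes the factor \<open>t (2 * j + 1) e\<close>,
        which fixes v because the signs outside the block are trivial.\<close>
      case True
      have "t (2 * j + 1) c *\<^sub>v (t c e *\<^sub>v v) = t c e *\<^sub>v (t (2 * j + 1) c *\<^sub>v (t (2 * j + 1) e *\<^sub>v v))"
        using jx cd v' by (intro act_commutator) auto
      also have "t (2 * j + 1) e *\<^sub>v v = v" using e2 jx cd by simp
      finally show ?thesis using True by simp
    qed
    then have "t (2 * j + 1) x *\<^sub>v u = sg (x = 2 * j) \<cdot>\<^sub>v (t c e *\<^sub>v v) - sg (x = 2 * j) \<cdot>\<^sub>v v"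
      using act_u[of "2 * j + 1" x] jx x1 cd N v' xv act_smult[of c e v] by auto
    also have "\<dots> = sg (x = 2 * j) \<cdot>\<^sub>v u"
      unfolding u_def using tv v' carrier[OF cd(2,4,5)] by (intro eq_vecI) (auto simp: right_diff_distrib)
    finally show ?thesis .
  qed
  have N2: "2 * r + 2 \<le> N" using cd by linarith
  \<comment> \<open>\<open>e'\<close> is the place to which the first transposition takes e (it is c
    when e = 2r + 1). The second transposition then takes it to 2r without moving 2r + 1 or any
    index below 2r.\<close>
  define e' where "e' = transpose c (2 * r + 1) e"
  have e': "e' \<noteq> 2 * r + 1" "e' < N" "2 * r \<le> e'" using cd N2 by (auto simp: e'_def transpose_def)
  define \<pi> where "\<pi> x = transpose e' (2 * r) (transpose c (2 * r + 1) x)" for x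
  have \<pi>: "\<pi> c = 2 * r + 1" "\<pi> e = 2 * r" "\<And>x. x < 2 * r \<Longrightarrow> \<pi> x = x" "\<And>x. \<pi> x = 2 * r \<Longrightarrow> x = e"
    using e' cd N2 by (auto simp: \<pi>_def e'_def transpose_def split: if_splits)
  obtain P1 where P1: "P1 \<in> carrier_mat d d" "P1 * P1 = 1\<^sub>m d"
    "\<And>i j. i < N \<Longrightarrow> j < N \<Longrightarrow> i \<noteq> j \<Longrightarrow> P1 * t i j = t (transpose c (2 * r + 1) i) (transpose c (2 * r + 1) j) * P1"
    using transposition[of c "2 * r + 1"] cd N2 by auto
  obtain P2 where P2: "P2 \<in> carrier_mat d d" "P2 * P2 = 1\<^sub>m d"
    "\<And>i j. i < N \<Longrightarrow> j < N \<Longrightarrow> i \<noteq> j \<Longrightarrow> P2 * t i j = t (transpose e' (2 * r) i) (transpose e' (2 * r) j) * P2"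
    using transposition[of e' "2 * r"] e' N2 by auto
  define w where "w = P2 *\<^sub>v (P1 *\<^sub>v u)"
  have w: "w \<in> carrier_vec d" using P1(1) P2(1) u by (simp add: w_def)
  have "P1 *\<^sub>v (P2 *\<^sub>v w) = u" unfolding w_def using P1(1,2) P2(1,2) u
    by (metis assoc_mult_mat_vec mult_mat_vec_carrier one_mult_mat_vec)
  moreover have "P1 *\<^sub>v (P2 *\<^sub>v 0\<^sub>v d) = 0\<^sub>v d"
  proof -
    have "P *\<^sub>v 0\<^sub>v d = 0\<^sub>v d" if "P \<in> carrier_mat d d" for P :: "complex mat"
      using that by auto
    then show ?thesis using P1 P2 by simp
  qed
  ultimately have w0: "w \<noteq> 0\<^sub>v d" using u0 by metis
  have move: "t (\<pi> i) (\<pi> j) *\<^sub>v w = s \<cdot>\<^sub>v w" if ij: "i < N" "j < N" "i \<noteq> j" "t i j *\<^sub>v u = s \<cdot>\<^sub>v u" for i j s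
  proof -
    define i' j' where "i' = transpose c (2 * r + 1) i" "j' = transpose c (2 * r + 1) j"
    have ij': "i' < N" "j' < N" "i' \<noteq> j'" using ij cd N2 by (auto simp: i'_j'_def transpose_def)
    have ij'': "\<pi> i < N" "\<pi> j < N" "\<pi> i \<noteq> \<pi> j" using ij' e' N2 by (auto simp: i'_j'_def \<pi>_def transpose_def split: if_splits)
    note cs = carrier[OF ij(1-3)] carrier[OF ij'] carrier[OF ij''] P1(1) P2(1) u
    have "t i' j' *\<^sub>v (P1 *\<^sub>v u) = P1 *\<^sub>v (t i j *\<^sub>v u)"
      using P1(3)[OF ij(1-3)] cs unfolding i'_j'_def by (metis assoc_mult_mat_vec)
    also have "\<dots> = s \<cdot>\<^sub>v (P1 *\<^sub>v u)" unfolding ij(4) using cs by (intro mult_mat_vec)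
    finally have 1: "t i' j' *\<^sub>v (P1 *\<^sub>v u) = s \<cdot>\<^sub>v (P1 *\<^sub>v u)" .
    have "t (\<pi> i) (\<pi> j) *\<^sub>v w = P2 *\<^sub>v (t i' j' *\<^sub>v (P1 *\<^sub>v u))"
    proof -
      have P1u: "P1 *\<^sub>v u \<in> carrier_vec d" using cs by simp
      have "t (\<pi> i) (\<pi> j) * P2 = P2 * t i' j'" using P2(3)[OF ij'] by (simp add: \<pi>_def i'_j'_def)
      then have "t (\<pi> i) (\<pi> j) *\<^sub>v (P2 *\<^sub>v (P1 *\<^sub>v u)) = (P2 * t i' j') *\<^sub>v (P1 *\<^sub>v u)"
        using assoc_mult_mat_vec[OF cs(3,5) P1u] by simp
      then show ?thesis using assoc_mult_mat_vec[OF cs(5,2) P1u] by (simp add: w_def)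
    qed
    also have "\<dots> = s \<cdot>\<^sub>v w" unfolding 1 w_def using cs by (intro mult_mat_vec) auto
    finally show ?thesis .
  qed
  have "\<exists>v. nondegenerate_weight (Suc r) v"
  proof (rule nondegenerate_weight_step[OF N2 w w0])
    show "t (2 * r + 1) (2 * r) *\<^sub>v w = sg True \<cdot>\<^sub>v w" using move[OF cd(2,4,5) uce] unfolding \<pi>(1,2) .
    fix j l assume jl: "j < r" "l \<le> r"
    show "t (2 * j + 1) (2 * l) *\<^sub>v w = sg (j = l) \<cdot>\<^sub>v w"
    proof (cases "l = r")
      case True
      have "t (\<pi> (2 * j + 1)) (\<pi> e) *\<^sub>v w = sg (e = 2 * j) \<cdot>\<^sub>v w"
        using jl cd N2 by (intro move eig_u) auto
      moreover have "\<pi> (2 * j + 1) = 2 * j + 1" using jl by (intro \<pi>(3)) simp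
      moreover have "e \<noteq> 2 * j" "j \<noteq> l" using jl cd True by auto
      ultimately show ?thesis using True \<pi>(2) by simp
    next
      case False
      have "t (\<pi> (2 * j + 1)) (\<pi> (2 * l)) *\<^sub>v w = sg (2 * l = 2 * j) \<cdot>\<^sub>v w"
        using jl False N2 by (intro move eig_u) (auto, presburger)
      moreover have "\<pi> (2 * j + 1) = 2 * j + 1" "\<pi> (2 * l) = 2 * l" using jl False by (intro \<pi>(3); simp)+
      moreover have "(2 * l = 2 * j) = (j = l)" by auto
      ultimately show ?thesis by simp
    qed
  qed
  then show False using max[OF N2] by blast
qed

text \<open>Rank 0 always occurs and the dimension excludes rank m + 1, so some rank r <= m occurs
  while r + 1 does not. Its weight with trivial signs outside the block is then fixed by all root
  elements with both indices at least 2r.\<close>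

theorem small_dim_fixed_vector:
  assumes d: "1 \<le> d" and N: "2 * (m + 1) \<le> N" and dim: "d < 2 ^ ((m + 1) * (N - 2 * (m + 1)))"
  shows "\<exists>v\<in>carrier_vec d. v \<noteq> 0\<^sub>v d \<and>
    (\<forall>c e. 2 * m \<le> c \<longrightarrow> c < N \<longrightarrow> 2 * m \<le> e \<longrightarrow> e < N \<longrightarrow> c \<noteq> e \<longrightarrow> t c e *\<^sub>v v = v)"
proof -
  define Q where "Q r \<longleftrightarrow> (\<exists>v. nondegenerate_weight r v)" for r
  have "unit_vec d 0 \<noteq> (0\<^sub>v d :: complex vec)" using d by auto
  then have Q0: "Q 0" unfolding Q_def nondegenerate_weight_def by (intro exI[of _ "unit_vec d 0"]) auto
  have nQ: "\<not> Q (m + 1)" using nondegenerate_weight_dim[OF N] dim by (auto simp: Q_def)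
  have "\<exists>r\<le>m. Q r \<and> \<not> Q (Suc r)"
  proof (rule ccontr)
    assume "\<not> ?thesis"
    then have "r \<le> m + 1 \<Longrightarrow> Q r" for r by (induction r) (use Q0 in auto)
    then show False using nQ by simp
  qed
  then obtain r where r: "r \<le> m" "Q r" "\<not> Q (Suc r)" by blast
  have rN: "2 * r \<le> N" using r N by simp
  from r(2) obtain v0 where "nondegenerate_weight r v0" by (auto simp: Q_def)
  from extended_weight_all[OF rN this] obtain v where v: "extended_weight r (\<lambda>_. False) v" by blast
  have "t c e *\<^sub>v v = v" if "2 * m \<le> c" "c < N" "2 * m \<le> e" "e < N" "c \<noteq> e" for c e
    by (rule extended_weight_fixed[OF rN _ v]) (use r(1,3) that in \<open>auto simp: Q_def\<close>)
  then show ?thesis using v by (intro bexI[of _ v]) (auto simp: extended_weight_def nondegenerate_weight_def)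
qed

end

section \<open>Transvections and double cosets over the field with two elements\<close>

definition GL :: "nat \<Rightarrow> bit mat monoid" where
  "GL n = \<lparr>carrier = {A \<in> carrier_mat n n. invertible_mat A}, mult = (*), one = 1\<^sub>m n\<rparr>"

lemma GL_simps [simp]: "mult (GL n) = (*)" "one (GL n) = 1\<^sub>m n"
  by (simp_all add: GL_def)

lemma GL_carrier_mat: "A \<in> carrier (GL n) \<Longrightarrow> A \<in> carrier_mat n n"
  by (simp add: GL_def)

lemma GL_I: "A \<in> carrier_mat n n \<Longrightarrow> B \<in> carrier_mat n n \<Longrightarrow> A * B = 1\<^sub>m n \<Longrightarrow> A \<in> carrier (GL n)"
  using mat_mult_left_right_inverse[of A n B] by (auto simp: GL_def intro: invertible_matI)

lemma GL_I': "A \<in> carrier_mat n n \<Longrightarrow> B \<in> carrier_mat n n \<Longrightarrow> B * A = 1\<^sub>m n \<Longrightarrow> A \<in> carrier (GL n)"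
  using mat_mult_left_right_inverse[of B n A] by (auto simp: GL_def intro: invertible_matI)

lemma GL_E:
  assumes "A \<in> carrier (GL n)"
  obtains B where "B \<in> carrier (GL n)" "A * B = 1\<^sub>m n" "B * A = 1\<^sub>m n"
proof -
  have A: "A \<in> carrier_mat n n" "invertible_mat A" using assms by (auto simp: GL_def)
  then obtain B where B: "A * B = 1\<^sub>m n" "B * A = 1\<^sub>m (dim_row B)"
    unfolding invertible_mat_def inverts_mat_def by auto
  have "B \<in> carrier_mat n n"
  proof (rule carrier_matI)
    show "dim_col B = n" using arg_cong[OF B(1), of dim_col] by simp
    show "dim_row B = n" using arg_cong[OF B(2), of dim_col] A(1) by simp
  qed
  then show ?thesis using that[of B] B A GL_I'[of B n A] by simp
qed

lemma GL_one [simp]: "1\<^sub>m n \<in> carrier (GL n)"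
  by (rule GL_I[of _ _ "1\<^sub>m n"]) auto

lemma GL_mult: "A \<in> carrier (GL n) \<Longrightarrow> B \<in> carrier (GL n) \<Longrightarrow> A * B \<in> carrier (GL n)"
proof -
  assume A: "A \<in> carrier (GL n)" and B: "B \<in> carrier (GL n)"
  obtain A' B' where i: "A' \<in> carrier (GL n)" "A * A' = 1\<^sub>m n" "B' \<in> carrier (GL n)" "B * B' = 1\<^sub>m n"
    using GL_E[OF A] GL_E[OF B] by metis
  note c = A B i(1,3)
  note c = c[THEN GL_carrier_mat]
  have "A * B * (B' * A') = A * ((B * B') * A')"
    using c assoc_mult_mat[OF c(1,2) mult_carrier_mat[OF c(4,3)]] assoc_mult_mat[OF c(2,4,3)] by simp
  also have "\<dots> = 1\<^sub>m n" using c i by simp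
  finally show ?thesis using c by (intro GL_I[of _ _ "B' * A'"]) auto
qed

lemma GL_group: "group (GL n)"
proof (rule groupI)
  fix A assume "A \<in> carrier (GL n)"
  then show "\<exists>B\<in>carrier (GL n). B \<otimes>\<^bsub>GL n\<^esub> A = \<one>\<^bsub>GL n\<^esub>" by (auto elim: GL_E)
next
  fix A B C assume "A \<in> carrier (GL n)" "B \<in> carrier (GL n)" "C \<in> carrier (GL n)"
  then show "A \<otimes>\<^bsub>GL n\<^esub> B \<otimes>\<^bsub>GL n\<^esub> C = A \<otimes>\<^bsub>GL n\<^esub> (B \<otimes>\<^bsub>GL n\<^esub> C)"
    by (auto dest!: GL_carrier_mat)
qed (auto intro: GL_mult dest: GL_carrier_mat)

definition matrix_support :: "bit mat \<Rightarrow> (nat \<times> nat) set" where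
  "matrix_support A = {(i, j). i < dim_row A \<and> j < dim_col A \<and> A $$ (i, j) = 1}"

lemma inj_on_matrix_support: "inj_on matrix_support (carrier_mat n m)"
proof (rule inj_onI)
  fix A B :: "bit mat" assume c: "A \<in> carrier_mat n m" "B \<in> carrier_mat n m" and eq: "matrix_support A = matrix_support B"
  show "A = B"
  proof (rule eq_matI)
    fix i j assume "i < dim_row B" "j < dim_col B"
    then have "A $$ (i, j) = 1 \<longleftrightarrow> B $$ (i, j) = 1" using eq c by (auto simp: matrix_support_def)
    then show "A $$ (i, j) = B $$ (i, j)" by (metis bit_not_one_iff)
  qed (use c in auto)
qed

lemma finite_carrier_mat_bit: "finite (carrier_mat n m :: bit mat set)"
  and card_carrier_mat_bit_le: "card (carrier_mat n m :: bit mat set) \<le> 2 ^ (n * m)"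
proof -
  have sub: "matrix_support ` carrier_mat n m \<subseteq> Pow ({..<n} \<times> {..<m})" by (auto simp: matrix_support_def)
  show "finite (carrier_mat n m :: bit mat set)"
    using inj_on_finite[OF inj_on_matrix_support sub] by simp
  show "card (carrier_mat n m :: bit mat set) \<le> 2 ^ (n * m)"
    using card_inj_on_le[OF inj_on_matrix_support sub] by (simp add: card_Pow)
qed

section \<open>Transvections, their relations, and elimination\<close>

definition transvection :: "nat \<Rightarrow> nat \<Rightarrow> nat \<Rightarrow> bit mat" where
  "transvection n i j = mat n n (\<lambda>(a, b). if a = b \<or> a = i \<and> b = j then 1 else 0)"

lemma sum_two_deltas:
  fixes x y :: "'a::comm_monoid_add" and n :: nat
  shows "a < n \<Longrightarrow> c < n \<Longrightarrow> (\<Sum>k<n. (if k = a then x else 0) + (if k = c then y else 0)) = x + y"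
  by (simp add: sum.distrib)

lemma transvection_carrier [simp]: "transvection n i j \<in> carrier_mat n n"
  by (simp add: transvection_def)

lemma transvection_index:
  "a < n \<Longrightarrow> b < n \<Longrightarrow> transvection n i j $$ (a, b) = (if a = b \<or> a = i \<and> b = j then 1 else 0)"
  by (simp add: transvection_def)

lemma transvection_dim [simp]: "dim_row (transvection n i j) = n" "dim_col (transvection n i j) = n"
  by (simp_all add: transvection_def)

lemma transvection_mult_index:
  assumes A: "A \<in> carrier_mat n m" and ij: "i < n" "j < n" "i \<noteq> j" and ab: "a < n" "b < m"
  shows "(transvection n i j * A) $$ (a, b) = A $$ (a, b) + (if a = i then A $$ (j, b) else 0)"
proof -
  have "(transvection n i j * A) $$ (a, b) = (\<Sum>k<n. transvection n i j $$ (a, k) * A $$ (k, b))"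
    using A ab by (intro index_mult_mat_sum) auto
  also have "\<dots> = (\<Sum>k<n. (if k = a then A $$ (a, b) else 0) + (if k = j then if a = i then A $$ (j, b) else 0 else 0))"
    using ab ij by (intro sum.cong refl) (auto simp: transvection_index)
  also have "\<dots> = A $$ (a, b) + (if a = i then A $$ (j, b) else 0)"
    using ab ij by (intro sum_two_deltas) auto
  finally show ?thesis .
qed

lemma transvection_mult_carrier [simp]:
  "A \<in> carrier_mat n m \<Longrightarrow> transvection n i j * A \<in> carrier_mat n m"
  by (intro mult_carrier_mat[of _ n n]) auto

lemma transvection_involution:
  assumes "i < n" "j < n" "i \<noteq> j"
  shows "transvection n i j * transvection n i j = 1\<^sub>m n"
  by (rule eq_matI) (use assms in \<open>auto simp: transvection_mult_index[of _ n n] transvection_index simp del: index_mult_mat(1)\<close>)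

lemma transvection_cancel:
  assumes "i < n" "j < n" "i \<noteq> j" "A \<in> carrier_mat n m"
  shows "transvection n i j * (transvection n i j * A) = A"
  using assms by (subst assoc_mult_mat[symmetric, of _ n n _ n _ m]) (auto simp: transvection_involution)

lemma transvection_GL [simp]: "i < n \<Longrightarrow> j < n \<Longrightarrow> i \<noteq> j \<Longrightarrow> transvection n i j \<in> carrier (GL n)"
  by (rule GL_I[OF transvection_carrier transvection_carrier transvection_involution])

lemma transvection_commute:
  assumes "i < n" "j < n" "k < n" "l < n" "i \<noteq> j" "k \<noteq> l" "j \<noteq> k" "i \<noteq> l"
  shows "transvection n i j * transvection n k l = transvection n k l * transvection n i j"
  by (rule eq_matI) (use assms in \<open>auto simp: transvection_mult_index[of _ n n] transvection_index simp del: index_mult_mat(1)\<close>)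

lemma transvection_commutator:
  assumes "i < n" "j < n" "k < n" "i \<noteq> j" "j \<noteq> k" "i \<noteq> k"
  shows "transvection n i j * transvection n j k = transvection n j k * (transvection n i j * transvection n i k)"
  by (rule eq_matI) (use assms in \<open>auto simp: transvection_mult_index[of _ n n] transvection_index simp del: index_mult_mat(1)\<close>)

text \<open>Otherwise column k is a combination of the first k columns, which are unit vectors;
  \<open>v\<close> is the resulting kernel vector, without signs in characteristic 2.\<close>

lemma invertible_column_nonzero:
  assumes A: "A \<in> carrier (GL n)" and k: "k < n"
    and id: "\<And>a b. a < n \<Longrightarrow> b < k \<Longrightarrow> A $$ (a, b) = of_bool (a = b)"
  shows "\<exists>i. k \<le> i \<and> i < n \<and> A $$ (i, k) = 1"
proof (rule ccontr)
  assume neg: "\<not> ?thesis"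
  obtain B where B: "B \<in> carrier (GL n)" "B * A = 1\<^sub>m n" using GL_E[OF A] by metis
  have c: "A \<in> carrier_mat n n" "B \<in> carrier_mat n n" using A B GL_carrier_mat by auto
  define v where "v = vec n (\<lambda>i. if i < k then A $$ (i, k) else of_bool (i = k))"
  have v: "v \<in> carrier_vec n" by (simp add: v_def)
  have "A *\<^sub>v v = 0\<^sub>v n"
  proof (rule eq_vecI)
    fix a assume "a < dim_vec (0\<^sub>v n :: bit vec)"
    then have a: "a < n" by simp
    have "(A *\<^sub>v v) $ a = (\<Sum>b<n. A $$ (a, b) * v $ b)" by (rule index_mult_vec_sum[OF c(1) v a])
    also have "\<dots> = (\<Sum>b<n. (if b = a then if a < k then A $$ (a, k) else 0 else 0) + (if b = k then A $$ (a, k) else 0))"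
      using id a by (intro sum.cong refl) (auto simp: v_def)
    also have "\<dots> = (if a < k then A $$ (a, k) else 0) + A $$ (a, k)"
      using a k by (rule sum_two_deltas)
    also have "\<dots> = 0" using neg a by (cases "a < k") (auto simp: not_less)
    finally show "(A *\<^sub>v v) $ a = 0\<^sub>v n $ a" using a by simp
  qed (use c in auto)
  then have "B *\<^sub>v (A *\<^sub>v v) = 0\<^sub>v n" using c by auto
  then have "v = 0\<^sub>v n" using c v B(2) by (metis assoc_mult_mat_vec one_mult_mat_vec)
  then have "v $ k = 0" using k by simp
  then show False using k by (simp add: v_def)
qed

text \<open>Gaussian elimination as an induction rule. The field has no unit besides 1, so row
  additions alone reach the identity. Each transvection is its own inverse, hence membership in S
  can be carried back from the reduced matrix to A.\<close>

lemma GL_generated_by_transvections: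
  assumes one: "1\<^sub>m n \<in> S"
    and tv: "\<And>A i j. A \<in> S \<Longrightarrow> i < n \<Longrightarrow> j < n \<Longrightarrow> i \<noteq> j \<Longrightarrow> transvection n i j * A \<in> S"
    and A: "A \<in> carrier (GL n)"
  shows "A \<in> S"
proof -
  have main: "A \<in> S" if "k \<le> n" "A \<in> carrier (GL n)"
    "\<And>a b. a < n \<Longrightarrow> b < k \<Longrightarrow> A $$ (a, b) = of_bool (a = b)" for k A
    using that
  proof (induction k arbitrary: A rule: inc_induct)
    case base
    then have "A = 1\<^sub>m n" by (intro eq_matI) (auto dest!: GL_carrier_mat)
    then show ?case using one by simp
  next
    case (step k)
    \<comment> \<open>\<open>D\<close> is the set of rows in which column k still has a one off the
      diagonal; each transvection removes one row from it.\<close>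
    have clear: "B \<in> S" if "B \<in> carrier (GL n)" "\<And>a b. a < n \<Longrightarrow> b < k \<Longrightarrow> B $$ (a, b) = of_bool (a = b)"
      "B $$ (k, k) = 1" "finite D" "D = {a. a < n \<and> a \<noteq> k \<and> B $$ (a, k) = 1}" for B D
      using that(4,1-3,5)
    proof (induction D arbitrary: B rule: finite_psubset_induct)
      case (psubset D)
      note Bc = GL_carrier_mat[OF psubset.prems(1)]
      show ?case
      proof (cases "D = {}")
        case True
        show ?thesis
        proof (rule step.IH)
          fix a b assume ab: "a < n" "b < Suc k"
          show "B $$ (a, b) = of_bool (a = b)"
          proof (cases "b < k")
            case False
            then have "b = k" using ab by simp
            then show ?thesis using True psubset.prems(3,4) ab by (cases "a = k") auto
          qed (use psubset.prems(2) ab in simp)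
        qed (use psubset.prems in simp)
      next
        case False
        then obtain a0 where a0: "a0 < n" "a0 \<noteq> k" "B $$ (a0, k) = 1" using psubset.prems(4) by auto
        define C where "C = transvection n a0 k * B"
        have C: "C \<in> carrier (GL n)" unfolding C_def using a0 step psubset.prems by (intro GL_mult) auto
        have Cix: "C $$ (a, b) = B $$ (a, b) + (if a = a0 then B $$ (k, b) else 0)" if "a < n" "b < n" for a b
          unfolding C_def using transvection_mult_index[OF Bc a0(1) _ a0(2) that] step by simp
        have Ck: "C $$ (a, k) = (if a = a0 then 0 else B $$ (a, k))" if "a < n" for a
          using Cix[OF that \<open>k < n\<close>] a0(3) psubset.prems(3) by simp
        have "C \<in> S"
        proof (rule psubset.IH[OF _ C])
          have "a0 \<in> D" using a0 psubset.prems(4) by simp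
          moreover have "a0 \<notin> {a. a < n \<and> a \<noteq> k \<and> C $$ (a, k) = 1}" using a0 Ck by simp
          moreover have "{a. a < n \<and> a \<noteq> k \<and> C $$ (a, k) = 1} \<subseteq> D"
            using psubset.prems(4) Ck by (auto split: if_splits)
          ultimately show "{a. a < n \<and> a \<noteq> k \<and> C $$ (a, k) = 1} \<subset> D" by blast
        qed (use a0 psubset.prems step in \<open>auto simp: Cix\<close>)
        then have "transvection n a0 k * C \<in> S" using a0 step by (intro tv) auto
        then show ?thesis unfolding C_def using transvection_cancel[OF a0(1) _ a0(2) Bc] step by simp
      qed
    qed
    note Ac = GL_carrier_mat[OF step.prems(1)]
    show ?case
    proof (cases "A $$ (k, k) = 1")
      case True
      then show ?thesis using clear[of A] step by auto
    next
      case False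
      obtain i where i: "k \<le> i" "i < n" "A $$ (i, k) = 1"
        using invertible_column_nonzero[of A n k] step by auto
      then have ik: "k \<noteq> i" using False by auto
      \<comment> \<open>Adding row i to row k puts a one on the diagonal. As i > k, row i is zero in
        the finished columns, so these are unchanged.\<close>
      define C where "C = transvection n k i * A"
      have C: "C \<in> carrier (GL n)" unfolding C_def using i ik step by (intro GL_mult) auto
      have Cix: "C $$ (a, b) = A $$ (a, b) + (if a = k then A $$ (i, b) else 0)" if "a < n" "b < n" for a b
        unfolding C_def using transvection_mult_index[OF Ac _ i(2) ik that] step by simp
      have "C \<in> S"
        by (rule clear[OF C _ _ _ refl]) (use step False i ik in \<open>auto simp: Cix\<close>)
      then have "transvection n k i * C \<in> S" using i ik step by (intro tv) auto
      then show ?thesis unfolding C_def using transvection_cancel[OF _ i(2) ik Ac] step by simp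
    qed
  qed
  show ?thesis by (rule main[of 0]) (use A in auto)
qed

text \<open>In row echelon form the pivot of row i lies in column i or later, so with k columns all
  rows from k on vanish.\<close>

lemma row_reduce:
  assumes X: "X \<in> carrier_mat n k"
  shows "\<exists>h\<in>carrier (GL n). \<forall>i j. k \<le> i \<longrightarrow> i < n \<longrightarrow> j < k \<longrightarrow> (h * X) $$ (i, j) = 0"
proof -
  obtain A B where AB: "gauss_jordan X (1\<^sub>m n) = (A, B)" by fastforce
  from gauss_jordan_transform[OF X one_carrier_mat AB, of undefined]
  obtain P where P: "P \<in> Units (ring_mat TYPE(bit) n undefined)" "A = P * X" by auto
  then obtain Q where "P \<in> carrier_mat n n" "Q \<in> carrier_mat n n" "P * Q = 1\<^sub>m n"
    by (auto simp: Units_def ring_mat_simps)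
  then have PG: "P \<in> carrier (GL n)" by (intro GL_I)
  have dim: "dim_row A = n" "dim_col A = k" using P X GL_carrier_mat[OF PG] by auto
  obtain f where f: "pivot_fun A f k"
    using gauss_jordan_row_echelon[OF X AB] dim by (auto simp: row_echelon_form_def)
  have "A $$ (i, j) = 0" if "k \<le> i" "i < n" "j < k" for i j
  proof -
    have "f i \<le> k" using pivot_funD(1)[OF dim(1) f] that by simp
    moreover have "f i = k \<or> f i \<ge> i" using pivot_bound[OF dim(1) f, of 0 i] that by auto
    ultimately have "j < f i" using that by linarith
    then show ?thesis using pivot_funD(2)[OF dim(1) f that(2)] by simp
  qed
  then show ?thesis using PG P(2) by (intro bexI[of _ P]) auto
qed

section \<open>The block subgroups of matrices diag(1, h) with h of size n - k\<close>

definition lower_block :: "nat \<Rightarrow> nat \<Rightarrow> bit mat \<Rightarrow> bit mat" where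
  "lower_block n k h = mat n n (\<lambda>(i, j). if i < k \<or> j < k then of_bool (i = j) else h $$ (i - k, j - k))"

lemma lower_block_carrier [simp]: "lower_block n k h \<in> carrier_mat n n"
  by (simp add: lower_block_def)

lemma sum_split_at:
  fixes f :: "nat \<Rightarrow> 'a::comm_monoid_add"
  assumes "k \<le> n"
  shows "(\<Sum>i<n. f i) = (\<Sum>i<k. f i) + (\<Sum>i<n - k. f (k + i))"
  using assms by (induction n rule: dec_induct) (simp_all add: Suc_diff_le add.assoc)

lemma lower_block_mult_index:
  assumes A: "A \<in> carrier_mat n m" and h: "h \<in> carrier_mat (n - k) (n - k)" and k: "k \<le> n" and ij: "i < n" "j < m"
  shows "(lower_block n k h * A) $$ (i, j) =
    (if i < k then A $$ (i, j) else (\<Sum>b<n - k. h $$ (i - k, b) * A $$ (k + b, j)))"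
proof -
  have "(lower_block n k h * A) $$ (i, j) = (\<Sum>b<n. lower_block n k h $$ (i, b) * A $$ (b, j))"
    using A ij by (intro index_mult_mat_sum) auto
  also have "\<dots> = (\<Sum>b<k. lower_block n k h $$ (i, b) * A $$ (b, j)) +
      (\<Sum>b<n - k. lower_block n k h $$ (i, k + b) * A $$ (k + b, j))"
    by (rule sum_split_at[OF k])
  also have "(\<Sum>b<k. lower_block n k h $$ (i, b) * A $$ (b, j)) = (\<Sum>b<k. if b = i then A $$ (i, j) else 0)"
    using ij k by (intro sum.cong) (auto simp: lower_block_def)
  also have "(\<Sum>b<n - k. lower_block n k h $$ (i, k + b) * A $$ (k + b, j)) =
      (if i < k then 0 else (\<Sum>b<n - k. h $$ (i - k, b) * A $$ (k + b, j)))"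
    using ij k by (auto simp: lower_block_def intro!: sum.cong sum.neutral)
  finally show ?thesis by auto
qed

lemma mult_lower_block_index:
  assumes A: "A \<in> carrier_mat m n" and h: "h \<in> carrier_mat (n - k) (n - k)" and k: "k \<le> n" and ij: "i < m" "j < n"
  shows "(A * lower_block n k h) $$ (i, j) =
    (if j < k then A $$ (i, j) else (\<Sum>b<n - k. A $$ (i, k + b) * h $$ (b, j - k)))"
proof -
  have "(A * lower_block n k h) $$ (i, j) = (\<Sum>b<n. A $$ (i, b) * lower_block n k h $$ (b, j))"
    using A ij by (intro index_mult_mat_sum) auto
  also have "\<dots> = (\<Sum>b<k. A $$ (i, b) * lower_block n k h $$ (b, j)) +
      (\<Sum>b<n - k. A $$ (i, k + b) * lower_block n k h $$ (k + b, j))"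
    by (rule sum_split_at[OF k])
  also have "(\<Sum>b<k. A $$ (i, b) * lower_block n k h $$ (b, j)) = (\<Sum>b<k. if b = j then A $$ (i, j) else 0)"
    using ij k by (intro sum.cong) (auto simp: lower_block_def)
  also have "(\<Sum>b<n - k. A $$ (i, k + b) * lower_block n k h $$ (k + b, j)) =
      (if j < k then 0 else (\<Sum>b<n - k. A $$ (i, k + b) * h $$ (b, j - k)))"
    using ij k by (auto simp: lower_block_def intro!: sum.cong sum.neutral)
  finally show ?thesis by auto
qed

lemma lower_block_mult:
  assumes h: "h \<in> carrier_mat (n - k) (n - k)" "h' \<in> carrier_mat (n - k) (n - k)" and k: "k \<le> n"
  shows "lower_block n k h * lower_block n k h' = lower_block n k (h * h')"
proof (rule eq_matI)
  fix i j assume "i < dim_row (lower_block n k (h * h'))" "j < dim_col (lower_block n k (h * h'))"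
  then have ij: "i < n" "j < n" by (auto simp: lower_block_def)
  show "(lower_block n k h * lower_block n k h') $$ (i, j) = lower_block n k (h * h') $$ (i, j)"
    unfolding lower_block_mult_index[OF lower_block_carrier h(1) k ij]
    using ij k by (auto simp: lower_block_def index_mult_mat_sum[OF h] intro!: sum.neutral simp del: index_mult_mat)
qed (auto simp: lower_block_def)

lemma lower_block_one [simp]: "lower_block n k (1\<^sub>m (n - k)) = 1\<^sub>m n"
  by (rule eq_matI) (auto simp: lower_block_def)

lemma lower_block_lower_block:
  "k \<le> n \<Longrightarrow> lower_block n k (lower_block (n - k) l h) = lower_block n (k + l) h"
  by (rule eq_matI) (auto simp: lower_block_def)

lemma lower_block_GL:
  assumes h: "h \<in> carrier (GL (n - k))" and k: "k \<le> n"
  shows "lower_block n k h \<in> carrier (GL n)"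
proof -
  obtain h' where h': "h' \<in> carrier (GL (n - k))" "h * h' = 1\<^sub>m (n - k)" using GL_E[OF h] by metis
  show ?thesis using lower_block_mult[of h n k h'] h h' k GL_carrier_mat
    by (intro GL_I[of _ _ "lower_block n k h'"]) auto
qed

lemma lower_block_transvection:
  "k \<le> n \<Longrightarrow> i < n - k \<Longrightarrow> j < n - k \<Longrightarrow> i \<noteq> j \<Longrightarrow>
    lower_block n k (transvection (n - k) i j) = transvection n (k + i) (k + j)"
  by (rule eq_matI) (auto simp: lower_block_def transvection_def)

section \<open>Permutation matrices and the Steinberg relations in a representation\<close>

definition swap_matrix :: "nat \<Rightarrow> nat \<Rightarrow> nat \<Rightarrow> bit mat" where
  "swap_matrix n a b = mat n n (\<lambda>(i, j). if i = transpose a b j then 1 else 0)"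

lemma swap_matrix_carrier [simp]: "swap_matrix n a b \<in> carrier_mat n n"
  by (simp add: swap_matrix_def)

lemma transpose_less: "a < n \<Longrightarrow> b < n \<Longrightarrow> i < n \<Longrightarrow> transpose a b i < (n::nat)"
  by (auto simp: transpose_def)

lemma swap_matrix_mult_index:
  assumes A: "A \<in> carrier_mat n m" and ab: "a < n" "b < n" and ij: "i < n" "j < m"
  shows "(swap_matrix n a b * A) $$ (i, j) = A $$ (transpose a b i, j)"
proof -
  have "(swap_matrix n a b * A) $$ (i, j) = (\<Sum>k<n. swap_matrix n a b $$ (i, k) * A $$ (k, j))"
    using A ij by (intro index_mult_mat_sum) auto
  also have "\<dots> = (\<Sum>k<n. if k = transpose a b i then A $$ (transpose a b i, j) else 0)"
    using ij by (intro sum.cong refl) (auto simp: swap_matrix_def)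
  finally show ?thesis using transpose_less[OF ab ij(1)] by simp
qed

lemma mult_swap_matrix_index:
  assumes A: "A \<in> carrier_mat m n" and ab: "a < n" "b < n" and ij: "i < m" "j < n"
  shows "(A * swap_matrix n a b) $$ (i, j) = A $$ (i, transpose a b j)"
proof -
  have "(A * swap_matrix n a b) $$ (i, j) = (\<Sum>k<n. A $$ (i, k) * swap_matrix n a b $$ (k, j))"
    using A ij by (intro index_mult_mat_sum) auto
  also have "\<dots> = (\<Sum>k<n. if k = transpose a b j then A $$ (i, transpose a b j) else 0)"
    using ij by (intro sum.cong refl) (auto simp: swap_matrix_def)
  finally show ?thesis using transpose_less[OF ab ij(2)] by simp
qed

lemma swap_matrix_involution:
  assumes "a < n" "b < n"
  shows "swap_matrix n a b * swap_matrix n a b = 1\<^sub>m n"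
proof (rule eq_matI)
  fix i j assume "i < dim_row (1\<^sub>m n :: bit mat)" "j < dim_col (1\<^sub>m n :: bit mat)"
  then have ij: "i < n" "j < n" by auto
  show "(swap_matrix n a b * swap_matrix n a b) $$ (i, j) = 1\<^sub>m n $$ (i, j)"
    unfolding swap_matrix_mult_index[OF swap_matrix_carrier assms ij]
    using ij transpose_less[OF assms ij(1)] by (auto simp: swap_matrix_def transpose_eq_iff)
qed (auto simp: swap_matrix_def)

lemma swap_matrix_GL: "a < n \<Longrightarrow> b < n \<Longrightarrow> swap_matrix n a b \<in> carrier (GL n)"
  by (rule GL_I[OF swap_matrix_carrier swap_matrix_carrier swap_matrix_involution])

lemma swap_matrix_transvection:
  assumes ab: "a < n" "b < n" and ij: "i < n" "j < n" "i \<noteq> j"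
  shows "swap_matrix n a b * transvection n i j =
    transvection n (transpose a b i) (transpose a b j) * swap_matrix n a b"
proof (rule eq_matI)
  fix x y assume "x < dim_row (transvection n (transpose a b i) (transpose a b j) * swap_matrix n a b)"
    "y < dim_col (transvection n (transpose a b i) (transpose a b j) * swap_matrix n a b)"
  then have xy: "x < n" "y < n" by (auto simp: swap_matrix_def)
  have "(transpose a b x = i) = (x = transpose a b i)" "(transpose a b x = y) = (x = transpose a b y)"
    "(transpose a b y = transpose a b j) = (y = j)"
    by (metis transpose_involutory)+
  then show "(swap_matrix n a b * transvection n i j) $$ (x, y) =
    (transvection n (transpose a b i) (transpose a b j) * swap_matrix n a b) $$ (x, y)"
    unfolding swap_matrix_mult_index[OF transvection_carrier ab xy] mult_swap_matrix_index[OF transvection_carrier ab xy]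
    using xy transpose_less[OF ab xy(1)] transpose_less[OF ab xy(2)]
    by (simp add: transvection_index)
qed (auto simp: swap_matrix_def)

lemma mat_rep_GL_steinberg:
  fixes r :: "bit mat \<Rightarrow> complex mat"
  assumes r: "mat_rep (GL n) d r"
  shows "steinberg n d (\<lambda>i j. r (transvection n i j))"
proof
  note m = mat_repD[OF r, simplified]
  show "r (transvection n i j) \<in> carrier_mat d d" if "i < n" "j < n" "i \<noteq> j" for i j
    using that by (intro m(1)) auto
  show "r (transvection n i j) * r (transvection n i j) = 1\<^sub>m d" if "i < n" "j < n" "i \<noteq> j" for i j
    using that m(2) by (subst m(3)[symmetric]) (auto simp: transvection_involution)
  show "r (transvection n i j) * r (transvection n k l) = r (transvection n k l) * r (transvection n i j)"
    if "i < n" "j < n" "k < n" "l < n" "i \<noteq> j" "k \<noteq> l" "j \<noteq> k" "i \<noteq> l" for i j k l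
    using that transvection_commute[OF that] by (metis m(3) transvection_GL)
  show "r (transvection n i j) * r (transvection n j k) = r (transvection n j k) * (r (transvection n i j) * r (transvection n i k))"
    if "i < n" "j < n" "k < n" "i \<noteq> j" "j \<noteq> k" "i \<noteq> k" for i j k
    using that transvection_commutator[OF that] by (metis m(3) GL_mult transvection_GL)
  show "\<exists>P\<in>carrier_mat d d. P * P = 1\<^sub>m d \<and> (\<forall>i<n. \<forall>j<n. i \<noteq> j \<longrightarrow>
      P * r (transvection n i j) = r (transvection n (transpose a b i) (transpose a b j)) * P)"
    if ab: "a < n" "b < n" for a b
  proof (intro bexI[of _ "r (swap_matrix n a b)"] conjI allI impI)
    show "r (swap_matrix n a b) \<in> carrier_mat d d" using ab by (intro m(1) swap_matrix_GL)
    show "r (swap_matrix n a b) * r (swap_matrix n a b) = 1\<^sub>m d"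
      using ab swap_matrix_GL[OF ab] m(2) by (subst m(3)[symmetric]) (auto simp: swap_matrix_involution)
    fix i j assume ij: "i < n" "j < n" "i \<noteq> j"
    have t: "transvection n (transpose a b i) (transpose a b j) \<in> carrier (GL n)"
      using ij ab by (intro transvection_GL transpose_less) (auto simp: transpose_eq_iff)
    show "r (swap_matrix n a b) * r (transvection n i j) =
        r (transvection n (transpose a b i) (transpose a b j)) * r (swap_matrix n a b)"
      using swap_matrix_transvection[OF ab ij] m(3)[OF t swap_matrix_GL[OF ab]]
        m(3)[OF swap_matrix_GL[OF ab] transvection_GL[OF ij]] by simp
  qed
qed

text \<open>The stabiliser of the fixed vector contains all transvections of the lower corner, which
  generate the whole block subgroup.\<close>

lemma small_dim_GL_fixed_vector:
  fixes r :: "bit mat \<Rightarrow> complex mat"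
  assumes r: "mat_rep (GL n) d r" and d: "1 \<le> d" and n: "2 * (m + 1) \<le> n"
    and dim: "d < 2 ^ ((m + 1) * (n - 2 * (m + 1)))"
  shows "\<exists>v\<in>carrier_vec d. v \<noteq> 0\<^sub>v d \<and>
    (\<forall>h\<in>carrier (GL (n - 2 * m)). r (lower_block n (2 * m) h) *\<^sub>v v = v)"
proof -
  interpret steinberg n d "\<lambda>i j. r (transvection n i j)" by (rule mat_rep_GL_steinberg[OF r])
  from small_dim_fixed_vector[OF d n dim] obtain v where v: "v \<in> carrier_vec d" "v \<noteq> 0\<^sub>v d"
    "\<And>c e. 2 * m \<le> c \<Longrightarrow> c < n \<Longrightarrow> 2 * m \<le> e \<Longrightarrow> e < n \<Longrightarrow> c \<noteq> e \<Longrightarrow> r (transvection n c e) *\<^sub>v v = v" by blast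
  have m2: "2 * m \<le> n" using n by simp
  define S where "S = {h \<in> carrier (GL (n - 2 * m)). r (lower_block n (2 * m) h) *\<^sub>v v = v}"
  have "h \<in> S" if h: "h \<in> carrier (GL (n - 2 * m))" for h
  proof (rule GL_generated_by_transvections[OF _ _ h])
    show "1\<^sub>m (n - 2 * m) \<in> S" using v(1) mat_repD(2)[OF r] by (simp add: S_def)
  next
    fix A i j assume A: "A \<in> S" and ij: "i < n - 2 * m" "j < n - 2 * m" "i \<noteq> j"
    have AG: "A \<in> carrier (GL (n - 2 * m))" and Av: "r (lower_block n (2 * m) A) *\<^sub>v v = v"
      using A by (auto simp: S_def)
    have t: "transvection n (2 * m + i) (2 * m + j) \<in> carrier (GL n)" using ij by (intro transvection_GL) auto
    note lA = lower_block_GL[OF AG m2]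
    have "lower_block n (2 * m) (transvection (n - 2 * m) i j * A) =
        transvection n (2 * m + i) (2 * m + j) * lower_block n (2 * m) A"
      using lower_block_mult[of "transvection (n - 2 * m) i j" n "2 * m" A] GL_carrier_mat[OF AG] m2 ij
      by (simp add: lower_block_transvection)
    then have "r (lower_block n (2 * m) (transvection (n - 2 * m) i j * A)) *\<^sub>v v =
        (r (transvection n (2 * m + i) (2 * m + j)) * r (lower_block n (2 * m) A)) *\<^sub>v v"
      using mat_repD(3)[OF r t lA] by simp
    also have "\<dots> = v"
      using assoc_mult_mat_vec[OF mat_repD(1)[OF r t] mat_repD(1)[OF r lA] v(1)] Av v(3) ij by simp
    finally show "transvection (n - 2 * m) i j * A \<in> S"
      using AG ij by (auto simp: S_def intro!: GL_mult)
  qed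
  then show ?thesis using v(1,2) by (intro bexI[of _ v]) (auto simp: S_def)
qed

text \<open>A reduced form under left multiplication by diag(1, h): the first k columns of M live in
  the first 2k rows, the first k rows of its inverse in the first 3k columns. This leaves 5k^2 free
  bits, whatever n is.\<close>

lemma double_coset_reduce:
  assumes g: "g \<in> carrier (GL n)" and k: "2 * k \<le> n"
  shows "\<exists>h M M'. h \<in> carrier (GL (n - k)) \<and> M = lower_block n k h * g \<and>
    M \<in> carrier (GL n) \<and> M' \<in> carrier (GL n) \<and> M * M' = 1\<^sub>m n \<and> M' * M = 1\<^sub>m n \<and>
    (\<forall>i j. 2 * k \<le> i \<longrightarrow> i < n \<longrightarrow> j < k \<longrightarrow> M $$ (i, j) = 0) \<and>
    (\<forall>i j. i < k \<longrightarrow> 3 * k \<le> j \<longrightarrow> j < n \<longrightarrow> M' $$ (i, j) = 0)"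
proof -
  note gc = GL_carrier_mat[OF g]
  have kn: "k \<le> n" "k \<le> n - k" using k by auto
  define C where "C = mat (n - k) k (\<lambda>(i, j). g $$ (k + i, j))"
  have Cc: "C \<in> carrier_mat (n - k) k" by (simp add: C_def)
  obtain h1 where h1: "h1 \<in> carrier (GL (n - k))" "\<And>i j. k \<le> i \<Longrightarrow> i < n - k \<Longrightarrow> j < k \<Longrightarrow> (h1 * C) $$ (i, j) = 0"
    using row_reduce[OF Cc] by blast
  note h1c = GL_carrier_mat[OF h1(1)]
  define M1 where "M1 = lower_block n k h1 * g"
  have M1: "M1 \<in> carrier (GL n)" unfolding M1_def by (intro GL_mult lower_block_GL h1(1) g kn(1))
  have M1_0: "M1 $$ (i, j) = 0" if "2 * k \<le> i" "i < n" "j < k" for i j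
  proof -
    have jn: "j < n" using that kn by simp
    have "M1 $$ (i, j) = (\<Sum>b<n - k. h1 $$ (i - k, b) * g $$ (k + b, j))"
      using lower_block_mult_index[OF gc h1c kn(1) that(2) jn] that kn by (simp add: M1_def)
    also have "\<dots> = (h1 * C) $$ (i - k, j)"
      using index_mult_mat_sum[OF h1c Cc, of "i - k" j] that kn by (simp add: C_def)
    finally show ?thesis using h1(2)[of "i - k" j] that by simp
  qed
  obtain M1' where M1': "M1' \<in> carrier (GL n)" "M1 * M1' = 1\<^sub>m n" using GL_E[OF M1] by metis
  \<comment> \<open>The second reduction uses only matrices acting on the rows from 2k on, where the
    first k columns already vanish, so the first reduction survives. It acts on the inverse from the
    right, hence the transposes.\<close>
  define Z where "Z = mat (n - 2 * k) k (\<lambda>(b, i). M1' $$ (i, 2 * k + b))"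
  have Zc: "Z \<in> carrier_mat (n - 2 * k) k" by (simp add: Z_def)
  obtain u where u: "u \<in> carrier (GL (n - 2 * k))" "\<And>i j. k \<le> i \<Longrightarrow> i < n - 2 * k \<Longrightarrow> j < k \<Longrightarrow> (u * Z) $$ (i, j) = 0"
    using row_reduce[OF Zc] by blast
  note uc = GL_carrier_mat[OF u(1)]
  obtain u' where u': "u' \<in> carrier (GL (n - 2 * k))" "u * u' = 1\<^sub>m (n - 2 * k)" "u' * u = 1\<^sub>m (n - 2 * k)"
    using GL_E[OF u(1)] by metis
  note u'c = GL_carrier_mat[OF u'(1)]
  define w h2 where "w = transpose_mat u" and "h2 = transpose_mat u'"
  have wc: "w \<in> carrier_mat (n - 2 * k) (n - 2 * k)" and h2c: "h2 \<in> carrier_mat (n - 2 * k) (n - 2 * k)"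
    using uc u'c by (simp_all add: w_def h2_def)
  have h2w: "h2 * w = 1\<^sub>m (n - 2 * k)"
    unfolding w_def h2_def using u'(2) transpose_mult[OF uc u'c] by simp
  have h2G: "h2 \<in> carrier (GL (n - 2 * k))" by (rule GL_I[OF h2c wc h2w])
  have wG: "w \<in> carrier (GL (n - 2 * k))" by (rule GL_I'[OF wc h2c h2w])
  define M M' where "M = lower_block n (2 * k) h2 * M1" and "M' = M1' * lower_block n (2 * k) w"
  have MG: "M \<in> carrier (GL n)" and M'G: "M' \<in> carrier (GL n)"
    unfolding M_def M'_def by (intro GL_mult lower_block_GL M1 M1'(1) h2G wG k)+
  have MM': "M * M' = 1\<^sub>m n"
  proof -
    note c = GL_carrier_mat[OF M1] GL_carrier_mat[OF M1'(1)] lower_block_carrier[of n "2 * k" h2] lower_block_carrier[of n "2 * k" w]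
    have "M * M' = lower_block n (2 * k) h2 * (M1 * (M1' * lower_block n (2 * k) w))"
      unfolding M_def M'_def by (rule assoc_mult_mat[OF c(3,1) mult_carrier_mat[OF c(2,4)]])
    also have "M1 * (M1' * lower_block n (2 * k) w) = lower_block n (2 * k) w"
      using assoc_mult_mat[OF c(1,2,4)] M1'(2) c(4) by simp
    finally show ?thesis using lower_block_mult[OF h2c wc k] h2w by simp
  qed
  have M'M: "M' * M = 1\<^sub>m n"
    using mat_mult_left_right_inverse[OF GL_carrier_mat[OF MG] GL_carrier_mat[OF M'G] MM'] .
  define h where "h = lower_block (n - k) k h2 * h1"
  have nk: "n - k - k = n - 2 * k" by simp
  have h: "h \<in> carrier (GL (n - k))" unfolding h_def using h2G nk by (intro GL_mult lower_block_GL h1(1) kn(2)) simp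
  have M_h: "M = lower_block n k h * g"
  proof -
    have "M = lower_block n k (lower_block (n - k) k h2) * (lower_block n k h1 * g)"
      unfolding M_def M1_def lower_block_lower_block[OF kn(1)] by (simp add: mult_2)
    also have "\<dots> = lower_block n k (lower_block (n - k) k h2) * lower_block n k h1 * g"
      by (rule assoc_mult_mat[OF lower_block_carrier lower_block_carrier gc, symmetric])
    also have "lower_block n k (lower_block (n - k) k h2) * lower_block n k h1 = lower_block n k h"
      unfolding h_def by (rule lower_block_mult[OF lower_block_carrier h1c kn(1)])
    finally show ?thesis .
  qed
  have M0: "M $$ (i, j) = 0" if ij: "2 * k \<le> i" "i < n" "j < k" for i j
  proof -
    have jn: "j < n" using ij kn by simp
    show ?thesis unfolding M_def
      using lower_block_mult_index[OF GL_carrier_mat[OF M1] h2c k ij(2) jn] ij M1_0 by (auto intro!: sum.neutral)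
  qed
  have M'0: "M' $$ (i, j) = 0" if ij: "i < k" "3 * k \<le> j" "j < n" for i j
  proof -
    have i_n: "i < n" using ij kn by simp
    have "M' $$ (i, j) = (\<Sum>b<n - 2 * k. M1' $$ (i, 2 * k + b) * w $$ (b, j - 2 * k))"
      unfolding M'_def using mult_lower_block_index[OF GL_carrier_mat[OF M1'(1)] wc k i_n ij(3)] ij by simp
    also have "\<dots> = (\<Sum>b<n - 2 * k. u $$ (j - 2 * k, b) * Z $$ (b, i))"
      using ij uc by (intro sum.cong refl) (auto simp: w_def Z_def mult.commute)
    also have "\<dots> = (u * Z) $$ (j - 2 * k, i)"
      using ij by (intro index_mult_mat_sum[OF uc Zc, symmetric]) auto
    also have "\<dots> = 0" using ij by (intro u(2)) auto
    finally show ?thesis .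
  qed
  show ?thesis
    by (intro exI[of _ h] exI[of _ M] exI[of _ M'] conjI allI impI h M_h MG M'G MM' M'M M0 M'0) assumption+
qed

lemma lower_block_cancel:
  assumes "k \<le> n" "h \<in> carrier_mat (n - k) (n - k)" "h' \<in> carrier_mat (n - k) (n - k)"
    "lower_block n k h = lower_block n k h'"
  shows "h = h'"
proof (rule eq_matI)
  fix i j assume "i < dim_row h'" "j < dim_col h'"
  then have ij: "i < n - k" "j < n - k" using assms by auto
  have "lower_block n k h $$ (k + i, k + j) = lower_block n k h' $$ (k + i, k + j)" using assms(4) by simp
  then show "h $$ (i, j) = h' $$ (i, j)" using ij assms(1) by (simp add: lower_block_def)
qed (use assms in auto)

lemma lower_blockI:
  assumes k: "k \<le> n" and Q: "Q \<in> carrier (GL n)"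
    and col: "\<And>i j. i < n \<Longrightarrow> j < k \<Longrightarrow> Q $$ (i, j) = of_bool (i = j)"
    and row: "\<And>i j. i < k \<Longrightarrow> j < n \<Longrightarrow> Q $$ (i, j) = of_bool (i = j)"
    and Q': "Q' \<in> carrier_mat n n" "Q * Q' = 1\<^sub>m n"
    and col': "\<And>i j. i < n \<Longrightarrow> j < k \<Longrightarrow> Q' $$ (i, j) = of_bool (i = j)"
    and row': "\<And>i j. i < k \<Longrightarrow> j < n \<Longrightarrow> Q' $$ (i, j) = of_bool (i = j)"
  shows "\<exists>q\<in>carrier (GL (n - k)). Q = lower_block n k q"
proof -
  define q q' where "q = mat (n - k) (n - k) (\<lambda>(i, j). Q $$ (k + i, k + j))"
    and "q' = mat (n - k) (n - k) (\<lambda>(i, j). Q' $$ (k + i, k + j))"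
  have c: "q \<in> carrier_mat (n - k) (n - k)" "q' \<in> carrier_mat (n - k) (n - k)" by (auto simp: q_def q'_def)
  have Qq: "P = lower_block n k (mat (n - k) (n - k) (\<lambda>(i, j). P $$ (k + i, k + j)))"
    if "P \<in> carrier_mat n n" "\<And>i j. i < n \<Longrightarrow> j < k \<Longrightarrow> P $$ (i, j) = of_bool (i = j)"
      "\<And>i j. i < k \<Longrightarrow> j < n \<Longrightarrow> P $$ (i, j) = of_bool (i = j)" for P
  proof (rule eq_matI)
    fix i j assume "i < dim_row (lower_block n k (mat (n - k) (n - k) (\<lambda>(i, j). P $$ (k + i, k + j))))"
      "j < dim_col (lower_block n k (mat (n - k) (n - k) (\<lambda>(i, j). P $$ (k + i, k + j))))"
    then have ij: "i < n" "j < n" by (simp_all add: lower_block_def)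
    consider "i < k" | "j < k" | "k \<le> i" "k \<le> j" by linarith
    then show "P $$ (i, j) = lower_block n k (mat (n - k) (n - k) (\<lambda>(i, j). P $$ (k + i, k + j))) $$ (i, j)"
    proof cases
      case 3
      then show ?thesis using ij by (simp add: lower_block_def)
    qed (use ij that(2)[of i j] that(3)[of i j] in \<open>simp_all add: lower_block_def\<close>)
  qed (use that(1) in \<open>simp_all add: lower_block_def\<close>)
  have Q_q: "Q = lower_block n k q" unfolding q_def by (rule Qq[OF GL_carrier_mat[OF Q] col row])
  have Q_q': "Q' = lower_block n k q'" unfolding q'_def by (rule Qq[OF Q'(1) col' row'])
  have "lower_block n k (q * q') = lower_block n k q * lower_block n k q'"
    by (rule lower_block_mult[OF c k, symmetric])
  also have "\<dots> = lower_block n k (1\<^sub>m (n - k))"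
    unfolding lower_block_one using Q'(2) Q_q Q_q' by metis
  finally have "lower_block n k (q * q') = lower_block n k (1\<^sub>m (n - k))" .
  then have "q * q' = 1\<^sub>m (n - k)" using c by (intro lower_block_cancel[OF k mult_carrier_mat[OF c] one_carrier_mat])
  then show ?thesis using GL_I[OF c] Q_q by blast
qed

text \<open>If g and g' have equal keys, their reduced forms agree in the first k columns and the
  inverses agree in the first k rows. Then M(g)^-1 M(g') agrees with the identity in its first k
  rows and columns, so it is some diag(1, q).\<close>

lemma lower_block_double_cosets:
  assumes k: "2 * k \<le> n"
  obtains \<kappa> :: "bit mat \<Rightarrow> (nat \<times> nat) set \<times> (nat \<times> nat) set"
  where "\<And>g. \<kappa> g \<in> Pow ({..<2 * k} \<times> {..<k}) \<times> Pow ({..<k} \<times> {..<3 * k})"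
    and "\<And>g g'. g \<in> carrier (GL n) \<Longrightarrow> g' \<in> carrier (GL n) \<Longrightarrow> \<kappa> g = \<kappa> g' \<Longrightarrow>
      \<exists>h\<in>carrier (GL (n - k)). \<exists>h'\<in>carrier (GL (n - k)). g' = lower_block n k h * g * lower_block n k h'"
proof -
  have kn: "k \<le> n" using k by simp
  define reduced where "reduced g h M M' \<longleftrightarrow> h \<in> carrier (GL (n - k)) \<and> M = lower_block n k h * g \<and>
    M \<in> carrier (GL n) \<and> M' \<in> carrier (GL n) \<and> M * M' = 1\<^sub>m n \<and> M' * M = 1\<^sub>m n \<and>
    (\<forall>i j. 2 * k \<le> i \<longrightarrow> i < n \<longrightarrow> j < k \<longrightarrow> M $$ (i, j) = 0) \<and>
    (\<forall>i j. i < k \<longrightarrow> 3 * k \<le> j \<longrightarrow> j < n \<longrightarrow> M' $$ (i, j) = 0)" for g h M M'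
  have "\<forall>g\<in>carrier (GL n). \<exists>h M M'. reduced g h M M'"
    unfolding reduced_def using double_coset_reduce[OF _ k] by (rule ballI)
  then obtain H M M' where red: "\<And>g. g \<in> carrier (GL n) \<Longrightarrow> reduced g (H g) (M g) (M' g)" by metis
  have f': "H g \<in> carrier (GL (n - k))" "M g = lower_block n k (H g) * g"
    "M g \<in> carrier (GL n)" "M' g \<in> carrier (GL n)" "M g * M' g = 1\<^sub>m n" "M' g * M g = 1\<^sub>m n"
    "\<And>i j. 2 * k \<le> i \<Longrightarrow> i < n \<Longrightarrow> j < k \<Longrightarrow> M g $$ (i, j) = 0"
    "\<And>i j. i < k \<Longrightarrow> 3 * k \<le> j \<Longrightarrow> j < n \<Longrightarrow> M' g $$ (i, j) = 0" if "g \<in> carrier (GL n)" for g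
    using red[OF that] unfolding reduced_def by blast+
  define \<kappa> where "\<kappa> g = ({(i, j). i < 2 * k \<and> j < k \<and> M g $$ (i, j) = 1}, {(i, j). i < k \<and> j < 3 * k \<and> M' g $$ (i, j) = 1})" for g
  show thesis
  proof (rule that[of \<kappa>])
    show "\<kappa> g \<in> Pow ({..<2 * k} \<times> {..<k}) \<times> Pow ({..<k} \<times> {..<3 * k})" for g
      by (auto simp: \<kappa>_def)
  next
    fix g g' assume g: "g \<in> carrier (GL n)" "g' \<in> carrier (GL n)" and eq: "\<kappa> g = \<kappa> g'"
    note F = f'[OF g(1)] and F' = f'[OF g(2)]
    note c = GL_carrier_mat[OF F(3)] GL_carrier_mat[OF F(4)] GL_carrier_mat[OF F'(3)] GL_carrier_mat[OF F'(4)]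
    have colM: "M g $$ (i, j) = M g' $$ (i, j)" if "i < n" "j < k" for i j
    proof (cases "i < 2 * k")
      case True
      have "(i, j) \<in> fst (\<kappa> g) \<longleftrightarrow> (i, j) \<in> fst (\<kappa> g')" using eq by simp
      then have "M g $$ (i, j) = 1 \<longleftrightarrow> M g' $$ (i, j) = 1" using True that by (simp add: \<kappa>_def)
      then show ?thesis by (metis bit_not_one_iff)
    qed (use F(7) F'(7) that in simp)
    have rowM: "M' g $$ (i, j) = M' g' $$ (i, j)" if "i < k" "j < n" for i j
    proof (cases "j < 3 * k")
      case True
      have "(i, j) \<in> snd (\<kappa> g) \<longleftrightarrow> (i, j) \<in> snd (\<kappa> g')" using eq by simp
      then have "M' g $$ (i, j) = 1 \<longleftrightarrow> M' g' $$ (i, j) = 1" using True that by (simp add: \<kappa>_def)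
      then show ?thesis by (metis bit_not_one_iff)
    qed (use F(8) F'(8) that in simp)
    \<comment> \<open>\<open>Q'\<close> is the inverse of \<open>Q\<close>; that it has the same
      block shape makes the corner q invertible.\<close>
    define Q Q' where "Q = M' g * M g'" and "Q' = M' g' * M g"
    have QG: "Q \<in> carrier (GL n)" unfolding Q_def by (intro GL_mult F F')
    have Q'c: "Q' \<in> carrier_mat n n" unfolding Q'_def using c by auto
    have QQ': "Q * Q' = 1\<^sub>m n"
    proof -
      have "Q * Q' = M' g * (M g' * (M' g' * M g))" unfolding Q_def Q'_def
        by (rule assoc_mult_mat[OF c(2,3) mult_carrier_mat[OF c(4,1)]])
      also have "M g' * (M' g' * M g) = M g" using assoc_mult_mat[OF c(3,4,1)] F'(5) c(1) by simp
      finally show ?thesis using F(6) by simp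
    qed
    have "\<exists>q\<in>carrier (GL (n - k)). Q = lower_block n k q"
    proof (rule lower_blockI[OF kn QG _ _ Q'c QQ'])
      show "Q $$ (i, j) = of_bool (i = j)" if "i < n" "j < k" for i j
      proof -
        have jn: "j < n" using that kn by simp
        have "Q $$ (i, j) = (M' g * M g) $$ (i, j)" unfolding Q_def
          unfolding index_mult_mat_sum[OF c(2,3) that(1) jn] index_mult_mat_sum[OF c(2,1) that(1) jn]
          using colM that by (intro sum.cong) auto
        then show ?thesis using F(6) that jn by simp
      qed
      show "Q' $$ (i, j) = of_bool (i = j)" if "i < n" "j < k" for i j
      proof -
        have jn: "j < n" using that kn by simp
        have "Q' $$ (i, j) = (M' g' * M g') $$ (i, j)" unfolding Q'_def
          unfolding index_mult_mat_sum[OF c(4,1) that(1) jn] index_mult_mat_sum[OF c(4,3) that(1) jn]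
          using colM that by (intro sum.cong) auto
        then show ?thesis using F'(6) that jn by simp
      qed
      show "Q $$ (i, j) = of_bool (i = j)" if "i < k" "j < n" for i j
      proof -
        have i_n: "i < n" using that kn by simp
        have "Q $$ (i, j) = (M' g' * M g') $$ (i, j)" unfolding Q_def
          unfolding index_mult_mat_sum[OF c(2,3) i_n that(2)] index_mult_mat_sum[OF c(4,3) i_n that(2)]
          using rowM that by (intro sum.cong) auto
        then show ?thesis using F'(6) that i_n by simp
      qed
      show "Q' $$ (i, j) = of_bool (i = j)" if "i < k" "j < n" for i j
      proof -
        have i_n: "i < n" using that kn by simp
        have "Q' $$ (i, j) = (M' g * M g) $$ (i, j)" unfolding Q'_def
          unfolding index_mult_mat_sum[OF c(4,1) i_n that(2)] index_mult_mat_sum[OF c(2,1) i_n that(2)]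
          using rowM that by (intro sum.cong) auto
        then show ?thesis using F(6) that i_n by simp
      qed
    qed
    then obtain q where q: "q \<in> carrier (GL (n - k))" "Q = lower_block n k q" by blast
    obtain h where h: "h \<in> carrier (GL (n - k))" "h * H g' = 1\<^sub>m (n - k)" using GL_E[OF F'(1)] by metis
    note hc = GL_carrier_mat[OF h(1)] GL_carrier_mat[OF F(1)] GL_carrier_mat[OF F'(1)]
    note gc = GL_carrier_mat[OF g(1)] GL_carrier_mat[OF g(2)]
    have "M g * Q = M g'" unfolding Q_def using assoc_mult_mat[OF c(1,2,3)] F(5) c(3) by simp
    then have "lower_block n k (H g') * g' = lower_block n k (H g) * g * lower_block n k q"
      using F(2) F'(2) q(2) by simp
    then have e: "lower_block n k h * (lower_block n k (H g') * g') = lower_block n k h * (lower_block n k (H g) * g * lower_block n k q)"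
      by simp
    have "lower_block n k h * (lower_block n k (H g') * g') = g'"
      using assoc_mult_mat[OF lower_block_carrier lower_block_carrier gc(2)] lower_block_mult[OF hc(1,3) kn] h(2) gc(2)
      by (metis left_mult_one_mat lower_block_one)
    moreover have "lower_block n k h * (lower_block n k (H g) * g * lower_block n k q) =
        lower_block n k (h * H g) * g * lower_block n k q"
    proof -
      let ?h = "lower_block n k h" and ?H = "lower_block n k (H g)" and ?q = "lower_block n k q"
      have "?h * (?H * g * ?q) = ?h * (?H * g) * ?q"
        by (rule assoc_mult_mat[OF lower_block_carrier mult_carrier_mat[OF lower_block_carrier gc(1)] lower_block_carrier, symmetric])
      also have "?h * (?H * g) = ?h * ?H * g"
        by (rule assoc_mult_mat[OF lower_block_carrier lower_block_carrier gc(1), symmetric])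
      also have "?h * ?H = lower_block n k (h * H g)" by (rule lower_block_mult[OF hc(1,2) kn])
      finally show ?thesis .
    qed
    ultimately have "g' = lower_block n k (h * H g) * g * lower_block n k q" using e by simp
    then show "\<exists>h\<in>carrier (GL (n - k)). \<exists>h'\<in>carrier (GL (n - k)). g' = lower_block n k h * g * lower_block n k h'"
      using GL_mult[OF h(1) F(1)] q(1) by blast
  qed
qed

section \<open>Conjugacy classes\<close>

primrec krylov :: "'a::semiring_0 mat \<Rightarrow> 'a vec \<Rightarrow> nat \<Rightarrow> 'a vec" where
  "krylov A v 0 = v"
| "krylov A v (Suc j) = A *\<^sub>v krylov A v j"

lemma krylov_carrier: "A \<in> carrier_mat n n \<Longrightarrow> v \<in> carrier_vec n \<Longrightarrow> krylov A v j \<in> carrier_vec n"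
  by (cases j) (auto intro: carrier_vecI)

lemma krylov_pairing:
  fixes A :: "'a::comm_semiring_0 mat"
  assumes A: "A \<in> carrier_mat n n" and v: "v \<in> carrier_vec n" and f: "f \<in> carrier_vec n"
  shows "krylov (transpose_mat A) f j \<bullet> krylov A v i = f \<bullet> krylov A v (i + j)"
proof (induction j arbitrary: i)
  case (Suc j)
  have At: "transpose_mat A \<in> carrier_mat n n" using A by simp
  have "krylov (transpose_mat A) f (Suc j) \<bullet> krylov A v i = krylov (transpose_mat A) f j \<bullet> krylov A v (Suc i)"
    using transpose_vec_mult_scalar[OF A krylov_carrier[OF A v] krylov_carrier[OF At f]] by simp
  then show ?case using Suc.IH[of "Suc i"] by simp
qed simp

definition companion :: "nat \<Rightarrow> (nat \<Rightarrow> bit) \<Rightarrow> bit mat" where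
  "companion d w = mat d d (\<lambda>(i, j). if j + 1 < d then of_bool (i = j + 1) else w i)"

lemma companion_carrier [simp]: "companion d w \<in> carrier_mat d d"
  by (simp add: companion_def)

definition krylov_mat :: "nat \<Rightarrow> nat \<Rightarrow> bit mat \<Rightarrow> bit vec \<Rightarrow> bit mat" where
  "krylov_mat n d A v = mat n d (\<lambda>(i, j). krylov A v j $ i)"

lemma krylov_mat_carrier [simp]: "krylov_mat n d A v \<in> carrier_mat n d"
  by (simp add: krylov_mat_def)

lemma scalar_prod_sum:
  "w \<in> carrier_vec n \<Longrightarrow> v \<bullet> w = (\<Sum>k<n. v $ k * w $ k)"
  by (auto simp: scalar_prod_def lessThan_atLeast0)

text \<open>The functional f vanishes on the first d - 1 Krylov vectors of v and is 1 on the last.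
  This makes the first d Krylov vectors of v under A, and those of f under the transpose, linearly
  independent, so d is bounded by n.\<close>

definition dual_vectors :: "nat \<Rightarrow> bit mat \<Rightarrow> nat \<Rightarrow> bit vec \<Rightarrow> bit vec \<Rightarrow> bool" where
  "dual_vectors n A d v f \<longleftrightarrow> v \<in> carrier_vec n \<and> f \<in> carrier_vec n \<and>
     (\<forall>i<d. f \<bullet> krylov A v i = of_bool (i + 1 = d))"

text \<open>The pairing matrix is triangular with respect to the antidiagonal, hence invertible.\<close>

lemma dual_vectors_pairing:
  assumes A: "A \<in> carrier_mat n n" and dv: "dual_vectors n A d v f"
  defines "X \<equiv> krylov_mat n d A v" and "Y \<equiv> transpose_mat (krylov_mat n d (transpose_mat A) f)"
  shows "Y * X \<in> carrier (GL d)"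
proof -
  have v: "v \<in> carrier_vec n" "f \<in> carrier_vec n"
    and p: "\<And>i. i < d \<Longrightarrow> f \<bullet> krylov A v i = of_bool (i + 1 = d)"
    using dv by (auto simp: dual_vectors_def)
  have At: "transpose_mat A \<in> carrier_mat n n" using A by simp
  have X: "X \<in> carrier_mat n d" and Y: "Y \<in> carrier_mat d n" by (auto simp: X_def Y_def)
  have YX: "(Y * X) $$ (j, i) = f \<bullet> krylov A v (i + j)" if "j < d" "i < d" for i j
  proof -
    have "(Y * X) $$ (j, i) = (\<Sum>k<n. Y $$ (j, k) * X $$ (k, i))" by (rule index_mult_mat_sum[OF Y X that])
    also have "\<dots> = (\<Sum>k<n. krylov (transpose_mat A) f j $ k * krylov A v i $ k)"
      using that by (intro sum.cong) (auto simp: X_def Y_def krylov_mat_def)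
    also have "\<dots> = krylov (transpose_mat A) f j \<bullet> krylov A v i"
      by (rule scalar_prod_sum[OF krylov_carrier[OF A v(1)], symmetric])
    finally show ?thesis using krylov_pairing[OF A v] by simp
  qed
  have YXc: "Y * X \<in> carrier_mat d d" using X Y by auto
  have "det (Y * X) \<noteq> 0"
  proof
    assume "det (Y * X) = 0"
    then obtain u where u: "u \<in> carrier_vec d" "u \<noteq> 0\<^sub>v d" "(Y * X) *\<^sub>v u = 0\<^sub>v d"
      using det_0_iff_vec_prod_zero_field[OF YXc] by blast
    have "\<exists>i<d. u $ i \<noteq> 0" using u(1,2) by (metis carrier_vecD eq_vecI index_zero_vec)
    then have ne: "{i. i < d \<and> u $ i \<noteq> 0} \<noteq> {}" by auto
    define i0 where "i0 = Max {i. i < d \<and> u $ i \<noteq> 0}"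
    have fin: "finite {i. i < d \<and> u $ i \<noteq> 0}" by simp
    have i0: "i0 < d" "u $ i0 \<noteq> 0" using Max_in[OF fin ne] by (auto simp: i0_def)
    have above: "u $ i = 0" if "i0 < i" "i < d" for i
    proof (rule ccontr)
      assume "u $ i \<noteq> 0"
      then have "i \<le> i0" unfolding i0_def using that by (intro Max_ge fin) simp
      then show False using that by simp
    qed
    define j where "j = d - 1 - i0"
    have j: "j < d" "i0 + j + 1 = d" using i0(1) by (auto simp: j_def)
    have "0 = ((Y * X) *\<^sub>v u) $ j" using u(3) j by simp
    also have "\<dots> = (\<Sum>i<d. (Y * X) $$ (j, i) * u $ i)" by (rule index_mult_vec_sum[OF YXc u(1) j(1)])
    also have "\<dots> = (\<Sum>i<d. if i = i0 then u $ i0 else 0)"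
    proof (intro sum.cong refl)
      fix i assume "i \<in> {..<d}"
      then have i: "i < d" by simp
      show "(Y * X) $$ (j, i) * u $ i = (if i = i0 then u $ i0 else 0)"
      proof (cases "i0 < i")
        case True
        then show ?thesis using above[OF True i] by simp
      next
        case False
        then have "i + j < d" using j by simp
        then show ?thesis using p[of "i + j"] YX[OF j(1) i] False j by auto
      qed
    qed
    also have "\<dots> = u $ i0" using i0(1) by simp
    finally show False using i0(2) by simp
  qed
  then have "Y * X \<in> Units (ring_mat TYPE(bit) d ())" by (rule det_non_zero_imp_unit[OF YXc])
  then obtain Q where "Q \<in> carrier_mat d d" "Y * X * Q = 1\<^sub>m d" by (auto simp: Units_def ring_mat_simps)
  then show ?thesis using YXc by (intro GL_I)
qed

lemma left_invertible_dim:
  fixes L X :: "'a::field mat"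
  assumes L: "L \<in> carrier_mat d n" and X: "X \<in> carrier_mat n d" and LX: "L * X = 1\<^sub>m d"
  shows "d \<le> n"
proof (rule ccontr)
  assume "\<not> d \<le> n"
  then obtain c where c: "\<exists>j<d. c j \<noteq> 0" "\<forall>i<n. (\<Sum>j<d. c j * X $$ (i, j)) = 0"
    using homogeneous_system_nontrivial[of "{..<n}" "{..<d}" "\<lambda>j i. X $$ (i, j)"] by auto
  define u where "u = vec d c"
  have u: "u \<in> carrier_vec d" by (simp add: u_def)
  have "X *\<^sub>v u = 0\<^sub>v n"
  proof (rule eq_vecI)
    fix i assume "i < dim_vec (0\<^sub>v n :: 'a vec)"
    then have i: "i < n" by simp
    show "(X *\<^sub>v u) $ i = 0\<^sub>v n $ i"
      unfolding index_mult_vec_sum[OF X u i] using c(2) i by (simp add: u_def mult.commute)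
  qed (use X in auto)
  then have "L *\<^sub>v (X *\<^sub>v u) = 0\<^sub>v d" using L by auto
  then have "u = 0\<^sub>v d" using L X LX u by (metis assoc_mult_mat_vec one_mult_mat_vec)
  then have "\<forall>j<d. c j = 0" by (metis index_vec index_zero_vec(1) u_def)
  then show False using c(1) by blast
qed

text \<open>If A^d v were outside the span of the earlier Krylov vectors, a functional vanishing on
  these and equal to 1 on A^d v would extend the duality to d + 1.\<close>

lemma krylov_mat_companion:
  assumes A: "A \<in> carrier_mat n n" and v: "v \<in> carrier_vec n" and d: "0 < d"
    and L: "L \<in> carrier_mat d n" "L * krylov_mat n d A v = 1\<^sub>m d"
    and max: "\<nexists>f. dual_vectors n A (d + 1) v f"
  shows "\<exists>w. A * krylov_mat n d A v = krylov_mat n d A v * companion d w"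
proof -
  define X where "X = krylov_mat n d A v"
  have X: "X \<in> carrier_mat n d" by (simp add: X_def)
  note kc = krylov_carrier[OF A v]
  define c where "c = L *\<^sub>v krylov A v d"
  have c: "c \<in> carrier_vec d" using L(1) kc by (auto simp: c_def)
  have Xe: "krylov A v i = X *\<^sub>v unit_vec d i" if "i < d" for i
    using that kc[of i] X by (intro eq_vecI) (auto simp: X_def krylov_mat_def)
  have last: "X *\<^sub>v c = krylov A v d"
  proof (rule ccontr)
    assume neq: "X *\<^sub>v c \<noteq> krylov A v d"
    have Xc: "X *\<^sub>v c \<in> carrier_vec n" using X c by auto
    obtain k where k: "k < n" "(X *\<^sub>v c) $ k \<noteq> krylov A v d $ k"
      using neq kc[of d] Xc by (metis carrier_vecD eq_vecI)
    \<comment> \<open>In characteristic 2 this is 1 - X L, the projection that kills the columns of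
      X; a row of it not vanishing on A^d v is the functional sought.\<close>
    define M where "M = 1\<^sub>m n + X * L"
    have M: "M \<in> carrier_mat n n" using X L(1) by (auto simp: M_def)
    define f where "f = row M k"
    have f: "f \<in> carrier_vec n" using M k by (auto simp: f_def)
    have fu: "f \<bullet> u = u $ k + (X *\<^sub>v (L *\<^sub>v u)) $ k" if u: "u \<in> carrier_vec n" for u
    proof -
      have "M *\<^sub>v u = u + X *\<^sub>v (L *\<^sub>v u)"
        unfolding M_def using u X L(1)
        by (subst add_mult_distrib_mat_vec[of _ n n]) auto
      then have "(M *\<^sub>v u) $ k = (u + X *\<^sub>v (L *\<^sub>v u)) $ k" by simp
      moreover have "dim_vec (X *\<^sub>v (L *\<^sub>v u)) = n" using X by simp
      ultimately show ?thesis using M k u by (simp add: f_def)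
    qed
    have "f \<bullet> krylov A v i = of_bool (i + 1 = d + 1)" if "i < d + 1" for i
    proof (cases "i < d")
      case True
      have "L *\<^sub>v (X *\<^sub>v unit_vec d i) = unit_vec d i"
        using assoc_mult_mat_vec[OF L(1) X unit_vec_carrier, of i] L(2) by (simp add: X_def)
      then show ?thesis using fu[OF kc[of i]] Xe[OF True] True by simp
    next
      case False
      then have "i = d" using that by simp
      moreover have "krylov A v d $ k + (X *\<^sub>v c) $ k = 1"
        using k(2) by (cases "krylov A v d $ k"; cases "(X *\<^sub>v c) $ k") auto
      ultimately show ?thesis using fu[OF kc[of d]] by (simp add: c_def)
    qed
    then have "dual_vectors n A (d + 1) v f" using v f by (simp add: dual_vectors_def)
    with max show False by blast
  qed
  have "A * X = X * companion d (\<lambda>i. c $ i)"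
  proof (rule eq_matI)
    fix i j assume "i < dim_row (X * companion d (\<lambda>i. c $ i))" "j < dim_col (X * companion d (\<lambda>i. c $ i))"
    then have ij: "i < n" "j < d" using X by (auto simp: companion_def)
    have "(A * X) $$ (i, j) = (\<Sum>k<n. A $$ (i, k) * X $$ (k, j))" by (rule index_mult_mat_sum[OF A X ij])
    also have "\<dots> = (\<Sum>k<n. A $$ (i, k) * krylov A v j $ k)"
      using ij by (intro sum.cong) (auto simp: X_def krylov_mat_def)
    also have "\<dots> = krylov A v (Suc j) $ i" using index_mult_vec_sum[OF A kc ij(1)] by simp
    also have "\<dots> = (\<Sum>k<d. X $$ (i, k) * companion d (\<lambda>i. c $ i) $$ (k, j))"
    proof (cases "j + 1 < d")
      case True
      have "(\<Sum>k<d. X $$ (i, k) * companion d (\<lambda>i. c $ i) $$ (k, j)) = (\<Sum>k<d. if k = Suc j then X $$ (i, Suc j) else 0)"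
        using True by (intro sum.cong) (auto simp: companion_def)
      then show ?thesis using True ij by (simp add: X_def krylov_mat_def)
    next
      case False
      then have "Suc j = d" using ij by simp
      have "(\<Sum>k<d. X $$ (i, k) * companion d (\<lambda>i. c $ i) $$ (k, j)) = (\<Sum>k<d. X $$ (i, k) * c $ k)"
        using False ij by (intro sum.cong) (auto simp: companion_def)
      also have "\<dots> = (X *\<^sub>v c) $ i" by (rule index_mult_vec_sum[OF X c ij(1), symmetric])
      finally show ?thesis using last \<open>Suc j = d\<close> by simp
    qed
    also have "\<dots> = (X * companion d (\<lambda>i. c $ i)) $$ (i, j)"
      by (rule index_mult_mat_sum[OF X companion_carrier ij, symmetric])
    finally show "(A * X) $$ (i, j) = (X * companion d (\<lambda>i. c $ i)) $$ (i, j)" .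
  qed (use A X in \<open>auto simp: companion_def\<close>)
  then show ?thesis unfolding X_def by blast
qed

definition stack_rows :: "nat \<Rightarrow> nat \<Rightarrow> bit mat \<Rightarrow> bit mat \<Rightarrow> bit mat" where
  "stack_rows n d L T = mat n n (\<lambda>(i, j). if i < d then L $$ (i, j) else T $$ (i, j))"

definition stack_cols :: "nat \<Rightarrow> nat \<Rightarrow> bit mat \<Rightarrow> bit mat \<Rightarrow> bit mat" where
  "stack_cols n d X Z = mat n n (\<lambda>(i, j). if j < d then X $$ (i, j) else Z $$ (i, j - d))"

lemma stack_carrier [simp]: "stack_rows n d L T \<in> carrier_mat n n" "stack_cols n d X Z \<in> carrier_mat n n"
  by (simp_all add: stack_rows_def stack_cols_def)

lemma stack_rows_mult_index:
  assumes "d \<le> n" "L \<in> carrier_mat d n" "T \<in> carrier_mat n n" "M \<in> carrier_mat n m" "i < n" "j < m"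
  shows "(stack_rows n d L T * M) $$ (i, j) = (if i < d then (L * M) $$ (i, j) else (T * M) $$ (i, j))"
proof -
  have "(stack_rows n d L T * M) $$ (i, j) = (\<Sum>k<n. stack_rows n d L T $$ (i, k) * M $$ (k, j))"
    using assms by (intro index_mult_mat_sum) auto
  also have "\<dots> = (if i < d then (\<Sum>k<n. L $$ (i, k) * M $$ (k, j)) else (\<Sum>k<n. T $$ (i, k) * M $$ (k, j)))"
    using assms by (simp add: stack_rows_def)
  finally show ?thesis using index_mult_mat_sum[OF assms(2,4) _ assms(6), of i] index_mult_mat_sum[OF assms(3,4,5,6)] by auto
qed

lemma mult_stack_cols_index:
  assumes "d \<le> n" "X \<in> carrier_mat n d" "Z \<in> carrier_mat n (n - d)" "M \<in> carrier_mat m n" "i < m" "j < n"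
  shows "(M * stack_cols n d X Z) $$ (i, j) = (if j < d then (M * X) $$ (i, j) else (M * Z) $$ (i, j - d))"
proof -
  have jd: "\<not> j < d \<Longrightarrow> j - d < n - d" using assms(1,6) by simp
  have "(M * stack_cols n d X Z) $$ (i, j) = (\<Sum>k<n. M $$ (i, k) * stack_cols n d X Z $$ (k, j))"
    using assms by (intro index_mult_mat_sum) auto
  also have "\<dots> = (if j < d then (\<Sum>k<n. M $$ (i, k) * X $$ (k, j)) else (\<Sum>k<n. M $$ (i, k) * Z $$ (k, j - d)))"
    using assms by (simp add: stack_cols_def)
  finally show ?thesis using index_mult_mat_sum[OF assms(4,2,5), of j] index_mult_mat_sum[OF assms(4,3,5), of "j - d"] jd by auto
qed

text \<open>The columns of X span an invariant subspace, the kernel of Y is invariant too, and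
  invertibility of Y X makes the two complementary.\<close>

lemma invariant_complement_similar:
  assumes A: "A \<in> carrier_mat n n" and d: "d \<le> n" and X: "X \<in> carrier_mat n d" and Y: "Y \<in> carrier_mat d n"
    and G: "Y * X \<in> carrier (GL d)" and C: "C \<in> carrier_mat d d" "A * X = X * C"
    and D: "D \<in> carrier_mat d d" "Y * A = D * Y"
  shows "\<exists>B\<in>carrier_mat (n - d) (n - d). similar_mat A (four_block_mat C (0\<^sub>m d (n - d)) (0\<^sub>m (n - d) d) B)"
proof -
  obtain Gi where Gi: "Gi \<in> carrier (GL d)" "Y * X * Gi = 1\<^sub>m d" "Gi * (Y * X) = 1\<^sub>m d" using GL_E[OF G] by metis
  note Gic = GL_carrier_mat[OF Gi(1)]
  have YX: "Y * X \<in> carrier_mat d d" using X Y by auto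
  define L where "L = Gi * Y"
  have L: "L \<in> carrier_mat d n" using Gic Y by (auto simp: L_def)
  have LX: "L * X = 1\<^sub>m d" unfolding L_def using assoc_mult_mat[OF Gic Y X] Gi(3) by simp
  have Y_L: "Y = Y * X * L" unfolding L_def using assoc_mult_mat[OF YX Gic Y] Gi(2) Y by simp
  obtain h where h: "h \<in> carrier (GL n)" "\<And>i j. d \<le> i \<Longrightarrow> i < n \<Longrightarrow> j < d \<Longrightarrow> (h * X) $$ (i, j) = 0"
    using row_reduce[OF X] by blast
  obtain h' where h': "h' \<in> carrier (GL n)" "h * h' = 1\<^sub>m n" using GL_E[OF h(1)] by metis
  note hc = GL_carrier_mat[OF h(1)] GL_carrier_mat[OF h'(1)]
  define T where "T = mat n (n - d) (\<lambda>(i, j). h' $$ (i, d + j))"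
  have T: "T \<in> carrier_mat n (n - d)" by (simp add: T_def)
  have hT: "(h * T) $$ (i, j) = of_bool (i = d + j)" if ij: "i < n" "j < n - d" for i j
  proof -
    have dj: "d + j < n" using ij by simp
    have "(h * T) $$ (i, j) = (h * h') $$ (i, d + j)"
      unfolding index_mult_mat_sum[OF hc(1) T ij] index_mult_mat_sum[OF hc ij(1) dj]
      using ij by (intro sum.cong) (auto simp: T_def)
    then show ?thesis unfolding h'(2) using ij dj by simp
  qed
  have LT: "L * T \<in> carrier_mat d (n - d)" using L T by auto
  have XLT: "X * (L * T) \<in> carrier_mat n (n - d)" using X LT by auto
  \<comment> \<open>T consists of the last n - d columns of h^-1, and Z = (1 - X L) T is its
    projection into the kernel of L, which is the kernel of Y.\<close>
  define Z where "Z = T + X * (L * T)"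
  have Z: "Z \<in> carrier_mat n (n - d)" using T XLT by (simp add: Z_def)
  have LZ: "L * Z = 0\<^sub>m d (n - d)"
  proof -
    have "L * Z = L * T + L * (X * (L * T))" unfolding Z_def by (rule mult_add_distrib_mat[OF L T XLT])
    also have "L * (X * (L * T)) = L * T"
      by (metis LX assoc_mult_mat[OF L X LT] left_mult_one_mat[OF LT])
    finally show ?thesis using LT L T by (intro eq_matI) auto
  qed
  have hX0: "(h * X * M) $$ (i, j) = 0" if "d \<le> i" "i < n" "j < m" "M \<in> carrier_mat d m" for i j m M
    using index_mult_mat_sum[OF mult_carrier_mat[OF hc(1) X] that(4,2,3)] h(2)[OF that(1,2)] by simp
  have hZ: "(h * Z) $$ (i, j) = of_bool (i = d + j)" if "d \<le> i" "i < n" "j < n - d" for i j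
  proof -
    have "h * Z = h * T + h * (X * (L * T))" unfolding Z_def by (rule mult_add_distrib_mat[OF hc(1) T XLT])
    also have "h * (X * (L * T)) = h * X * (L * T)" by (rule assoc_mult_mat[OF hc(1) X LT, symmetric])
    finally have e: "h * Z = h * T + h * X * (L * T)" .
    have "(h * Z) $$ (i, j) = (h * T) $$ (i, j) + (h * X * (L * T)) $$ (i, j)"
      unfolding e by (rule index_add_mat(1)) (use that hc T in auto)
    then show ?thesis using hT[OF that(2,3)] hX0[OF that LT] by simp
  qed
  define W V where "W = stack_rows n d L h" and "V = stack_cols n d X Z"
  have W: "W \<in> carrier_mat n n" and V: "V \<in> carrier_mat n n" by (auto simp: W_def V_def)
  have dimZ: "j - d < n - d" if "j < n" "\<not> j < d" for j using that d by simp
  have block: "(W * M * V) $$ (i, j) = (if i < d then if j < d then (L * (M * X)) $$ (i, j) else (L * (M * Z)) $$ (i, j - d)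
      else if j < d then (h * (M * X)) $$ (i, j) else (h * (M * Z)) $$ (i, j - d))"
    if M: "M \<in> carrier_mat n n" and ij: "i < n" "j < n" for M i j
  proof -
    have WM: "W * M \<in> carrier_mat n n" using W M by auto
    have MX: "M * X \<in> carrier_mat n d" and MZ: "M * Z \<in> carrier_mat n (n - d)" using M X Z by auto
    have "(W * M * V) $$ (i, j) = (if j < d then (W * M * X) $$ (i, j) else (W * M * Z) $$ (i, j - d))"
      unfolding V_def by (rule mult_stack_cols_index[OF d X Z WM ij])
    moreover have "j < d \<Longrightarrow> (W * (M * X)) $$ (i, j) = (if i < d then (L * (M * X)) $$ (i, j) else (h * (M * X)) $$ (i, j))"
      unfolding W_def by (rule stack_rows_mult_index[OF d L hc(1) MX ij(1)])
    moreover have "\<not> j < d \<Longrightarrow> (W * (M * Z)) $$ (i, j - d) = (if i < d then (L * (M * Z)) $$ (i, j - d) else (h * (M * Z)) $$ (i, j - d))"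
      unfolding W_def by (rule stack_rows_mult_index[OF d L hc(1) MZ ij(1) dimZ[OF ij(2)]])
    ultimately show ?thesis using assoc_mult_mat[OF W M X] assoc_mult_mat[OF W M Z] by auto
  qed
  have WV: "W * V = 1\<^sub>m n"
  proof (rule eq_matI)
    fix i j assume "i < dim_row (1\<^sub>m n :: bit mat)" "j < dim_col (1\<^sub>m n :: bit mat)"
    then have ij: "i < n" "j < n" by auto
    have "(W * V) $$ (i, j) = (W * 1\<^sub>m n * V) $$ (i, j)" using W by simp
    also have "\<dots> = (if i < d then if j < d then (L * X) $$ (i, j) else (L * Z) $$ (i, j - d)
      else if j < d then (h * X) $$ (i, j) else (h * Z) $$ (i, j - d))"
      unfolding block[OF one_carrier_mat ij] using X Z by simp
    also have "\<dots> = 1\<^sub>m n $$ (i, j)"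
      unfolding LX LZ using ij h(2)[of i j] hZ[of i "j - d"] dimZ[OF ij(2)] by auto
    finally show "(W * V) $$ (i, j) = 1\<^sub>m n $$ (i, j)" .
  qed (use W V in auto)
  have VW: "V * W = 1\<^sub>m n" by (rule mat_mult_left_right_inverse[OF W V WV])
  define B where "B = mat (n - d) (n - d) (\<lambda>(i, j). (W * A * V) $$ (d + i, d + j))"
  have B: "B \<in> carrier_mat (n - d) (n - d)" by (simp add: B_def)
  have YZ: "Y * Z = 0\<^sub>m d (n - d)"
  proof -
    have "Y * Z = Y * X * (L * Z)" using assoc_mult_mat[OF YX L Z] Y_L by simp
    then show ?thesis unfolding LZ using right_mult_zero_mat[OF YX] by simp
  qed
  have LAZ: "L * (A * Z) = 0\<^sub>m d (n - d)"
  proof -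
    have "L * (A * Z) = Gi * (Y * (A * Z))" unfolding L_def by (rule assoc_mult_mat[OF Gic Y mult_carrier_mat[OF A Z]])
    also have "Y * (A * Z) = D * (Y * Z)" using assoc_mult_mat[OF Y A Z] assoc_mult_mat[OF D(1) Y Z] D(2) by simp
    also have "\<dots> = 0\<^sub>m d (n - d)" unfolding YZ using D(1) by simp
    finally show ?thesis using Gic by simp
  qed
  have LAX: "L * (A * X) = C" unfolding C(2) using assoc_mult_mat[OF L X C(1)] LX C(1) by simp
  have "W * A * V = four_block_mat C (0\<^sub>m d (n - d)) (0\<^sub>m (n - d) d) B"
  proof (rule eq_matI)
    fix i j assume "i < dim_row (four_block_mat C (0\<^sub>m d (n - d)) (0\<^sub>m (n - d) d) B)"
      "j < dim_col (four_block_mat C (0\<^sub>m d (n - d)) (0\<^sub>m (n - d) d) B)"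
    then have ij: "i < n" "j < n" using C(1) B d by auto
    have hAX: "(h * (A * X)) $$ (i, j) = 0" if "\<not> i < d" "j < d"
      unfolding C(2) using hX0[OF _ ij(1) that(2) C(1)] that assoc_mult_mat[OF hc(1) X C(1)] by simp
    show "(W * A * V) $$ (i, j) = four_block_mat C (0\<^sub>m d (n - d)) (0\<^sub>m (n - d) d) B $$ (i, j)"
    proof (cases "i < d \<or> j < d")
      case True
      then show ?thesis unfolding block[OF A ij] LAX LAZ using hAX ij C(1) B dimZ[OF ij(2)] by auto
    next
      case False
      then have "\<not> i < d" "\<not> j < d" by auto
      then show ?thesis using ij C(1) dimZ[OF ij(1)] dimZ[OF ij(2)] by (simp add: B_def del: index_mult_mat(1))
    qed
  qed (use W V C(1) B d in auto)
  moreover have "similar_mat_wit A (W * A * V) V W"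
    unfolding similar_mat_wit_def Let_def
  proof (intro conjI)
    have WA: "W * A \<in> carrier_mat n n" using W A by auto
    have "V * (W * A * V) * W = V * (W * A) * (V * W)"
      using assoc_mult_mat[OF V WA V] assoc_mult_mat[OF mult_carrier_mat[OF V WA] V W] by simp
    also have "V * (W * A) = A" using assoc_mult_mat[OF V W A] VW A by simp
    finally show "A = V * (W * A * V) * W" using VW A by simp
  qed (use W V A VW WV in auto)
  ultimately show ?thesis using B unfolding similar_mat_def by metis
qed

text \<open>Choosing d maximal over all pairs v, f makes it maximal for the transposed matrix as
  well, because the duality is symmetric. So the Krylov space of v and that of f are both invariant,
  and the annihilator of the latter is an invariant complement of the former.\<close>

lemma companion_block_exists:
  assumes A: "A \<in> carrier_mat n n" and n: "0 < n"
  shows "\<exists>d w B. 0 < d \<and> d \<le> n \<and> B \<in> carrier_mat (n - d) (n - d) \<and>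
    similar_mat A (four_block_mat (companion d w) (0\<^sub>m d (n - d)) (0\<^sub>m (n - d) d) B)"
proof -
  have At: "transpose_mat A \<in> carrier_mat n n" using A by simp
  have inv: "\<exists>L. L \<in> carrier_mat d n \<and> L * krylov_mat n d A v = 1\<^sub>m d"
    if A: "A \<in> carrier_mat n n" and dv: "dual_vectors n A d v f" for A d v f
  proof -
    obtain Gi where Gi: "Gi \<in> carrier (GL d)" "Gi * (transpose_mat (krylov_mat n d (transpose_mat A) f) * krylov_mat n d A v) = 1\<^sub>m d"
      using GL_E[OF dual_vectors_pairing[OF A dv]] by metis
    have Y: "transpose_mat (krylov_mat n d (transpose_mat A) f) \<in> carrier_mat d n" by simp
    show ?thesis
      using assoc_mult_mat[OF GL_carrier_mat[OF Gi(1)] Y krylov_mat_carrier] Gi(2) mult_carrier_mat[OF GL_carrier_mat[OF Gi(1)] Y]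
      by metis
  qed
  have bound: "d \<le> n" if "dual_vectors n A d v f" for d v f
    using inv[OF A that] left_invertible_dim krylov_mat_carrier by metis
  have sym: "dual_vectors n (transpose_mat A) d f v \<longleftrightarrow> dual_vectors n A d v f" for d v f
  proof -
    have "v \<bullet> krylov (transpose_mat A) f i = f \<bullet> krylov A v i" if "v \<in> carrier_vec n" "f \<in> carrier_vec n" for i
      using krylov_pairing[OF A that, of i 0] comm_scalar_prod[OF that(1) krylov_carrier[OF At that(2)]] by simp
    then show ?thesis by (auto simp: dual_vectors_def)
  qed
  have "dual_vectors n A 1 (unit_vec n 0) (unit_vec n 0)"
    using n by (simp add: dual_vectors_def)
  then have ex: "\<exists>v f. dual_vectors n A 1 v f" by blast
  define d where "d = (GREATEST d. \<exists>v f. dual_vectors n A d v f)"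
  have "\<exists>v f. dual_vectors n A d v f" unfolding d_def
    using ex bound by (intro GreatestI_nat[where P = "\<lambda>d. \<exists>v f. dual_vectors n A d v f" and k = 1 and b = n]) auto
  then obtain v f where vf: "dual_vectors n A d v f" by blast
  have d1: "1 \<le> d" unfolding d_def
    using ex bound by (intro Greatest_le_nat[where P = "\<lambda>d. \<exists>v f. dual_vectors n A d v f" and b = n]) auto
  have dmax: "\<nexists>v f. dual_vectors n A (d + 1) v f"
  proof
    assume "\<exists>v f. dual_vectors n A (d + 1) v f"
    then have "d + 1 \<le> d" unfolding d_def[symmetric]
      using bound Greatest_le_nat[where P = "\<lambda>d. \<exists>v f. dual_vectors n A d v f" and b = n and k = "d + 1"] unfolding d_def by blast
    then show False by simp
  qed
  have v: "v \<in> carrier_vec n" "f \<in> carrier_vec n" using vf by (auto simp: dual_vectors_def)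
  obtain L where L: "L \<in> carrier_mat d n" "L * krylov_mat n d A v = 1\<^sub>m d" using inv[OF A vf] by blast
  obtain w where w: "A * krylov_mat n d A v = krylov_mat n d A v * companion d w"
    using krylov_mat_companion[OF A v(1) _ L] dmax d1 by auto
  have vf': "dual_vectors n (transpose_mat A) d f v" using vf sym by simp
  obtain L' where L': "L' \<in> carrier_mat d n" "L' * krylov_mat n d (transpose_mat A) f = 1\<^sub>m d" using inv[OF At vf'] by blast
  obtain w' where w': "transpose_mat A * krylov_mat n d (transpose_mat A) f = krylov_mat n d (transpose_mat A) f * companion d w'"
    using krylov_mat_companion[OF At v(2) _ L'] dmax sym d1 by auto
  define Y where "Y = transpose_mat (krylov_mat n d (transpose_mat A) f)"
  have Y: "Y \<in> carrier_mat d n" by (simp add: Y_def)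
  have "transpose_mat (transpose_mat A * krylov_mat n d (transpose_mat A) f) = Y * A"
    unfolding Y_def using transpose_mult[OF At krylov_mat_carrier, of d "transpose_mat A" f] by simp
  moreover have "transpose_mat (krylov_mat n d (transpose_mat A) f * companion d w') = transpose_mat (companion d w') * Y"
    unfolding Y_def by (rule transpose_mult[OF krylov_mat_carrier companion_carrier])
  ultimately have YA: "Y * A = transpose_mat (companion d w') * Y" unfolding w' by simp
  have "\<exists>B\<in>carrier_mat (n - d) (n - d). similar_mat A (four_block_mat (companion d w) (0\<^sub>m d (n - d)) (0\<^sub>m (n - d) d) B)"
    by (rule invariant_complement_similar[OF A bound[OF vf] krylov_mat_carrier Y
          dual_vectors_pairing[OF A vf, folded Y_def] companion_carrier w _ YA]) simp
  then show ?thesis using d1 bound[OF vf] by (intro exI[of _ d] exI[of _ w]) auto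
qed

text \<open>Not a normal form, since blocks may be permuted; for an upper bound on the number of
  classes it suffices that every matrix is similar to at least one of these.\<close>

inductive block_companion :: "nat \<Rightarrow> bit mat \<Rightarrow> bool" where
  "block_companion 0 (1\<^sub>m 0)"
| "0 < d \<Longrightarrow> d \<le> n \<Longrightarrow> block_companion (n - d) M \<Longrightarrow>
    block_companion n (four_block_mat (companion d w) (0\<^sub>m d (n - d)) (0\<^sub>m (n - d) d) M)"

lemma similar_block_companion:
  "A \<in> carrier_mat n n \<Longrightarrow> \<exists>B. block_companion n B \<and> similar_mat A B"
proof (induction n arbitrary: A rule: less_induct)
  case (less n)
  show ?case
  proof (cases "n = 0")
    case True
    then have "A = 1\<^sub>m 0" using less.prems by (intro eq_matI) auto
    then show ?thesis using True similar_mat_refl[OF less.prems] block_companion.intros(1) by auto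
  next
    case False
    then obtain d w B where B: "0 < d" "d \<le> n" "B \<in> carrier_mat (n - d) (n - d)"
      "similar_mat A (four_block_mat (companion d w) (0\<^sub>m d (n - d)) (0\<^sub>m (n - d) d) B)"
      using companion_block_exists[OF less.prems] by auto
    obtain M where M: "block_companion (n - d) M" "similar_mat B M"
      using less.IH[OF _ B(3)] B(1,2) by auto
    have "similar_mat A (four_block_mat (companion d w) (0\<^sub>m d (n - d)) (0\<^sub>m (n - d) d) M)"
      by (rule similar_mat_trans[OF B(4) similar_mat_four_block_0_0[OF similar_mat_refl[OF companion_carrier] M(2) companion_carrier B(3)]])
    then show ?thesis using block_companion.intros(2)[OF B(1,2) M(1)] by blast
  qed
qed

text \<open>The count by the size d of the first block, which has 2^d possible last columns; the
  extra term 2^n closes the induction.\<close>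

lemma sum_2_4_powers: "(\<Sum>d = 1..n. 2 ^ d * 4 ^ (n - d)) + 2 ^ n = (4 ^ n :: nat)"
proof (induction n)
  case (Suc n)
  have "(\<Sum>d = 1..Suc n. 2 ^ d * 4 ^ (Suc n - d)) = (\<Sum>d = 1..n. 4 * (2 ^ d * 4 ^ (n - d))) + (2 ^ Suc n :: nat)"
    by (simp add: Suc_diff_le mult.left_commute)
  also have "\<dots> = 4 * (\<Sum>d = 1..n. 2 ^ d * 4 ^ (n - d)) + 2 ^ Suc n"
    unfolding sum_distrib_left ..
  finally show ?case using Suc by simp
qed simp

lemma finite_block_companion: "finite {M. block_companion n M}"
  and card_block_companion_le: "card {M. block_companion n M} \<le> 4 ^ n"
proof -
  have "finite {M. block_companion n M} \<and> card {M. block_companion n M} \<le> 4 ^ n"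
  proof (induction n rule: less_induct)
    case (less n)
    show ?case
    proof (cases "n = 0")
      case True
      have "{M. block_companion n M} \<subseteq> {1\<^sub>m 0}" using True by (auto elim: block_companion.cases)
      then have "finite {M. block_companion n M}" "card {M. block_companion n M} \<le> card {1\<^sub>m 0 :: bit mat}"
        using card_mono[of "{1\<^sub>m 0 :: bit mat}"] by (auto intro: finite_subset)
      then show ?thesis using True by simp
    next
      case False
      define F where "F d = (\<lambda>(S, M). four_block_mat (companion d (\<lambda>i. of_bool (i \<in> S))) (0\<^sub>m d (n - d)) (0\<^sub>m (n - d) d) M) `
        (Pow {..<d} \<times> {M. block_companion (n - d) M})" for d
      have F: "finite (F d)" "card (F d) \<le> 2 ^ d * 4 ^ (n - d)" if "d \<in> {1..n}" for d
      proof -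
        have *: "finite {M. block_companion (n - d) M}" "card {M. block_companion (n - d) M} \<le> 4 ^ (n - d)"
          using less.IH[of "n - d"] that by auto
        then show "finite (F d)" by (simp add: F_def)
        have "card (F d) \<le> card (Pow {..<d} \<times> {M. block_companion (n - d) M})"
          unfolding F_def using * by (intro card_image_le) simp
        also have "\<dots> \<le> 2 ^ d * 4 ^ (n - d)" using * by (simp add: card_cartesian_product card_Pow)
        finally show "card (F d) \<le> 2 ^ d * 4 ^ (n - d)" .
      qed
      have sub: "{M. block_companion n M} \<subseteq> (\<Union>d\<in>{1..n}. F d)"
      proof
        fix M assume "M \<in> {M. block_companion n M}"
        then have "block_companion n M" by simp
        then show "M \<in> (\<Union>d\<in>{1..n}. F d)"
        proof cases
          case 1
          then show ?thesis using False by simp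
        next
          case (2 d M' w)
          have "companion d w = companion d (\<lambda>i. of_bool (i \<in> {i. i < d \<and> w i = 1}))"
            unfolding companion_def by (intro cong_mat refl) (auto simp: bit_not_one_iff)
          then have "M = (\<lambda>(S, M). four_block_mat (companion d (\<lambda>i. of_bool (i \<in> S))) (0\<^sub>m d (n - d)) (0\<^sub>m (n - d) d) M) ({i. i < d \<and> w i = 1}, M')"
            using 2(1) by simp
          moreover have "({i. i < d \<and> w i = 1}, M') \<in> Pow {..<d} \<times> {M. block_companion (n - d) M}"
            using 2(4) by auto
          ultimately have "M \<in> F d" unfolding F_def by (rule image_eqI)
          then show ?thesis using 2(2,3) by auto
        qed
      qed
      have finU: "finite (\<Union>d\<in>{1..n}. F d)" using F by blast
      have "card {M. block_companion n M} \<le> card (\<Union>d\<in>{1..n}. F d)" by (rule card_mono[OF finU sub])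
      also have "\<dots> \<le> (\<Sum>d = 1..n. card (F d))" by (rule card_UN_le) simp
      also have "\<dots> \<le> (\<Sum>d = 1..n. 2 ^ d * 4 ^ (n - d))" using F by (intro sum_mono) auto
      also have "\<dots> \<le> 4 ^ n" using sum_2_4_powers[of n] by linarith
      finally show ?thesis using finite_subset[OF sub finU] by blast
    qed
  qed
  then show "finite {M. block_companion n M}" "card {M. block_companion n M} \<le> 4 ^ n" by auto
qed

text \<open>\<kappa> chooses a similar block companion matrix, so equal values mean conjugate
  elements.\<close>

lemma block_companion_representatives:
  obtains \<kappa> :: "bit mat \<Rightarrow> bit mat"
  where "\<And>g. g \<in> carrier (GL n) \<Longrightarrow> block_companion n (\<kappa> g)"
    and "\<And>g g'. g \<in> carrier (GL n) \<Longrightarrow> g' \<in> carrier (GL n) \<Longrightarrow> \<kappa> g = \<kappa> g' \<Longrightarrow>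
      \<exists>p\<in>carrier (GL n). \<exists>q\<in>carrier (GL n). p * q = 1\<^sub>m n \<and> g' = p * g * q"
proof -
  have "\<forall>g\<in>carrier (GL n). \<exists>B. block_companion n B \<and> similar_mat g B"
    using similar_block_companion GL_carrier_mat by blast
  then obtain \<kappa> where \<kappa>: "\<And>g. g \<in> carrier (GL n) \<Longrightarrow> block_companion n (\<kappa> g) \<and> similar_mat g (\<kappa> g)" by metis
  show thesis
  proof (rule that[of \<kappa>])
    fix g g' assume g: "g \<in> carrier (GL n)" "g' \<in> carrier (GL n)" and eq: "\<kappa> g = \<kappa> g'"
    have "similar_mat g' g" using \<kappa>[OF g(1)] \<kappa>[OF g(2)] eq by (metis similar_mat_sym similar_mat_trans)
    then obtain P Q where PQ: "similar_mat_wit g' g P Q" by (auto simp: similar_mat_def)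
    note w = similar_mat_witD2[OF GL_carrier_mat[OF g(2)] PQ]
    have "P \<in> carrier (GL n)" "Q \<in> carrier (GL n)" using w GL_I[of P n Q] GL_I[of Q n P] by auto
    then show "\<exists>p\<in>carrier (GL n). \<exists>q\<in>carrier (GL n). p * q = 1\<^sub>m n \<and> g' = p * g * q" using w by blast
  qed (use \<kappa> in blast)
qed

section \<open>The coefficient ring\<close>

text \<open>The growth makes the product of all earlier \<open>GL (comp_dim c')\<close> no larger than \<open>block_size c\<close>.\<close>

primrec level :: "nat \<Rightarrow> nat" where
  "level 0 = 1"
| "level (Suc c) = level c + (3 * 2 ^ level c) ^ 2"

text \<open>A power of two for two reasons: small 2-adic valuations of index differences survive
  reduction modulo the block size, and the shift by 2^m is the identity exactly on the components of
  level at most m.\<close>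

definition block_size :: "nat \<Rightarrow> nat" where "block_size c = 2 ^ level c"

definition comp_dim :: "nat \<Rightarrow> nat" where "comp_dim c = 3 * block_size c"

lemma level_strict_mono: "strict_mono level"
  by (simp add: strict_mono_Suc_iff)

lemma level_ge: "c + 1 \<le> level c"
  by (induction c) (use strict_mono_less[OF level_strict_mono] in \<open>auto simp: Suc_le_eq intro: le_less_trans\<close>)

lemma level_le_iff: "level c \<le> level c' \<longleftrightarrow> c \<le> c'"
  by (rule strict_mono_less_eq[OF level_strict_mono])

lemma block_size_pos [simp]: "0 < block_size c"
  by (simp add: block_size_def)

text \<open>The elementary matrix e_pq(M) of size 3 over the n by n matrices, with the blocks
  interleaved: index 3x + p is coordinate x of block p.\<close>

definition elementary :: "nat \<Rightarrow> nat \<Rightarrow> nat \<Rightarrow> 'a::comm_semiring_1 mat \<Rightarrow> 'a mat" where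
  "elementary n p q M = mat (3 * n) (3 * n)
    (\<lambda>(i, j). (if i = j then 1 else 0) + (if i mod 3 = p \<and> j mod 3 = q then M $$ (i div 3, j div 3) else 0))"

lemma elementary_carrier [simp]: "elementary n p q M \<in> carrier_mat (3 * n) (3 * n)"
  by (simp add: elementary_def)

lemma elementary_dim [simp]: "dim_row (elementary n p q M) = 3 * n" "dim_col (elementary n p q M) = 3 * n"
  by (simp_all add: elementary_def)

lemma elementary_index:
  "i < 3 * n \<Longrightarrow> j < 3 * n \<Longrightarrow> elementary n p q M $$ (i, j) =
    (if i = j then 1 else 0) + (if i mod 3 = p \<and> j mod 3 = q then M $$ (i div 3, j div 3) else 0)"
  by (simp add: elementary_def)

lemma div3_less: "i < 3 * n \<Longrightarrow> i div 3 < (n::nat)"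
  by (simp add: less_mult_imp_div_less mult.commute)

lemma sum_residue_class:
  fixes f :: "nat \<Rightarrow> 'a::comm_monoid_add"
  assumes "q < 3"
  shows "(\<Sum>i<3 * n. if i mod 3 = q then f i else 0) = (\<Sum>y<n. f (3 * y + q))"
proof -
  have "(\<Sum>i<3 * n. if i mod 3 = q then f i else 0) = sum f {i \<in> {..<3 * n}. i mod 3 = q}"
    by (rule sum.inter_filter[symmetric]) simp
  also have "\<dots> = (\<Sum>y<n. f (3 * y + q))"
  proof (rule sum.reindex_bij_witness[of _ "\<lambda>y. 3 * y + q" "\<lambda>i. i div 3"])
    fix i assume "i \<in> {i \<in> {..<3 * n}. i mod 3 = q}"
    then show "3 * (i div 3) + q = i" "i div 3 \<in> {..<n}" "f (3 * (i div 3) + q) = f i"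
      using div3_less by (auto simp: mult_div_mod_eq)
  qed (use assms in auto)
  finally show ?thesis .
qed

lemma elementary_mult_index:
  fixes M :: "'a::comm_semiring_1 mat"
  assumes M: "M \<in> carrier_mat n n" and T: "T \<in> carrier_mat (3 * n) m" and q: "q < 3" and ij: "i < 3 * n" "j < m"
  shows "(elementary n p q M * T) $$ (i, j) =
    T $$ (i, j) + (if i mod 3 = p then (\<Sum>y<n. M $$ (i div 3, y) * T $$ (3 * y + q, j)) else 0)"
proof -
  have "(elementary n p q M * T) $$ (i, j) = (\<Sum>k<3 * n. elementary n p q M $$ (i, k) * T $$ (k, j))"
    using T ij by (intro index_mult_mat_sum) auto
  also have "\<dots> = (\<Sum>k<3 * n. (if k = i then T $$ (i, j) else 0) +
      (if k mod 3 = q then (if i mod 3 = p then M $$ (i div 3, k div 3) * T $$ (k, j) else 0) else 0))"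
    using ij by (intro sum.cong refl) (auto simp: elementary_index distrib_right)
  also have "\<dots> = T $$ (i, j) + (\<Sum>y<n. if i mod 3 = p then M $$ (i div 3, (3 * y + q) div 3) * T $$ (3 * y + q, j) else 0)"
    unfolding sum.distrib sum_residue_class[OF q] using ij by simp
  finally show ?thesis using q by (auto intro!: sum.cong)
qed

lemma sum_delta_residue:
  fixes f :: "nat \<Rightarrow> 'a::semiring_1"
  assumes "q < 3" "j < 3 * n"
  shows "(\<Sum>y<n. f y * (if 3 * y + q = j then 1 else 0)) = (if j mod 3 = q then f (j div 3) else 0)"
proof (cases "j mod 3 = q")
  case True
  have "(\<Sum>y<n. f y * (if 3 * y + q = j then 1 else 0)) = (\<Sum>y<n. if y = j div 3 then f (j div 3) else 0)"
    using True by (intro sum.cong refl) (auto simp: mult_div_mod_eq)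
  then show ?thesis using True div3_less[OF assms(2)] by simp
next
  case False
  then have "3 * y + q \<noteq> j" for y using assms(1) by auto
  then show ?thesis using False by simp
qed

lemma elementary_add:
  fixes M :: "'a::comm_semiring_1 mat"
  assumes M: "M \<in> carrier_mat n n" "M' \<in> carrier_mat n n" and pq: "p < 3" "q < 3" "p \<noteq> q"
  shows "elementary n p q M * elementary n p q M' = elementary n p q (M + M')"
proof (rule eq_matI)
  fix i j assume "i < dim_row (elementary n p q (M + M'))" "j < dim_col (elementary n p q (M + M'))"
  then have ij: "i < 3 * n" "j < 3 * n" by auto
  have "(\<Sum>y<n. M $$ (i div 3, y) * elementary n p q M' $$ (3 * y + q, j)) =
      (\<Sum>y<n. M $$ (i div 3, y) * (if 3 * y + q = j then 1 else 0))"
    using ij pq by (intro sum.cong refl) (auto simp: elementary_index)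
  also have "\<dots> = (if j mod 3 = q then M $$ (i div 3, j div 3) else 0)"
    by (rule sum_delta_residue[OF pq(2) ij(2)])
  finally have sum: "(\<Sum>y<n. M $$ (i div 3, y) * elementary n p q M' $$ (3 * y + q, j)) =
      (if j mod 3 = q then M $$ (i div 3, j div 3) else 0)" .
  show "(elementary n p q M * elementary n p q M') $$ (i, j) = elementary n p q (M + M') $$ (i, j)"
    unfolding elementary_mult_index[OF M(1) elementary_carrier pq(2) ij] sum elementary_index[OF ij]
    using M div3_less[OF ij(1)] div3_less[OF ij(2)]
    by (simp add: add_ac)
qed auto

lemma elementary_zero: "elementary n p q (0\<^sub>m n n) = (1\<^sub>m (3 * n) :: bit mat)"
proof (rule eq_matI)
  fix i j assume "i < dim_row (1\<^sub>m (3 * n) :: bit mat)" "j < dim_col (1\<^sub>m (3 * n) :: bit mat)"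
  then have ij: "i < 3 * n" "j < 3 * n" by auto
  show "elementary n p q (0\<^sub>m n n) $$ (i, j) = 1\<^sub>m (3 * n) $$ (i, j)"
    using ij div3_less[OF ij(1)] div3_less[OF ij(2)] by (simp add: elementary_index)
qed auto

lemma mat_add_self: "M \<in> carrier_mat n m \<Longrightarrow> M + M = 0\<^sub>m n (m::nat)" for M :: "bit mat"
  by (rule eq_matI) auto

lemma elementary_involution:
  fixes M :: "bit mat"
  shows "M \<in> carrier_mat n n \<Longrightarrow> p < 3 \<Longrightarrow> q < 3 \<Longrightarrow> p \<noteq> q \<Longrightarrow> elementary n p q M * elementary n p q M = 1\<^sub>m (3 * n)"
  by (simp add: elementary_add mat_add_self elementary_zero)

lemma elementary_GL:
  fixes M :: "bit mat"
  shows "M \<in> carrier_mat n n \<Longrightarrow> p < 3 \<Longrightarrow> q < 3 \<Longrightarrow> p \<noteq> q \<Longrightarrow> elementary n p q M \<in> carrier (GL (3 * n))"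
  by (rule GL_I[OF elementary_carrier elementary_carrier elementary_involution])

lemma elementary_commutator:
  fixes M :: "'a::comm_semiring_1 mat"
  assumes M: "M \<in> carrier_mat n n" "M' \<in> carrier_mat n n"
    and pqr: "p < 3" "q < 3" "r < 3" "p \<noteq> q" "q \<noteq> r" "p \<noteq> r"
  shows "elementary n p q M * elementary n q r M' =
    elementary n q r M' * (elementary n p q M * elementary n p r (M * M'))"
proof (rule eq_matI)
  let ?S = "elementary n p q M * elementary n p r (M * M')"
  fix i j assume "i < dim_row (elementary n q r M' * ?S)" "j < dim_col (elementary n q r M' * ?S)"
  then have ij: "i < 3 * n" "j < 3 * n" by auto
  have MM': "M * M' \<in> carrier_mat n n" using M by auto
  have S: "?S $$ (i, j) = (if i = j then 1 else 0) + (if i mod 3 = p \<and> j mod 3 = r then (M * M') $$ (i div 3, j div 3) else 0)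
      + (if i mod 3 = p \<and> j mod 3 = q then M $$ (i div 3, j div 3) else 0)" if "i < 3 * n" for i
  proof -
    have "(\<Sum>y<n. M $$ (i div 3, y) * elementary n p r (M * M') $$ (3 * y + q, j)) =
        (\<Sum>y<n. M $$ (i div 3, y) * (if 3 * y + q = j then 1 else 0))"
      using ij pqr by (intro sum.cong refl) (auto simp: elementary_index)
    also have "\<dots> = (if j mod 3 = q then M $$ (i div 3, j div 3) else 0)"
      by (rule sum_delta_residue[OF pqr(2) ij(2)])
    finally have sum: "(\<Sum>y<n. M $$ (i div 3, y) * elementary n p r (M * M') $$ (3 * y + q, j)) =
        (if j mod 3 = q then M $$ (i div 3, j div 3) else 0)" .
    show ?thesis
      unfolding elementary_mult_index[OF M(1) elementary_carrier pqr(2) that ij(2)] sum elementary_index[OF that ij(2)]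
      by simp
  qed
  have Sc: "?S \<in> carrier_mat (3 * n) (3 * n)" by (rule mult_carrier_mat[OF elementary_carrier elementary_carrier])
  have "(\<Sum>y<n. M' $$ (i div 3, y) * ?S $$ (3 * y + r, j)) = (\<Sum>y<n. M' $$ (i div 3, y) * (if 3 * y + r = j then 1 else 0))"
  proof (intro sum.cong refl arg_cong2[of _ _ _ _ "(*)"])
    fix y assume "y \<in> {..<n}"
    then have "3 * y + r < 3 * n" using pqr by auto
    from S[OF this] show "?S $$ (3 * y + r, j) = (if 3 * y + r = j then 1 else 0)" using pqr by simp
  qed
  also have "\<dots> = (if j mod 3 = r then M' $$ (i div 3, j div 3) else 0)"
    by (rule sum_delta_residue[OF pqr(3) ij(2)])
  finally have R: "(elementary n q r M' * ?S) $$ (i, j) = ?S $$ (i, j) +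
      (if i mod 3 = q \<and> j mod 3 = r then M' $$ (i div 3, j div 3) else 0)"
    unfolding elementary_mult_index[OF M(2) Sc pqr(3) ij] by simp
  have "(\<Sum>y<n. M $$ (i div 3, y) * elementary n q r M' $$ (3 * y + q, j)) =
      (\<Sum>y<n. M $$ (i div 3, y) * (if 3 * y + q = j then 1 else 0)) +
      (\<Sum>y<n. if j mod 3 = r then M $$ (i div 3, y) * M' $$ (y, j div 3) else 0)"
    unfolding sum.distrib[symmetric]
    using ij pqr by (intro sum.cong refl) (auto simp: elementary_index distrib_left)
  also have "(\<Sum>y<n. M $$ (i div 3, y) * (if 3 * y + q = j then 1 else 0)) = (if j mod 3 = q then M $$ (i div 3, j div 3) else 0)"
    by (rule sum_delta_residue[OF pqr(2) ij(2)])
  also have "(\<Sum>y<n. if j mod 3 = r then M $$ (i div 3, y) * M' $$ (y, j div 3) else 0) =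
      (if j mod 3 = r then (M * M') $$ (i div 3, j div 3) else 0)"
    unfolding index_mult_mat_sum[OF M div3_less[OF ij(1)] div3_less[OF ij(2)]] by simp
  finally have L: "(elementary n p q M * elementary n q r M') $$ (i, j) = elementary n q r M' $$ (i, j) +
      (if i mod 3 = p then (if j mod 3 = q then M $$ (i div 3, j div 3) else 0) +
        (if j mod 3 = r then (M * M') $$ (i div 3, j div 3) else 0) else 0)"
    unfolding elementary_mult_index[OF M(1) elementary_carrier pqr(2) ij] by simp
  show "(elementary n p q M * elementary n q r M') $$ (i, j) = (elementary n q r M' * ?S) $$ (i, j)"
    unfolding L R S[OF ij(1)] elementary_index[OF ij] using pqr
    by (cases "i mod 3 = p"; cases "i mod 3 = q"; cases "j mod 3 = q"; cases "j mod 3 = r")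
      (simp_all add: add_ac del: index_mult_mat)
qed auto

text \<open>This is the commutator of e_pq(M) and e_qr(M'), written without inverses because both
  are involutions.\<close>

lemma elementary_mult:
  fixes M :: "bit mat"
  assumes M: "M \<in> carrier_mat n n" "M' \<in> carrier_mat n n"
    and pqr: "p < 3" "q < 3" "r < 3" "p \<noteq> q" "q \<noteq> r" "p \<noteq> r"
  shows "elementary n p r (M * M') =
    elementary n p q M * (elementary n q r M' * (elementary n p q M * elementary n q r M'))"
proof -
  let ?A = "elementary n p q M" and ?B = "elementary n q r M'" and ?C = "elementary n p r (M * M')"
  note c = elementary_carrier
  have AC: "?A * ?C \<in> carrier_mat (3 * n) (3 * n)" by (rule mult_carrier_mat[OF c c])
  have "?B * (?A * ?B) = ?B * (?B * (?A * ?C))" unfolding elementary_commutator[OF M pqr] ..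
  also have "\<dots> = ?A * ?C"
    using assoc_mult_mat[OF c c AC] elementary_involution[OF M(2) pqr(2,3,5)] left_mult_one_mat[OF AC] by metis
  finally have "?A * (?B * (?A * ?B)) = ?A * (?A * ?C)" by simp
  also have "\<dots> = ?C"
    using assoc_mult_mat[OF c c c] elementary_involution[OF M(1) pqr(1,2,4)] left_mult_one_mat[OF c] by metis
  finally show ?thesis by simp
qed

lemma transvection_elementary:
  assumes ij: "i < 3 * n" "j < 3 * n" "i mod 3 \<noteq> j mod 3"
  shows "transvection (3 * n) i j = elementary n (i mod 3) (j mod 3)
    (mat n n (\<lambda>(x, y). if x = i div 3 \<and> y = j div 3 then 1 else 0))"
proof (rule eq_matI)
  fix x y assume "x < dim_row (elementary n (i mod 3) (j mod 3) (mat n n (\<lambda>(x, y). if x = i div 3 \<and> y = j div 3 then 1 else 0)))"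
    "y < dim_col (elementary n (i mod 3) (j mod 3) (mat n n (\<lambda>(x, y). if x = i div 3 \<and> y = j div 3 then 1 else 0)))"
  then have xy: "x < 3 * n" "y < 3 * n" by auto
  have e: "(x mod 3 = i mod 3 \<and> y mod 3 = j mod 3) \<and> x div 3 = i div 3 \<and> y div 3 = j div 3 \<longleftrightarrow> x = i \<and> y = j"
    by (metis mult_div_mod_eq)
  let ?u = "(if x mod 3 = i mod 3 \<and> y mod 3 = j mod 3 then
    mat n n (\<lambda>(x, y). if x = i div 3 \<and> y = j div 3 then 1 else 0) $$ (x div 3, y div 3) else 0) :: bit"
  have u: "?u = (if x = i \<and> y = j then 1 else 0)"
  proof -
    have "?u = (if (x mod 3 = i mod 3 \<and> y mod 3 = j mod 3) \<and> x div 3 = i div 3 \<and> y div 3 = j div 3 then 1 else 0)"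
      unfolding index_mat(1)[OF div3_less[OF xy(1)] div3_less[OF xy(2)]] by simp
    then show ?thesis unfolding e .
  qed
  have ne: "\<not> (x = i \<and> y = j \<and> x = y)" using ij(3) by auto
  show "transvection (3 * n) i j $$ (x, y) = elementary n (i mod 3) (j mod 3)
    (mat n n (\<lambda>(x, y). if x = i div 3 \<and> y = j div 3 then 1 else 0)) $$ (x, y)"
    unfolding transvection_index[OF xy] elementary_index[OF xy] u using ne by auto
qed auto

text \<open>The coefficient ring is the ring of block diagonal matrices generated by the cyclic shifts,
  their inverses and two diagonal matrices: the Toeplitz word recording the parity of the
  2-adic valuation (the value at position 0 is 0, as the multiplicity of 2 in 0 is 0), and
  the indicator of position 0.\<close>

definition shift_power :: "nat \<Rightarrow> nat \<Rightarrow> bit mat" where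
  "shift_power k c = mat (block_size c) (block_size c) (\<lambda>(i, j). if i = (j + k) mod block_size c then 1 else 0)"

definition shift_power_inv :: "nat \<Rightarrow> nat \<Rightarrow> bit mat" where
  "shift_power_inv k c = mat (block_size c) (block_size c) (\<lambda>(i, j). if j = (i + k) mod block_size c then 1 else 0)"

definition diagonal :: "(nat \<Rightarrow> nat \<Rightarrow> bit) \<Rightarrow> nat \<Rightarrow> bit mat" where
  "diagonal F c = mat (block_size c) (block_size c) (\<lambda>(i, j). if i = j then F c j else 0)"

definition toeplitz_word :: "nat \<Rightarrow> bit" where
  "toeplitz_word j = of_bool (odd (multiplicity 2 j))"

definition ring_generators :: "(nat \<Rightarrow> bit mat) set" where
  "ring_generators = {diagonal (\<lambda>_ _. 1), shift_power 1, shift_power_inv 1,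
     diagonal (\<lambda>_. toeplitz_word), diagonal (\<lambda>_ j. of_bool (j = 0))}"

inductive_set coeff_ring :: "(nat \<Rightarrow> bit mat) set" where
  generator: "x \<in> ring_generators \<Longrightarrow> x \<in> coeff_ring"
| add: "x \<in> coeff_ring \<Longrightarrow> y \<in> coeff_ring \<Longrightarrow> (\<lambda>c. x c + y c) \<in> coeff_ring"
| mult: "x \<in> coeff_ring \<Longrightarrow> y \<in> coeff_ring \<Longrightarrow> (\<lambda>c. x c * y c) \<in> coeff_ring"

lemma coeff_ring_carrier: "x \<in> coeff_ring \<Longrightarrow> x c \<in> carrier_mat (block_size c) (block_size c)"
  by (induction rule: coeff_ring.induct)
    (auto simp: ring_generators_def diagonal_def shift_power_def shift_power_inv_def)

lemma mod_add_cancel: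
  fixes i l k n :: nat
  assumes "i < n" "l < n"
  shows "(i + k) mod n = (l + k) mod n \<longleftrightarrow> i = l"
proof
  assume "(i + k) mod n = (l + k) mod n"
  then obtain q1 q2 where "i + k + n * q1 = l + k + n * q2" unfolding nat_mod_eq_iff by blast
  then have "i mod n = l mod n" unfolding nat_mod_eq_iff by auto
  then show "i = l" using assms by simp
qed simp

text \<open>The inverse of the cyclic shift by k; it goes through the integers since x - k may be
  negative.\<close>

definition unshift :: "nat \<Rightarrow> nat \<Rightarrow> nat \<Rightarrow> nat" where
  "unshift n k x = nat ((int x - int k) mod int n)"

lemma unshift_less: "0 < n \<Longrightarrow> unshift n k x < n"
  by (simp add: unshift_def nat_less_iff)

lemma shift_unshift: "x < n \<Longrightarrow> (unshift n k x + k) mod n = x"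
proof -
  assume x: "x < n"
  have "int ((unshift n k x + k) mod n) = ((int x - int k) mod int n + int k) mod int n"
    using x by (simp add: unshift_def zmod_int)
  also have "\<dots> = int x" using x by (simp add: mod_simps)
  finally show ?thesis by simp
qed

lemma shift_surj:
  fixes x :: nat
  assumes "x < n"
  obtains i where "i < n" "x = (i + k) mod n" "i = unshift n k x"
proof (rule that)
  show "unshift n k x < n" using assms by (intro unshift_less) simp
  show "x = (unshift n k x + k) mod n" by (rule shift_unshift[OF assms, symmetric])
qed (rule refl)

lemma shift_power_carrier [simp]: "shift_power k c \<in> carrier_mat (block_size c) (block_size c)"
  "shift_power_inv k c \<in> carrier_mat (block_size c) (block_size c)"
  "diagonal F c \<in> carrier_mat (block_size c) (block_size c)"
  by (simp_all add: shift_power_def shift_power_inv_def diagonal_def)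

lemma shift_power_mult_index:
  assumes A: "A \<in> carrier_mat (block_size c) m" and ij: "i < block_size c" "j < m"
  shows "(shift_power k c * A) $$ ((i + k) mod block_size c, j) = A $$ (i, j)"
proof -
  have "(shift_power k c * A) $$ ((i + k) mod block_size c, j) =
      (\<Sum>l<block_size c. shift_power k c $$ ((i + k) mod block_size c, l) * A $$ (l, j))"
    using A ij by (intro index_mult_mat_sum[of _ "block_size c"]) auto
  also have "\<dots> = (\<Sum>l<block_size c. if l = i then A $$ (i, j) else 0)"
    using ij(1) by (intro sum.cong refl) (auto simp: shift_power_def mod_add_cancel)
  finally show ?thesis using ij by simp
qed

lemma mult_shift_power_inv_index:
  assumes A: "A \<in> carrier_mat m (block_size c)" and ij: "i < m" "j < block_size c"
  shows "(A * shift_power_inv k c) $$ (i, (j + k) mod block_size c) = A $$ (i, j)"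
proof -
  have "(A * shift_power_inv k c) $$ (i, (j + k) mod block_size c) =
      (\<Sum>l<block_size c. A $$ (i, l) * shift_power_inv k c $$ (l, (j + k) mod block_size c))"
    using A ij by (intro index_mult_mat_sum[of _ m "block_size c" _ "block_size c"]) auto
  also have "\<dots> = (\<Sum>l<block_size c. if l = j then A $$ (i, j) else 0)"
    using ij(2) by (intro sum.cong refl) (auto simp: shift_power_inv_def mod_add_cancel)
  finally show ?thesis using ij by simp
qed

lemma diagonal_mult_index:
  assumes A: "A \<in> carrier_mat (block_size c) m" and ij: "i < block_size c" "j < m"
  shows "(diagonal F c * A) $$ (i, j) = F c i * A $$ (i, j)"
proof -
  have "(diagonal F c * A) $$ (i, j) = (\<Sum>l<block_size c. diagonal F c $$ (i, l) * A $$ (l, j))"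
    using A ij by (intro index_mult_mat_sum[of _ "block_size c"]) auto
  also have "\<dots> = (\<Sum>l<block_size c. if l = i then F c i * A $$ (i, j) else 0)"
    using ij(1) by (intro sum.cong refl) (auto simp: diagonal_def)
  finally show ?thesis using ij by simp
qed

lemma mult_diagonal_index:
  assumes A: "A \<in> carrier_mat m (block_size c)" and ij: "i < m" "j < block_size c"
  shows "(A * diagonal F c) $$ (i, j) = A $$ (i, j) * F c j"
proof -
  have "(A * diagonal F c) $$ (i, j) = (\<Sum>l<block_size c. A $$ (i, l) * diagonal F c $$ (l, j))"
    using A ij by (intro index_mult_mat_sum[of _ m "block_size c" _ "block_size c"]) auto
  also have "\<dots> = (\<Sum>l<block_size c. if l = j then A $$ (i, j) * F c j else 0)"
    using ij(2) by (intro sum.cong refl) (auto simp: diagonal_def)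
  finally show ?thesis using ij by simp
qed

lemma diagonal_add: "diagonal F c + diagonal G c = diagonal (\<lambda>c j. F c j + G c j) c"
  by (rule eq_matI) (auto simp: diagonal_def)

lemma diagonal_mult: "diagonal F c * diagonal G c = diagonal (\<lambda>c j. F c j * G c j) c"
proof (rule eq_matI)
  fix i j assume "i < dim_row (diagonal (\<lambda>c j. F c j * G c j) c)" "j < dim_col (diagonal (\<lambda>c j. F c j * G c j) c)"
  then have ij: "i < block_size c" "j < block_size c" by (auto simp: diagonal_def)
  show "(diagonal F c * diagonal G c) $$ (i, j) = diagonal (\<lambda>c j. F c j * G c j) c $$ (i, j)"
    unfolding diagonal_mult_index[OF shift_power_carrier(3) ij] using ij by (simp add: diagonal_def)
qed (auto simp: diagonal_def)

lemma diagonal_one: "diagonal (\<lambda>_ _. 1) c = 1\<^sub>m (block_size c)"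
  by (rule eq_matI) (auto simp: diagonal_def)

lemma shift_power_Suc: "shift_power 1 c * shift_power k c = shift_power (Suc k) c"
proof (rule eq_matI)
  fix x j assume "x < dim_row (shift_power (Suc k) c)" "j < dim_col (shift_power (Suc k) c)"
  then have xj: "x < block_size c" "j < block_size c" by (auto simp: shift_power_def)
  obtain i where i: "i < block_size c" "x = (i + 1) mod block_size c" using shift_surj[OF xj(1), of 1] by metis
  have "(i = (j + k) mod block_size c) = (x = (j + Suc k) mod block_size c)"
    using mod_add_cancel[of i "block_size c" "(j + k) mod block_size c" 1] i by (simp add: mod_simps)
  then show "(shift_power 1 c * shift_power k c) $$ (x, j) = shift_power (Suc k) c $$ (x, j)"
    unfolding i(2) shift_power_mult_index[OF shift_power_carrier(1) i(1) xj(2)]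
    using i xj by (simp add: shift_power_def)
qed (auto simp: shift_power_def)

lemma shift_power_inv_Suc: "shift_power_inv k c * shift_power_inv 1 c = shift_power_inv (Suc k) c"
proof (rule eq_matI)
  fix x y assume "x < dim_row (shift_power_inv (Suc k) c)" "y < dim_col (shift_power_inv (Suc k) c)"
  then have xj: "x < block_size c" "y < block_size c" by (auto simp: shift_power_inv_def)
  obtain i where i: "i < block_size c" "y = (i + 1) mod block_size c" using shift_surj[OF xj(2), of 1] by metis
  have "(i = (x + k) mod block_size c) = (y = (x + Suc k) mod block_size c)"
    using mod_add_cancel[of i "block_size c" "(x + k) mod block_size c" 1] i by (simp add: mod_simps)
  then show "(shift_power_inv k c * shift_power_inv 1 c) $$ (x, y) = shift_power_inv (Suc k) c $$ (x, y)"
    unfolding i(2) mult_shift_power_inv_index[OF shift_power_carrier(2) xj(1) i(1)]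
    using i xj by (simp add: shift_power_inv_def)
qed (auto simp: shift_power_inv_def)

lemma coeff_ring_one: "diagonal (\<lambda>_ _. 1) \<in> coeff_ring"
  by (rule coeff_ring.generator) (simp add: ring_generators_def)

lemma coeff_ring_diagonal_zero: "diagonal (\<lambda>_ _. 0) \<in> coeff_ring"
proof -
  have "diagonal (\<lambda>_ _. 0) = (\<lambda>c. diagonal (\<lambda>_ _. 1) c + diagonal (\<lambda>_ _. 1) c)"
    by (rule ext) (simp add: diagonal_add)
  then show ?thesis using coeff_ring.add[OF coeff_ring_one coeff_ring_one] by simp
qed

lemma coeff_ring_shift_power: "shift_power k \<in> coeff_ring"
proof (induction k)
  case 0
  have "shift_power 0 = diagonal (\<lambda>_ _. 1)"
    by (rule ext, rule eq_matI) (auto simp: shift_power_def diagonal_def)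
  then show ?case using coeff_ring_one by simp
next
  case (Suc k)
  have "shift_power 1 \<in> coeff_ring" by (rule coeff_ring.generator) (simp add: ring_generators_def)
  from coeff_ring.mult[OF this Suc] show ?case unfolding shift_power_Suc .
qed

lemma coeff_ring_shift_power_inv: "shift_power_inv k \<in> coeff_ring"
proof (induction k)
  case 0
  have "shift_power_inv 0 = diagonal (\<lambda>_ _. 1)"
    by (rule ext, rule eq_matI) (auto simp: shift_power_inv_def diagonal_def)
  then show ?case using coeff_ring_one by simp
next
  case (Suc k)
  have "shift_power_inv 1 \<in> coeff_ring" by (rule coeff_ring.generator) (simp add: ring_generators_def)
  from coeff_ring.mult[OF Suc this] show ?case unfolding shift_power_inv_Suc .
qed

text \<open>Conjugation by shifts translates a diagonal, which yields infinitely many commuting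
  elements from a single diagonal generator.\<close>

lemma shift_conjugate_diagonal:
  "shift_power k c * diagonal F c * shift_power_inv k c = diagonal (\<lambda>c x. F c (unshift (block_size c) k x)) c"
proof (rule eq_matI)
  fix x y assume "x < dim_row (diagonal (\<lambda>c x. F c (unshift (block_size c) k x)) c)"
    "y < dim_col (diagonal (\<lambda>c x. F c (unshift (block_size c) k x)) c)"
  then have xy: "x < block_size c" "y < block_size c" by (auto simp: diagonal_def)
  obtain i where i: "i < block_size c" "x = (i + k) mod block_size c" "i = unshift (block_size c) k x"
    using shift_surj[OF xy(1), of k] by metis
  obtain j where j: "j < block_size c" "y = (j + k) mod block_size c" "j = unshift (block_size c) k y"
    using shift_surj[OF xy(2), of k] by metis
  have c1: "shift_power k c * diagonal F c \<in> carrier_mat (block_size c) (block_size c)"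
    by (rule mult_carrier_mat[OF shift_power_carrier(1,3)])
  have "(shift_power k c * diagonal F c * shift_power_inv k c) $$ (x, y) = (shift_power k c * diagonal F c) $$ (x, j)"
    using mult_shift_power_inv_index[OF c1 xy(1) j(1)] j(2) by simp
  also have "\<dots> = diagonal F c $$ (i, j)"
    using shift_power_mult_index[OF shift_power_carrier(3) i(1) j(1)] i(2) by simp
  also have "\<dots> = diagonal (\<lambda>c x. F c (unshift (block_size c) k x)) c $$ (x, y)"
  proof -
    have "(x = y) = (i = j)" using mod_add_cancel[OF i(1) j(1), of k] i(2) j(2) by simp
    then show ?thesis using i(1) j(1) xy j(3)[symmetric] by (simp add: diagonal_def)
  qed
  finally show "(shift_power k c * diagonal F c * shift_power_inv k c) $$ (x, y) =
    diagonal (\<lambda>c x. F c (unshift (block_size c) k x)) c $$ (x, y)" .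
qed (auto simp: diagonal_def shift_power_def shift_power_inv_def)

definition corner :: "nat \<Rightarrow> nat \<Rightarrow> bit mat" where
  "corner m c = mat (block_size c) (block_size c) (\<lambda>(i, j). if i = 0 \<and> j = 0 \<and> level c \<le> m then 1 else 0)"

text \<open>The diagonal unit at position 0 cuts out the (0, 0) entry of the shift by 2^m, which is
  1 exactly if the block size divides 2^m. This is how finitely many generators tell the components
  apart.\<close>

lemma coeff_ring_corner: "corner m \<in> coeff_ring"
proof -
  let ?b = "diagonal (\<lambda>_ j. of_bool (j = 0))"
  have b: "?b \<in> coeff_ring" by (rule coeff_ring.generator) (simp add: ring_generators_def)
  have "corner m c = ?b c * shift_power (2 ^ m) c * ?b c" for c
  proof (rule eq_matI)
    fix i j assume "i < dim_row (?b c * shift_power (2 ^ m) c * ?b c)" "j < dim_col (?b c * shift_power (2 ^ m) c * ?b c)"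
    then have ij: "i < block_size c" "j < block_size c" by (auto simp: diagonal_def)
    have c1: "?b c * shift_power (2 ^ m) c \<in> carrier_mat (block_size c) (block_size c)"
      by (rule mult_carrier_mat[OF shift_power_carrier(3,1)])
    have "shift_power (2 ^ m) c $$ (0, 0) = (if level c \<le> m then 1 else 0)"
    proof -
      have "(0 = (2 ^ m mod 2 ^ level c :: nat)) = (level c \<le> m)"
        by (metis dvd_power_iff_le le_refl mod_eq_0_iff_dvd)
      then show ?thesis by (simp add: shift_power_def block_size_def)
    qed
    then show "corner m c $$ (i, j) = (?b c * shift_power (2 ^ m) c * ?b c) $$ (i, j)"
      unfolding mult_diagonal_index[OF c1 ij] diagonal_mult_index[OF shift_power_carrier(1) ij]
      using ij by (auto simp: corner_def)
  qed (auto simp: corner_def diagonal_def)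
  then have "corner m = (\<lambda>c. ?b c * shift_power (2 ^ m) c * ?b c)" by (rule ext)
  then show ?thesis using coeff_ring.mult[OF coeff_ring.mult[OF b coeff_ring_shift_power] b] by simp
qed

definition supported_at :: "nat \<Rightarrow> (nat \<times> nat) set \<Rightarrow> nat \<Rightarrow> bit mat" where
  "supported_at c0 S c = mat (block_size c) (block_size c) (\<lambda>ij. if c = c0 \<and> ij \<in> S then 1 else 0)"

text \<open>Levels are positive and strictly increasing, so the corners with thresholds
  \<open>level c0\<close> and \<open>level c0 - 1\<close> differ in the component c0 only. Shifts
  from both sides move the entry from (0, 0) to (x, y).\<close>

lemma coeff_ring_supported_at_singleton:
  assumes xy: "x < block_size c0" "y < block_size c0"
  shows "supported_at c0 {(x, y)} \<in> coeff_ring"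
proof -
  have "supported_at c0 {(0, 0)} c = corner (level c0) c + corner (level c0 - 1) c" for c
  proof (rule eq_matI)
    fix i j assume "i < dim_row (corner (level c0) c + corner (level c0 - 1) c)"
      "j < dim_col (corner (level c0) c + corner (level c0 - 1) c)"
    then have ij: "i < block_size c" "j < block_size c" by (auto simp: corner_def)
    have "level c \<le> level c0 - 1 \<longleftrightarrow> level c \<le> level c0 \<and> c \<noteq> c0"
      using level_ge[of c0] level_le_iff[of c c0] level_le_iff[of c0 c] by auto
    then show "supported_at c0 {(0, 0)} c $$ (i, j) = (corner (level c0) c + corner (level c0 - 1) c) $$ (i, j)"
      using ij by (auto simp: supported_at_def corner_def)
  qed (auto simp: supported_at_def corner_def)
  then have "supported_at c0 {(0, 0)} = (\<lambda>c. corner (level c0) c + corner (level c0 - 1) c)" by (rule ext)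
  then have z: "supported_at c0 {(0, 0)} \<in> coeff_ring"
    using coeff_ring.add[OF coeff_ring_corner coeff_ring_corner] by simp
  have "supported_at c0 {(x, y)} c = shift_power x c * supported_at c0 {(0, 0)} c * shift_power_inv y c" for c
  proof (rule eq_matI)
    fix i j assume "i < dim_row (shift_power x c * supported_at c0 {(0, 0)} c * shift_power_inv y c)"
      "j < dim_col (shift_power x c * supported_at c0 {(0, 0)} c * shift_power_inv y c)"
    then have ij: "i < block_size c" "j < block_size c" by (auto simp: shift_power_def shift_power_inv_def)
    obtain i' where i': "i' < block_size c" "i = (i' + x) mod block_size c" using shift_surj[OF ij(1), of x] by metis
    obtain j' where j': "j' < block_size c" "j = (j' + y) mod block_size c" using shift_surj[OF ij(2), of y] by metis
    have zc: "supported_at c0 {(0, 0)} c \<in> carrier_mat (block_size c) (block_size c)" by (simp add: supported_at_def)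
    have c1: "shift_power x c * supported_at c0 {(0, 0)} c \<in> carrier_mat (block_size c) (block_size c)"
      by (rule mult_carrier_mat[OF shift_power_carrier(1) zc])
    have "(shift_power x c * supported_at c0 {(0, 0)} c * shift_power_inv y c) $$ (i, j) = supported_at c0 {(0, 0)} c $$ (i', j')"
      using mult_shift_power_inv_index[OF c1 ij(1) j'(1)] j'(2) shift_power_mult_index[OF zc i'(1) j'(1)] i'(2) by simp
    moreover have "c = c0 \<Longrightarrow> (i = x) = (i' = 0)" "c = c0 \<Longrightarrow> (j = y) = (j' = 0)"
      using mod_add_cancel[of i' "block_size c" 0 x] mod_add_cancel[of j' "block_size c" 0 y] i' j' xy by auto
    ultimately show "supported_at c0 {(x, y)} c $$ (i, j) = (shift_power x c * supported_at c0 {(0, 0)} c * shift_power_inv y c) $$ (i, j)"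
      using ij i'(1) j'(1) by (auto simp: supported_at_def)
  qed (auto simp: supported_at_def shift_power_def shift_power_inv_def)
  then have "supported_at c0 {(x, y)} = (\<lambda>c. shift_power x c * supported_at c0 {(0, 0)} c * shift_power_inv y c)" by (rule ext)
  then show ?thesis
    using coeff_ring.mult[OF coeff_ring.mult[OF coeff_ring_shift_power z] coeff_ring_shift_power_inv] by simp
qed

lemma coeff_ring_supported_at:
  assumes "S \<subseteq> {..<block_size c0} \<times> {..<block_size c0}"
  shows "supported_at c0 S \<in> coeff_ring"
proof -
  have "finite S" using assms by (rule finite_subset) simp
  then show ?thesis using assms
  proof (induction S rule: finite_induct)
    case empty
    have "supported_at c0 {} = (\<lambda>c. diagonal (\<lambda>_ _. 1) c + diagonal (\<lambda>_ _. 1) c)"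
      by (rule ext, rule eq_matI) (auto simp: supported_at_def diagonal_def)
    then show ?case using coeff_ring.add[OF coeff_ring_one coeff_ring_one] by simp
  next
    case (insert a S)
    have a: "supported_at c0 {a} \<in> coeff_ring"
      using coeff_ring_supported_at_singleton[of "fst a" c0 "snd a"] insert.prems by auto
    have "supported_at c0 (insert a S) = (\<lambda>c. supported_at c0 {a} c + supported_at c0 S c)"
      using insert.hyps(2) by (intro ext eq_matI) (auto simp: supported_at_def)
    then show ?case using coeff_ring.add[OF a insert.IH] insert.prems by auto
  qed
qed

definition tail_unit :: "nat \<Rightarrow> nat \<Rightarrow> bit mat" where
  "tail_unit k = diagonal (\<lambda>c _. of_bool (k \<le> c))"

text \<open>The unit minus the units of the first k components, each of which is an element
  supported on one component.\<close>

lemma coeff_ring_tail_unit: "tail_unit k \<in> coeff_ring"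
proof (induction k)
  case 0
  then show ?case using coeff_ring_one by (simp add: tail_unit_def)
next
  case (Suc k)
  have s: "supported_at k {(i, i) |i. i < block_size k} \<in> coeff_ring"
    by (rule coeff_ring_supported_at) auto
  have "tail_unit (Suc k) c = tail_unit k c + supported_at k {(i, i) |i. i < block_size k} c" for c
    by (rule eq_matI; cases "c = k") (auto simp: tail_unit_def diagonal_def supported_at_def)
  then have "tail_unit (Suc k) = (\<lambda>c. tail_unit k c + supported_at k {(i, i) |i. i < block_size k} c)"
    by (rule ext)
  then show ?case using coeff_ring.add[OF Suc s] by simp
qed

definition shifted_word :: "nat \<Rightarrow> nat \<Rightarrow> bit mat" where
  "shifted_word k = diagonal (\<lambda>c x. toeplitz_word (unshift (block_size c) k x))"

lemma coeff_ring_shifted_word: "shifted_word k \<in> coeff_ring"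
proof -
  have a: "diagonal (\<lambda>_. toeplitz_word) \<in> coeff_ring"
    by (rule coeff_ring.generator) (simp add: ring_generators_def)
  have "shifted_word k = (\<lambda>c. shift_power k c * diagonal (\<lambda>_. toeplitz_word) c * shift_power_inv k c)"
    unfolding shifted_word_def shift_conjugate_diagonal ..
  then show ?thesis
    using coeff_ring.mult[OF coeff_ring.mult[OF coeff_ring_shift_power a] coeff_ring_shift_power_inv] by simp
qed

text \<open>Reduction modulo n cannot change a valuation u as long as 2^(u + 1) divides n.\<close>

lemma multiplicity_2_mod:
  fixes z :: int and n u :: nat
  assumes n: "0 < n" "2 ^ (u + 1) dvd n" and z: "2 ^ u dvd z" "\<not> 2 ^ (u + 1) dvd z"
  shows "multiplicity 2 (nat (z mod int n)) = u"
proof (rule multiplicity_eqI)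
  have r: "2 ^ k dvd nat (z mod int n) \<longleftrightarrow> 2 ^ k dvd z" if "2 ^ k dvd n" for k
  proof -
    have "2 ^ k dvd nat (z mod int n) \<longleftrightarrow> int (2 ^ k) dvd int (nat (z mod int n))"
      by (rule int_dvd_int_iff[symmetric])
    also have "\<dots> \<longleftrightarrow> 2 ^ k dvd z mod int n" using n by simp
    also have "\<dots> \<longleftrightarrow> 2 ^ k dvd z"
    proof (rule dvd_mod_iff)
      have "int (2 ^ k) dvd int n" using that by (simp only: int_dvd_int_iff)
      then show "2 ^ k dvd int n" by simp
    qed
    finally show ?thesis .
  qed
  have "2 ^ u dvd n" using n(2) by (meson dvd_trans le_imp_power_dvd le_add1)
  then show "2 ^ u dvd nat (z mod int n)" using r z(1) by blast
  show "\<not> 2 ^ Suc u dvd nat (z mod int n)" using r[of "Suc u"] n(2) z(2) by simp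
qed

text \<open>With v the valuation of j - i, choose m such that x - i - m is 2^(v + 1) modulo 2^(v +
  2). Then x - i - m has valuation v + 1 and x - j - m has valuation v, of different parity. The
  window 2^(v + 2) serves all large components and all positions x.\<close>

lemma toeplitz_word_aperiodic:
  assumes "i < j"
  shows "\<exists>L. \<forall>c x. L \<le> level c \<longrightarrow> x < block_size c \<longrightarrow> (\<exists>m<2 ^ L.
    toeplitz_word (unshift (block_size c) (i + m) x) \<noteq> toeplitz_word (unshift (block_size c) (j + m) x))"
proof -
  define p where "p = j - i"
  have p: "p \<noteq> 0" "j = i + p" using assms by (auto simp: p_def)
  have "\<not> is_unit (2::nat)" by simp
  from multiplicity_decompose'[OF p(1) this] obtain v y where vy: "p = 2 ^ v * y" "odd y" by blast
  have vp: "2 ^ v dvd int p" "\<not> 2 ^ (v + 1) dvd int p"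
    using vy by (auto simp: even_of_nat_iff)
  have "\<exists>m<2 ^ (v + 2). toeplitz_word (unshift (block_size c) (i + m) x) \<noteq> toeplitz_word (unshift (block_size c) (j + m) x)"
    if c: "v + 2 \<le> level c" for c x
  proof -
    let ?n = "block_size c"
    have n: "2 ^ (v + 2) dvd ?n" using c unfolding block_size_def by (rule le_imp_power_dvd)
    then have n': "2 ^ (v + 1) dvd ?n" by (meson dvd_trans le_imp_power_dvd le_refl add_le_mono one_le_numeral)
    define m where "m = nat ((int x - int i - 2 ^ (v + 1)) mod 2 ^ (v + 2))"
    have m: "int m = (int x - int i - 2 ^ (v + 1)) mod 2 ^ (v + 2)" by (simp add: m_def)
    have "int m < 2 ^ (v + 2)" unfolding m by simp
    then have "m < 2 ^ (v + 2)" by (metis of_nat_less_iff of_nat_numeral of_nat_power)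
    define z where "z = int x - int (i + m)"
    have "2 ^ (v + 2) dvd (int x - int i - 2 ^ (v + 1)) - int m" unfolding m by (rule dvd_minus_mod)
    moreover have "(int x - int i - 2 ^ (v + 1)) - int m = z - 2 ^ (v + 1)" by (simp add: z_def)
    ultimately have "2 ^ (v + 2) dvd z - 2 ^ (v + 1)" by metis
    then obtain q where q: "z = 2 ^ (v + 1) + 2 ^ (v + 2) * q" unfolding dvd_def by (auto simp: algebra_simps)
    have zq: "z = 2 ^ (v + 1) * (1 + 2 * q)" unfolding q by (simp add: algebra_simps)
    have z1: "2 ^ (v + 1) dvd z" unfolding zq by simp
    have z1': "\<not> 2 ^ (v + 1 + 1) dvd z" unfolding zq power_add[of 2 "v + 1" 1] by (simp add: dvd_mult_cancel_left del: power_Suc)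
    have zp: "int x - int (j + m) = z - int p" by (simp add: z_def p(2))
    have z2: "2 ^ v dvd z - int p" using z1 vp(1) by (meson dvd_diff dvd_trans le_add1 le_imp_power_dvd)
    have z2': "\<not> 2 ^ (v + 1) dvd z - int p" using z1 vp(2) by (metis dvd_diff diff_diff_eq2 add_diff_cancel_left')
    have "multiplicity 2 (unshift ?n (i + m) x) = v + 1"
      unfolding unshift_def z_def[symmetric] using n z1 z1' by (intro multiplicity_2_mod) auto
    moreover have "multiplicity 2 (unshift ?n (j + m) x) = v"
      unfolding unshift_def zp using n' z2 z2' by (intro multiplicity_2_mod) auto
    ultimately show ?thesis using \<open>m < 2 ^ (v + 2)\<close>
      by (intro exI[of _ m]) (simp add: toeplitz_word_def)
  qed
  then show ?thesis by blast
qed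

lemma unshift_unshift: "0 < n \<Longrightarrow> unshift n i (unshift n m x) = unshift n (i + m) x"
  by (simp add: unshift_def mod_simps algebra_simps)

text \<open>The shift conjugates \<open>g m\<close> of the given diagonal lie in J. By aperiodicity,
  at every position of a far component one of the first 2^L of them is 1, so their union is the
  identity on a tail.\<close>

lemma ideal_contains_tail_unit:
  assumes add: "\<And>x y. x \<in> J \<Longrightarrow> y \<in> J \<Longrightarrow> (\<lambda>c. x c + y c) \<in> J"
    and left: "\<And>r x. r \<in> coeff_ring \<Longrightarrow> x \<in> J \<Longrightarrow> (\<lambda>c. r c * x c) \<in> J"
    and right: "\<And>r x. r \<in> coeff_ring \<Longrightarrow> x \<in> J \<Longrightarrow> (\<lambda>c. x c * r c) \<in> J"
    and ij: "i < j" and f: "(\<lambda>c. shifted_word i c + shifted_word j c) \<in> J"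
  shows "\<exists>k. tail_unit k \<in> J"
proof -
  define g where "g m c x = toeplitz_word (unshift (block_size c) (i + m) x) + toeplitz_word (unshift (block_size c) (j + m) x)" for m c x
  have gJ: "diagonal (g m) \<in> J" for m
  proof -
    let ?h = "\<lambda>c x. toeplitz_word (unshift (block_size c) i x) + toeplitz_word (unshift (block_size c) j x)"
    have "(\<lambda>c. shifted_word i c + shifted_word j c) = diagonal ?h"
      by (rule ext) (simp add: shifted_word_def diagonal_add)
    then have "diagonal ?h \<in> J" using f by metis
    then have "(\<lambda>c. shift_power m c * diagonal ?h c * shift_power_inv m c) \<in> J"
      by (rule right[OF coeff_ring_shift_power_inv left[OF coeff_ring_shift_power]])
    moreover have "(\<lambda>c. shift_power m c * diagonal ?h c * shift_power_inv m c) = diagonal (g m)"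
      unfolding shift_conjugate_diagonal g_def by (simp add: unshift_unshift)
    ultimately show ?thesis by simp
  qed
  \<comment> \<open>Union of idempotents: a + b + a b is 1 where a or b is, so \<open>u m\<close> is
    the indicator of the union of the supports of \<open>g 0\<close>, ...,
    \<open>g (m - 1)\<close>.\<close>
  define u where "u = rec_nat (\<lambda>_ _. 0) (\<lambda>m u c x. u c x + g m c x + u c x * g m c x)"
  have u0: "u 0 = (\<lambda>_ _. 0)" and uS: "u (Suc m) = (\<lambda>c x. u m c x + g m c x + u m c x * g m c x)" for m
    by (simp_all add: u_def)
  have uJ: "diagonal (u m) \<in> J \<and> diagonal (u m) \<in> coeff_ring" for m
  proof (induction m)
    case 0
    have z: "diagonal (u 0) = (\<lambda>c. diagonal (g 0) c + diagonal (g 0) c)"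
      by (rule ext) (simp add: diagonal_add u0)
    have "(\<lambda>c. diagonal (\<lambda>_ _. 0) c * diagonal (g 0) c) = diagonal (\<lambda>_ _. 0)"
      by (rule ext) (simp add: diagonal_mult)
    then show ?case using add[OF gJ gJ] z coeff_ring_diagonal_zero by (simp add: u0)
  next
    case (Suc m)
    have e: "diagonal (u (Suc m)) = (\<lambda>c. (diagonal (u m) c + diagonal (g m) c) + diagonal (u m) c * diagonal (g m) c)"
      by (rule ext) (simp add: diagonal_add diagonal_mult uS)
    have gR: "diagonal (g m) \<in> coeff_ring"
    proof -
      have "(\<lambda>c. shifted_word (i + m) c + shifted_word (j + m) c) = diagonal (g m)"
        unfolding shifted_word_def diagonal_add g_def ..
      then show ?thesis using coeff_ring.add[OF coeff_ring_shifted_word coeff_ring_shifted_word] by metis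
    qed
    show ?case unfolding e
      using add[OF add[OF _ gJ] left[OF _ gJ]] coeff_ring.add[OF coeff_ring.add[OF _ gR] coeff_ring.mult[OF _ gR]] Suc by blast
  qed
  have u1: "u m c x = 1" if "m' < m" "g m' c x = 1" for m m' c x
    using that
  proof (induction m)
    case (Suc m)
    show ?case
    proof (cases "m' = m")
      case True
      then show ?thesis using Suc.prems by (cases "u m c x") (simp_all add: uS)
    next
      case False
      then have "u m c x = 1" using Suc by simp
      then show ?thesis by (cases "g m c x") (simp_all add: uS)
    qed
  qed simp
  obtain L where L: "\<And>c x. L \<le> level c \<Longrightarrow> x < block_size c \<Longrightarrow> \<exists>m<2 ^ L.
    toeplitz_word (unshift (block_size c) (i + m) x) \<noteq> toeplitz_word (unshift (block_size c) (j + m) x)"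
    using toeplitz_word_aperiodic[OF ij] by blast
  have uL: "u (2 ^ L) c x = 1" if c: "L \<le> c" and x: "x < block_size c" for c x
  proof -
    have "L \<le> level c" using c level_ge[of c] by simp
    then obtain m where m: "m < 2 ^ L" "toeplitz_word (unshift (block_size c) (i + m) x) \<noteq> toeplitz_word (unshift (block_size c) (j + m) x)"
      using L x by blast
    have "g m c x = 1" unfolding g_def using m(2)
      by (cases "toeplitz_word (unshift (block_size c) (i + m) x)"; cases "toeplitz_word (unshift (block_size c) (j + m) x)") auto
    then show ?thesis using u1 m(1) by blast
  qed
  have "tail_unit L = (\<lambda>c. tail_unit L c * diagonal (u (2 ^ L)) c)"
  proof
    fix c
    show "tail_unit L c = tail_unit L c * diagonal (u (2 ^ L)) c"
      unfolding tail_unit_def diagonal_mult by (rule eq_matI) (auto simp: diagonal_def uL)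
  qed
  then have "tail_unit L \<in> J" using left[OF coeff_ring_tail_unit] uJ by metis
  then show ?thesis by blast
qed

section \<open>The group\<close>

definition product_group :: "(nat \<Rightarrow> bit mat) monoid" where
  "product_group = \<lparr>carrier = {f. \<forall>c. f c \<in> carrier (GL (comp_dim c))},
     mult = (\<lambda>f g c. f c * g c), one = (\<lambda>c. 1\<^sub>m (comp_dim c))\<rparr>"

lemma product_group_simps [simp]:
  "f \<in> carrier product_group \<longleftrightarrow> (\<forall>c. f c \<in> carrier (GL (comp_dim c)))"
  "f \<otimes>\<^bsub>product_group\<^esub> g = (\<lambda>c. f c * g c)" "\<one>\<^bsub>product_group\<^esub> = (\<lambda>c. 1\<^sub>m (comp_dim c))"
  by (simp_all add: product_group_def)

lemma product_group_group: "group product_group"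
proof (rule groupI)
  fix f assume "f \<in> carrier product_group"
  then have "\<forall>c. \<exists>B. B \<in> carrier (GL (comp_dim c)) \<and> B * f c = 1\<^sub>m (comp_dim c)" using GL_E by simp metis
  then obtain g where "\<And>c. g c \<in> carrier (GL (comp_dim c)) \<and> g c * f c = 1\<^sub>m (comp_dim c)" by metis
  then show "\<exists>g\<in>carrier product_group. g \<otimes>\<^bsub>product_group\<^esub> f = \<one>\<^bsub>product_group\<^esub>"
    by (intro bexI[of _ g]) auto
next
  fix f g h assume "f \<in> carrier product_group" "g \<in> carrier product_group" "h \<in> carrier product_group"
  then have c: "f c \<in> carrier_mat (comp_dim c) (comp_dim c)" "g c \<in> carrier_mat (comp_dim c) (comp_dim c)"
    "h c \<in> carrier_mat (comp_dim c) (comp_dim c)" for c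
    using GL_carrier_mat by auto
  then show "f \<otimes>\<^bsub>product_group\<^esub> g \<otimes>\<^bsub>product_group\<^esub> h = f \<otimes>\<^bsub>product_group\<^esub> (g \<otimes>\<^bsub>product_group\<^esub> h)"
    using assoc_mult_mat[OF c] by simp
next
  fix f assume "f \<in> carrier product_group"
  then have "f c \<in> carrier_mat (comp_dim c) (comp_dim c)" for c using GL_carrier_mat by auto
  then have "1\<^sub>m (comp_dim c) * f c = f c" for c by (rule left_mult_one_mat)
  then show "\<one>\<^bsub>product_group\<^esub> \<otimes>\<^bsub>product_group\<^esub> f = f" by simp
qed (auto intro: GL_mult)

section \<open>The finitely generated group \<Gamma> and its elementary matrices\<close>

definition elem :: "nat \<Rightarrow> nat \<Rightarrow> (nat \<Rightarrow> bit mat) \<Rightarrow> nat \<Rightarrow> bit mat" where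
  "elem p q x c = elementary (block_size c) p q (x c)"

lemma elem_closed:
  "x \<in> coeff_ring \<Longrightarrow> p < 3 \<Longrightarrow> q < 3 \<Longrightarrow> p \<noteq> q \<Longrightarrow> elem p q x \<in> carrier product_group"
  by (simp add: elem_def comp_dim_def elementary_GL coeff_ring_carrier)

definition elementary_generators :: "(nat \<Rightarrow> bit mat) set" where
  "elementary_generators = {elem p q x |p q x. p < 3 \<and> q < 3 \<and> p \<noteq> q \<and> x \<in> ring_generators}"

text \<open>Defined by finitely many generators inside the full product; that these generate all
  elementary matrices over the coefficient ring is \<open>elem_in_\<Gamma>\<close>.\<close>

definition \<Gamma> :: "(nat \<Rightarrow> bit mat) monoid" where
  "\<Gamma> = product_group\<lparr>carrier := generate product_group elementary_generators\<rparr>"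

lemma elementary_generators_closed: "elementary_generators \<subseteq> carrier product_group"
  using elem_closed coeff_ring.generator by (fastforce simp: elementary_generators_def)

lemma finite_elementary_generators: "finite elementary_generators"
proof (rule finite_subset)
  show "elementary_generators \<subseteq> (\<lambda>(p, q, x). elem p q x) ` ({..<3} \<times> {..<3} \<times> ring_generators)"
    by (fastforce simp: elementary_generators_def image_iff)
  show "finite ((\<lambda>(p, q, x). elem p q x) ` ({..<3} \<times> {..<3} \<times> ring_generators))"
    by (simp add: ring_generators_def)
qed

lemma \<Gamma>_subgroup: "subgroup (carrier \<Gamma>) product_group"
  using group.generate_is_subgroup[OF product_group_group elementary_generators_closed] by (simp add: \<Gamma>_def)

lemma \<Gamma>_group: "group \<Gamma>"
  using subgroup.subgroup_is_group[OF \<Gamma>_subgroup product_group_group] by (simp add: \<Gamma>_def)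

lemma \<Gamma>_simps [simp]:
  "f \<otimes>\<^bsub>\<Gamma>\<^esub> g = (\<lambda>c. f c * g c)" "\<one>\<^bsub>\<Gamma>\<^esub> = (\<lambda>c. 1\<^sub>m (comp_dim c))"
  by (simp_all add: \<Gamma>_def)

lemma \<Gamma>_component: "f \<in> carrier \<Gamma> \<Longrightarrow> f c \<in> carrier (GL (comp_dim c))"
  using subgroup.subset[OF \<Gamma>_subgroup] by auto

lemma \<Gamma>_mult: "f \<in> carrier \<Gamma> \<Longrightarrow> g \<in> carrier \<Gamma> \<Longrightarrow> (\<lambda>c. f c * g c) \<in> carrier \<Gamma>"
  using group.is_monoid[OF \<Gamma>_group] monoid.m_closed by fastforce

lemma \<Gamma>_finitely_generated: "finitely_generated_group \<Gamma>"
  unfolding finitely_generated_group_def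
proof (intro exI[of _ elementary_generators] conjI)
  show "elementary_generators \<subseteq> carrier \<Gamma>"
    by (auto simp: \<Gamma>_def intro: generate.incl)
  then show "generate \<Gamma> elementary_generators = carrier \<Gamma>"
    using group.generate_consistent[OF product_group_group _ \<Gamma>_subgroup, of elementary_generators]
    by (simp add: \<Gamma>_def)
qed (rule finite_elementary_generators)

lemma elem_add:
  assumes "x \<in> coeff_ring" "y \<in> coeff_ring" "p < 3" "q < 3" "p \<noteq> q"
  shows "elem p q (\<lambda>c. x c + y c) = (\<lambda>c. elem p q x c * elem p q y c)"
  using assms by (intro ext) (simp add: elem_def elementary_add coeff_ring_carrier)

lemma elem_mult:
  assumes "x \<in> coeff_ring" "y \<in> coeff_ring" "p < 3" "q < 3" "r < 3" "p \<noteq> q" "q \<noteq> r" "p \<noteq> r"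
  shows "elem p r (\<lambda>c. x c * y c) = (\<lambda>c. elem p q x c * (elem q r y c * (elem p q x c * elem q r y c)))"
  using assms unfolding elem_def by (intro ext elementary_mult coeff_ring_carrier)

lemma third_index: "p < 3 \<Longrightarrow> q < 3 \<Longrightarrow> \<exists>r<3. r \<noteq> p \<and> r \<noteq> (q::nat)"
proof -
  assume "p < 3" "q < 3"
  then have "p \<in> {0, 1, 2}" "q \<in> {0, 1, 2}" by auto
  then show ?thesis
    by (intro exI[of _ "if p \<noteq> 0 \<and> q \<noteq> 0 then 0 else if p \<noteq> 1 \<and> q \<noteq> 1 then 1 else 2"]) auto
qed

text \<open>Sums in the ring become products, and products become commutators through a third index.
  This is why matrices of size 3 are taken.\<close>

lemma elem_in_\<Gamma>:
  "x \<in> coeff_ring \<Longrightarrow> p < 3 \<Longrightarrow> q < 3 \<Longrightarrow> p \<noteq> q \<Longrightarrow> elem p q x \<in> carrier \<Gamma>"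
proof (induction arbitrary: p q rule: coeff_ring.induct)
  case (generator x)
  then have "elem p q x \<in> elementary_generators" by (auto simp: elementary_generators_def)
  then show ?case by (auto simp: \<Gamma>_def intro: generate.incl)
next
  case (add x y)
  then show ?case by (simp add: elem_add \<Gamma>_mult)
next
  case (mult x y)
  obtain r where r: "r < 3" "r \<noteq> p" "r \<noteq> q" using third_index mult.prems by metis
  have "elem p q (\<lambda>c. x c * y c) = (\<lambda>c. elem p r x c * (elem r q y c * (elem p r x c * elem r q y c)))"
    using r mult by (intro elem_mult) auto
  then show ?case using mult r by (simp add: \<Gamma>_mult)
qed

section \<open>The single components and finite truncations inside \<Gamma>\<close>

definition at_component :: "nat \<Rightarrow> bit mat \<Rightarrow> nat \<Rightarrow> bit mat" where
  "at_component c A c' = (if c' = c then A else 1\<^sub>m (comp_dim c'))"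

lemma at_component_mult:
  "A \<in> carrier_mat (comp_dim c) (comp_dim c) \<Longrightarrow> B \<in> carrier_mat (comp_dim c) (comp_dim c) \<Longrightarrow>
    at_component c (A * B) = (\<lambda>c'. at_component c A c' * at_component c B c')"
  by (auto simp: at_component_def)

text \<open>For i and j in different blocks the transvection is an elementary matrix over a ring
  element supported on one component. Inside one block the commutator relation gives a detour
  through an index l of another block.\<close>

lemma at_component_transvection:
  assumes ij: "i < comp_dim c" "j < comp_dim c" "i \<noteq> j"
  shows "at_component c (transvection (comp_dim c) i j) \<in> carrier \<Gamma>"
proof -
  have base: "at_component c (transvection (comp_dim c) i j) \<in> carrier \<Gamma>"
    if ij: "i < comp_dim c" "j < comp_dim c" "i mod 3 \<noteq> j mod 3" for i j
  proof -
    have b: "i div 3 < block_size c" "j div 3 < block_size c" using ij by (auto simp: comp_dim_def div3_less)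
    then have s: "supported_at c {(i div 3, j div 3)} \<in> coeff_ring" by (rule coeff_ring_supported_at_singleton)
    have "at_component c (transvection (comp_dim c) i j) = elem (i mod 3) (j mod 3) (supported_at c {(i div 3, j div 3)})"
    proof
      fix c'
      show "at_component c (transvection (comp_dim c) i j) c' = elem (i mod 3) (j mod 3) (supported_at c {(i div 3, j div 3)}) c'"
      proof (cases "c' = c")
        case True
        have "supported_at c {(i div 3, j div 3)} c = mat (block_size c) (block_size c) (\<lambda>(x, y). if x = i div 3 \<and> y = j div 3 then 1 else 0)"
          unfolding supported_at_def by (rule cong_mat) auto
        then show ?thesis using True transvection_elementary[of i "block_size c" j] ij
          by (simp add: at_component_def elem_def comp_dim_def)
      next
        case False
        then have "supported_at c {(i div 3, j div 3)} c' = 0\<^sub>m (block_size c') (block_size c')"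
          by (intro eq_matI) (auto simp: supported_at_def)
        then show ?thesis using False by (simp add: at_component_def elem_def elementary_zero comp_dim_def)
      qed
    qed
    then show ?thesis using elem_in_\<Gamma>[OF s, of "i mod 3" "j mod 3"] ij(3) by simp
  qed
  show ?thesis
  proof (cases "i mod 3 = j mod 3")
    case False
    then show ?thesis using base ij by blast
  next
    case True
    \<comment> \<open>\<open>l\<close> has the inner coordinate of i and lies in the cyclically next
      block.\<close>
    define l where "l = 3 * (i div 3) + (i + 1) mod 3"
    have l3: "l mod 3 = (i + 1) mod 3" by (simp add: l_def)
    have "(i + 1) mod 3 \<noteq> i mod 3" by presburger
    then have l: "l mod 3 \<noteq> i mod 3" "l mod 3 \<noteq> j mod 3" using l3 True by auto
    have "i div 3 < block_size c" using ij by (auto simp: comp_dim_def div3_less)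
    moreover have "(i + 1) mod 3 < 3" by simp
    ultimately have lc: "l < comp_dim c" unfolding l_def comp_dim_def by linarith
    let ?t = "transvection (comp_dim c)"
    have ne: "i \<noteq> l" "l \<noteq> j" using l by auto
    note c = transvection_carrier
    have "?t i l * ?t l j = ?t l j * (?t i l * ?t i j)" using ij lc ne by (intro transvection_commutator) auto
    then have "?t l j * (?t i l * ?t l j) = ?t i l * ?t i j"
      using transvection_cancel[OF lc ij(2) ne(2) mult_carrier_mat[OF c c]] by metis
    then have "?t i l * (?t l j * (?t i l * ?t l j)) = ?t i j"
      using transvection_cancel[OF ij(1) lc ne(1) c] by metis
    then have "at_component c (?t i j) = (\<lambda>c'. at_component c (?t i l) c' * (at_component c (?t l j) c' *
        (at_component c (?t i l) c' * at_component c (?t l j) c')))"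
      by (auto simp: at_component_def)
    moreover have "at_component c (?t i l) \<in> carrier \<Gamma>" "at_component c (?t l j) \<in> carrier \<Gamma>"
      using base ij lc l by metis+
    ultimately show ?thesis by (simp add: \<Gamma>_mult)
  qed
qed

lemma \<Gamma>_one: "(\<lambda>c. 1\<^sub>m (comp_dim c)) \<in> carrier \<Gamma>"
  using monoid.one_closed[OF group.is_monoid[OF \<Gamma>_group]] by simp

lemma at_component_in_\<Gamma>:
  assumes A: "A \<in> carrier (GL (comp_dim c))"
  shows "at_component c A \<in> carrier \<Gamma>"
proof -
  have "A \<in> {A \<in> carrier (GL (comp_dim c)). at_component c A \<in> carrier \<Gamma>}"
  proof (rule GL_generated_by_transvections[OF _ _ A])
    have "at_component c (1\<^sub>m (comp_dim c)) = (\<lambda>c. 1\<^sub>m (comp_dim c))" by (auto simp: at_component_def)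
    then show "1\<^sub>m (comp_dim c) \<in> {A \<in> carrier (GL (comp_dim c)). at_component c A \<in> carrier \<Gamma>}"
      using \<Gamma>_one by simp
  next
    fix B i j assume B: "B \<in> {A \<in> carrier (GL (comp_dim c)). at_component c A \<in> carrier \<Gamma>}"
      and ij: "i < comp_dim c" "j < comp_dim c" "i \<noteq> j"
    have "at_component c (transvection (comp_dim c) i j * B) \<in> carrier \<Gamma>"
      using at_component_mult[OF transvection_carrier GL_carrier_mat[of B "comp_dim c"]]
        \<Gamma>_mult[OF at_component_transvection[OF ij], of "at_component c B"] B by auto
    then show "transvection (comp_dim c) i j * B \<in> {A \<in> carrier (GL (comp_dim c)). at_component c A \<in> carrier \<Gamma>}"
      using B ij by (auto intro!: GL_mult)
  qed
  then show ?thesis by simp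
qed

definition truncate :: "nat \<Rightarrow> (nat \<Rightarrow> bit mat) \<Rightarrow> nat \<Rightarrow> bit mat" where
  "truncate k f c = (if c < k then f c else 1\<^sub>m (comp_dim c))"

lemma truncate_Suc:
  assumes "\<And>c. f c \<in> carrier_mat (comp_dim c) (comp_dim c)"
  shows "truncate (Suc k) f = (\<lambda>c. truncate k f c * at_component k (f k) c)"
  by (auto simp: truncate_def at_component_def less_Suc_eq left_mult_one_mat[OF assms] right_mult_one_mat[OF assms])

lemma truncate_in_\<Gamma>:
  assumes "f \<in> carrier product_group"
  shows "truncate k f \<in> carrier \<Gamma>"
proof (induction k)
  case 0
  then show ?case using \<Gamma>_one by (simp add: truncate_def)
next
  case (Suc k)
  have "f c \<in> carrier_mat (comp_dim c) (comp_dim c)" for c using assms GL_carrier_mat by simp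
  then show ?case using truncate_Suc[of f k] \<Gamma>_mult[OF Suc at_component_in_\<Gamma>, of "f k"] assms by simp
qed

lemma \<Gamma>_infinite: "infinite (carrier \<Gamma>)"
proof -
  have three: "1 < comp_dim c" "0 < comp_dim c" for c using block_size_pos[of c] unfolding comp_dim_def by linarith+
  let ?f = "\<lambda>c. at_component c (transvection (comp_dim c) 0 1)"
  have t: "transvection (comp_dim c) 0 1 \<noteq> 1\<^sub>m (comp_dim c)" for c
  proof
    assume "transvection (comp_dim c) 0 1 = 1\<^sub>m (comp_dim c)"
    then have "transvection (comp_dim c) 0 1 $$ (0, 1) = 1\<^sub>m (comp_dim c) $$ (0, 1)" by simp
    then show False using three[of c] by (simp add: transvection_index)
  qed
  have "inj ?f"
  proof (rule injI)
    fix c c' assume "?f c = ?f c'"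
    then have "?f c c = ?f c' c" by simp
    then show "c = c'" using t[of c] by (auto simp: at_component_def split: if_splits)
  qed
  then have "infinite (range ?f)" by (rule range_inj_infinite)
  moreover have "range ?f \<subseteq> carrier \<Gamma>" using three at_component_transvection by auto
  ultimately show ?thesis using infinite_super by blast
qed

lemma \<Gamma>_residually_finite: "residually_finite \<Gamma>"
  unfolding residually_finite_def
proof (intro ballI impI)
  interpret \<Gamma>: group \<Gamma> by (rule \<Gamma>_group)
  fix g assume g: "g \<in> carrier \<Gamma>" "g \<noteq> \<one>\<^bsub>\<Gamma>\<^esub>"
  then obtain c where c: "g c \<noteq> 1\<^sub>m (comp_dim c)" by auto
  have hom: "group_hom \<Gamma> (GL (comp_dim c)) (\<lambda>f. f c)"
    by (intro group_hom.intro group_hom_axioms.intro \<Gamma>_group GL_group homI) (auto simp: \<Gamma>_component)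
  interpret h: group_hom \<Gamma> "GL (comp_dim c)" "\<lambda>f. f c" by (rule hom)
  define N where "N = kernel \<Gamma> (GL (comp_dim c)) (\<lambda>f. f c)"
  have N: "N \<lhd> \<Gamma>" unfolding N_def by (rule h.normal_kernel)
  have "finite (rcosets\<^bsub>\<Gamma>\<^esub> N)"
  proof (rule inj_on_finite)
    \<comment> \<open>A coset of the kernel is sent to the singleton of the component common to its
      elements, so the cosets inject into a finite set.\<close>
    define \<phi> where "\<phi> C = (\<lambda>f. f c) ` C" for C :: "(nat \<Rightarrow> bit mat) set"
    have coset: "\<phi> (N #>\<^bsub>\<Gamma>\<^esub> x) = {x c}" if x: "x \<in> carrier \<Gamma>" for x
    proof -
      have "x c \<in> carrier_mat (comp_dim c) (comp_dim c)" using \<Gamma>_component[OF x] GL_carrier_mat by blast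
      then show ?thesis using \<Gamma>_one unfolding \<phi>_def r_coset_def N_def kernel_def
        by (force simp: image_iff)
    qed
    show "inj_on \<phi> (rcosets\<^bsub>\<Gamma>\<^esub> N)"
    proof (rule inj_onI)
      fix A B assume "A \<in> rcosets\<^bsub>\<Gamma>\<^esub> N" "B \<in> rcosets\<^bsub>\<Gamma>\<^esub> N" and eq: "\<phi> A = \<phi> B"
      then obtain x y where xy: "x \<in> carrier \<Gamma>" "y \<in> carrier \<Gamma>" "A = N #>\<^bsub>\<Gamma>\<^esub> x" "B = N #>\<^bsub>\<Gamma>\<^esub> y"
        by (auto simp: RCOSETS_def)
      then have "x c = y c" using eq coset by simp
      have "x \<otimes>\<^bsub>\<Gamma>\<^esub> inv\<^bsub>\<Gamma>\<^esub> y \<in> N"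
        unfolding N_def kernel_def using xy \<open>x c = y c\<close> h.hom_mult[of x "inv\<^bsub>\<Gamma>\<^esub> y"] h.hom_inv[of y]
          group.r_inv[OF GL_group, of "y c" "comp_dim c"] \<Gamma>_component by (simp del: \<Gamma>_simps GL_simps(1))
      then show "A = B"
        unfolding xy(3,4) using xy(1,2) N \<Gamma>.coset_join2 by (metis \<Gamma>.coset_mult_inv1 \<Gamma>.coset_mult_assoc \<Gamma>.inv_closed \<Gamma>.m_closed \<Gamma>.l_inv \<Gamma>.m_assoc \<Gamma>.r_one normal_imp_subgroup subgroup.subset)
    qed
    show "\<phi> ` (rcosets\<^bsub>\<Gamma>\<^esub> N) \<subseteq> (\<lambda>A. {A}) ` carrier_mat (comp_dim c) (comp_dim c)"
      using coset \<Gamma>_component GL_carrier_mat by (fastforce simp: RCOSETS_def)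
    show "finite ((\<lambda>A. {A}) ` carrier_mat (comp_dim c) (comp_dim c) :: bit mat set set)"
      using finite_carrier_mat_bit by blast
  qed
  moreover have "g \<notin> N" using c g by (simp add: N_def kernel_def)
  ultimately show "\<exists>N. N \<lhd> \<Gamma> \<and> finite (rcosets\<^bsub>\<Gamma>\<^esub> N) \<and> g \<notin> N" using N by blast
qed

section \<open>Representations factor through finitely many components\<close>

lemma \<Gamma>_in_product_group: "f \<in> carrier \<Gamma> \<Longrightarrow> f \<in> carrier product_group"
  using \<Gamma>_component by simp

text \<open>An arbitrary finite-dimensional representation, possibly reducible and a priori with
  infinite image.\<close>

context
  fixes d :: nat and r :: "(nat \<Rightarrow> bit mat) \<Rightarrow> complex mat"
  assumes rep: "mat_rep \<Gamma> d r"
begin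

lemma rep_carrier: "f \<in> carrier \<Gamma> \<Longrightarrow> r f \<in> carrier_mat d d"
  and rep_one: "r (\<lambda>c. 1\<^sub>m (comp_dim c)) = 1\<^sub>m d"
  and rep_mult: "f \<in> carrier \<Gamma> \<Longrightarrow> g \<in> carrier \<Gamma> \<Longrightarrow> r (\<lambda>c. f c * g c) = r f * r g"
  using mat_repD[OF rep] by simp_all

lemma rep_elem_involution:
  assumes "x \<in> coeff_ring" "p < 3" "q < 3" "p \<noteq> q"
  shows "r (elem p q x) * r (elem p q x) = 1\<^sub>m d"
proof -
  have "(\<lambda>c. elem p q x c * elem p q x c) = (\<lambda>c. 1\<^sub>m (comp_dim c))"
    using assms by (intro ext) (simp add: elem_def comp_dim_def elementary_involution coeff_ring_carrier)
  then show ?thesis using rep_mult[OF elem_in_\<Gamma> elem_in_\<Gamma>, of x p q x p q] assms rep_one by simp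
qed

text \<open>A commutator acts trivially as soon as one of its two arguments does.\<close>

lemma rep_elem_mult_trivial:
  assumes x: "x \<in> coeff_ring" "y \<in> coeff_ring"
    and pqs: "p < 3" "q < 3" "s < 3" "p \<noteq> q" "q \<noteq> s" "p \<noteq> s"
    and triv: "r (elem p q x) = 1\<^sub>m d \<or> r (elem q s y) = 1\<^sub>m d"
  shows "r (elem p s (\<lambda>c. x c * y c)) = 1\<^sub>m d"
proof -
  have A: "elem p q x \<in> carrier \<Gamma>" and B: "elem q s y \<in> carrier \<Gamma>" using x pqs by (auto intro: elem_in_\<Gamma>)
  note c = rep_carrier[OF A] rep_carrier[OF B]
  have "r (elem p s (\<lambda>c. x c * y c)) = r (elem p q x) * (r (elem q s y) * (r (elem p q x) * r (elem q s y)))"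
    unfolding elem_mult[OF x pqs] using A B by (simp add: rep_mult \<Gamma>_mult)
  moreover have "r (elem p q x) * r (elem p q x) = 1\<^sub>m d" "r (elem q s y) * r (elem q s y) = 1\<^sub>m d"
    using x pqs by (auto intro: rep_elem_involution)
  ultimately show ?thesis using triv c by auto
qed

definition trivial_ideal :: "(nat \<Rightarrow> bit mat) set" where
  "trivial_ideal = {x \<in> coeff_ring. \<forall>p<3. \<forall>q<3. p \<noteq> q \<longrightarrow> r (elem p q x) = 1\<^sub>m d}"

lemma mult_one_coeff_ring:
  assumes "x \<in> coeff_ring"
  shows "(\<lambda>c. x c * diagonal (\<lambda>_ _. 1) c) = x" "(\<lambda>c. diagonal (\<lambda>_ _. 1) c * x c) = x"
  unfolding diagonal_one
  by (simp_all add: left_mult_one_mat[OF coeff_ring_carrier[OF assms]] right_mult_one_mat[OF coeff_ring_carrier[OF assms]])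

text \<open>Multiplication by the unit moves a trivially acting element to another position in the
  same row or column; five moves from (0, 1) reach all positions.\<close>

lemma trivial_idealI:
  assumes x: "x \<in> coeff_ring" and triv: "r (elem 0 1 x) = 1\<^sub>m d"
  shows "x \<in> trivial_ideal"
proof -
  have step1: "r (elem p s x) = 1\<^sub>m d"
    if "r (elem p q x) = 1\<^sub>m d" "p < 3" "q < 3" "s < 3" "p \<noteq> q" "q \<noteq> s" "p \<noteq> s" for p q s
    using rep_elem_mult_trivial[OF x coeff_ring_one that(2-7)] that(1) mult_one_coeff_ring[OF x] by simp
  have step2: "r (elem s q x) = 1\<^sub>m d"
    if "r (elem p q x) = 1\<^sub>m d" "p < 3" "q < 3" "s < 3" "p \<noteq> q" "q \<noteq> s" "p \<noteq> s" for p q s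
    using rep_elem_mult_trivial[OF coeff_ring_one x that(4,2,3)] that mult_one_coeff_ring[OF x] by auto
  have 01: "r (elem 0 1 x) = 1\<^sub>m d" by fact
  have 02: "r (elem 0 2 x) = 1\<^sub>m d" by (rule step1[OF 01]) auto
  have 21: "r (elem 2 1 x) = 1\<^sub>m d" by (rule step2[OF 01]) auto
  have 12: "r (elem 1 2 x) = 1\<^sub>m d" by (rule step2[OF 02]) auto
  have 20: "r (elem 2 0 x) = 1\<^sub>m d" by (rule step1[OF 21]) auto
  have 10: "r (elem 1 0 x) = 1\<^sub>m d" by (rule step1[OF 12]) auto
  have "r (elem p q x) = 1\<^sub>m d" if "p < 3" "q < 3" "p \<noteq> q" for p q
  proof -
    have "p = 0 \<or> p = 1 \<or> p = 2" "q = 0 \<or> q = 1 \<or> q = 2" using that by linarith+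
    then show ?thesis using that(3) 01 02 21 12 20 10 by metis
  qed
  then show ?thesis using x by (simp add: trivial_ideal_def)
qed

lemma tail_unit_trivial: "\<exists>k. tail_unit k \<in> trivial_ideal"
proof -
  define g where "g i = r (elem 0 1 (shifted_word i))" for i
  have e: "elem 0 1 (shifted_word i) \<in> carrier \<Gamma>" for i
    by (rule elem_in_\<Gamma>[OF coeff_ring_shifted_word]) auto
  have add: "r (elem 0 1 (\<lambda>c. shifted_word i c + shifted_word j c)) = g i * g j" for i j
    unfolding g_def rep_mult[OF e e, symmetric]
    by (subst elem_add) (auto intro: coeff_ring_shifted_word)
  have sw: "shifted_word i c \<in> carrier_mat (block_size c) (block_size c)" for i c
    by (rule coeff_ring_carrier[OF coeff_ring_shifted_word])
  have sq: "g i * g i = 1\<^sub>m d" for i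
    unfolding g_def by (rule rep_elem_involution[OF coeff_ring_shifted_word]) auto
  have "\<exists>i<2 ^ d + 1. \<exists>j<2 ^ d + 1. i \<noteq> j \<and> g i = g j"
  proof (rule commuting_involutions_pigeonhole[of d])
    show "g i * g j = g j * g i" for i j
      unfolding add[symmetric] by (simp add: comm_add_mat[OF sw sw])
  qed (use rep_carrier[OF e] sq in \<open>auto simp: g_def\<close>)
  then obtain i j where ij: "i < j" "g i = g j" by (metis linorder_neqE_nat)
  have "r (elem 0 1 (\<lambda>c. shifted_word i c + shifted_word j c)) = 1\<^sub>m d" unfolding add ij(2) by (rule sq)
  then have f: "(\<lambda>c. shifted_word i c + shifted_word j c) \<in> trivial_ideal"
    by (intro trivial_idealI coeff_ring.add coeff_ring_shifted_word)
  have "(\<lambda>c. x c + y c) \<in> trivial_ideal" if "x \<in> trivial_ideal" "y \<in> trivial_ideal" for x y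
  proof -
    have xy: "x \<in> coeff_ring" "y \<in> coeff_ring" using that by (auto simp: trivial_ideal_def)
    have "r (elem 0 1 (\<lambda>c. x c + y c)) = r (elem 0 1 x) * r (elem 0 1 y)"
      by (subst elem_add[OF xy]) (auto intro!: rep_mult elem_in_\<Gamma> xy)
    also have "\<dots> = 1\<^sub>m d" using that by (simp add: trivial_ideal_def)
    finally show ?thesis by (intro trivial_idealI coeff_ring.add xy)
  qed
  moreover have "(\<lambda>c. y c * x c) \<in> trivial_ideal" if "y \<in> coeff_ring" "x \<in> trivial_ideal" for x y
  proof (rule trivial_idealI)
    have x: "x \<in> coeff_ring" "r (elem 2 1 x) = 1\<^sub>m d" using that by (auto simp: trivial_ideal_def)
    show "(\<lambda>c. y c * x c) \<in> coeff_ring" by (intro coeff_ring.mult that(1) x(1))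
    show "r (elem 0 1 (\<lambda>c. y c * x c)) = 1\<^sub>m d"
      by (rule rep_elem_mult_trivial[OF that(1) x(1), where q = 2]) (use x(2) in auto)
  qed
  moreover have "(\<lambda>c. x c * y c) \<in> trivial_ideal" if "y \<in> coeff_ring" "x \<in> trivial_ideal" for x y
  proof (rule trivial_idealI)
    have x: "x \<in> coeff_ring" "r (elem 0 2 x) = 1\<^sub>m d" using that by (auto simp: trivial_ideal_def)
    show "(\<lambda>c. x c * y c) \<in> coeff_ring" by (intro coeff_ring.mult that(1) x(1))
    show "r (elem 0 1 (\<lambda>c. x c * y c)) = 1\<^sub>m d"
      by (rule rep_elem_mult_trivial[OF x(1) that(1), where q = 2]) (use x(2) in auto)
  qed
  ultimately show ?thesis using ideal_contains_tail_unit[OF _ _ _ ij(1) f] by blast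
qed

text \<open>Truncating multiplies the ring element by the complement of the tail unit, so it changes
  the group element only by e_pq of a multiple of the tail unit.\<close>

lemma truncate_elem:
  assumes x: "x \<in> coeff_ring"
  shows "truncate k (elem p q x) = elem p q (\<lambda>c. x c + tail_unit k c * x c)"
proof
  fix c
  note xc = coeff_ring_carrier[OF x, of c]
  show "truncate k (elem p q x) c = elem p q (\<lambda>c. x c + tail_unit k c * x c) c"
  proof (cases "c < k")
    case True
    then have "tail_unit k c = 0\<^sub>m (block_size c) (block_size c)"
      by (intro eq_matI) (auto simp: tail_unit_def diagonal_def)
    then show ?thesis using True xc by (simp add: truncate_def elem_def)
  next
    case False
    then have "tail_unit k c = 1\<^sub>m (block_size c)"
      by (intro eq_matI) (auto simp: tail_unit_def diagonal_def)
    then show ?thesis using False xc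
      by (simp add: truncate_def elem_def mat_add_self[OF xc] elementary_zero comp_dim_def)
  qed
qed

lemma truncate_mult: "truncate k (\<lambda>c. f c * g c) = (\<lambda>c. truncate k f c * truncate k g c)"
  by (auto simp: truncate_def)

text \<open>Once a tail unit lies in the ideal, truncation does not change the action of the
  generators; being multiplicative, it then does not change the action of any word in them.\<close>

lemma rep_factors_through_truncate: "\<exists>k. \<forall>f\<in>carrier \<Gamma>. r f = r (truncate k f)"
proof -
  obtain k where k: "tail_unit k \<in> trivial_ideal" using tail_unit_trivial by blast
  have gen: "r (elem p q x) = r (truncate k (elem p q x))"
    if x: "x \<in> coeff_ring" and pq: "p < 3" "q < 3" "p \<noteq> q" for p q x
  proof -
    have t: "(\<lambda>c. tail_unit k c * x c) \<in> coeff_ring" by (intro coeff_ring.mult coeff_ring_tail_unit x)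
    obtain s where s: "s < 3" "s \<noteq> p" "s \<noteq> q" using third_index[OF pq(1,2)] by blast
    have "r (elem p q (\<lambda>c. tail_unit k c * x c)) = 1\<^sub>m d"
      by (rule rep_elem_mult_trivial[OF coeff_ring_tail_unit x, where q = s])
        (use s pq k in \<open>auto simp: trivial_ideal_def\<close>)
    moreover have "r (truncate k (elem p q x)) = r (elem p q x) * r (elem p q (\<lambda>c. tail_unit k c * x c))"
      unfolding truncate_elem[OF x] elem_add[OF x t pq] by (intro rep_mult elem_in_\<Gamma> x t pq)
    ultimately show ?thesis using rep_carrier[OF elem_in_\<Gamma>[OF x pq]] by simp
  qed
  have "r f = r (truncate k f)" if "f \<in> generate product_group elementary_generators" for f
    using that
  proof (induction rule: generate.induct)
    case one
    have "truncate k \<one>\<^bsub>product_group\<^esub> = \<one>\<^bsub>product_group\<^esub>" by (auto simp: truncate_def)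
    then show ?case by simp
  next
    case (incl h)
    then show ?case using gen coeff_ring.generator by (auto simp: elementary_generators_def)
  next
    \<comment> \<open>The generators are involutions, so this case is the previous one.\<close>
    case (inv h)
    then obtain p q x where h: "h = elem p q x" "p < 3" "q < 3" "p \<noteq> q" "x \<in> ring_generators"
      by (auto simp: elementary_generators_def)
    have x: "x \<in> coeff_ring" using h(5) by (rule coeff_ring.generator)
    have "h \<otimes>\<^bsub>product_group\<^esub> h = \<one>\<^bsub>product_group\<^esub>"
      using h x by (auto simp: elem_def comp_dim_def elementary_involution coeff_ring_carrier)
    then have "inv\<^bsub>product_group\<^esub> h = h"
      using group.inv_equality[OF product_group_group, of h h] elem_closed[OF x h(2-4)] h(1) by blast
    then show ?case using gen[OF x h(2-4)] h(1) by simp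
  next
    case (eng h1 h2)
    have h: "h1 \<in> carrier \<Gamma>" "h2 \<in> carrier \<Gamma>" using eng.hyps by (auto simp: \<Gamma>_def)
    then have t: "truncate k h1 \<in> carrier \<Gamma>" "truncate k h2 \<in> carrier \<Gamma>"
      using truncate_in_\<Gamma> \<Gamma>_in_product_group by blast+
    show ?case using rep_mult[OF h] rep_mult[OF t] eng.IH by (simp add: truncate_mult)
  qed
  then show ?thesis by (auto simp: \<Gamma>_def)
qed

end

lemma at_component_rep:
  fixes r :: "(nat \<Rightarrow> bit mat) \<Rightarrow> complex mat"
  assumes "mat_rep \<Gamma> d r"
  shows "mat_rep (GL (comp_dim c)) d (\<lambda>A. r (at_component c A))"
  unfolding mat_rep_def
proof (intro conjI ballI Pi_I)
  fix A assume "A \<in> carrier (GL (comp_dim c))"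
  then show "r (at_component c A) \<in> carrier_mat d d"
    using rep_carrier[OF assms] at_component_in_\<Gamma> by blast
next
  have "at_component c (1\<^sub>m (comp_dim c)) = (\<lambda>c. 1\<^sub>m (comp_dim c))" by (auto simp: at_component_def)
  then show "r (at_component c \<one>\<^bsub>GL (comp_dim c)\<^esub>) = 1\<^sub>m d" using rep_one[OF assms] by simp
next
  fix A B assume AB: "A \<in> carrier (GL (comp_dim c))" "B \<in> carrier (GL (comp_dim c))"
  then show "r (at_component c (A \<otimes>\<^bsub>GL (comp_dim c)\<^esub> B)) = r (at_component c A) * r (at_component c B)"
    using rep_mult[OF assms at_component_in_\<Gamma> at_component_in_\<Gamma>, OF AB]
    by (simp add: at_component_mult GL_carrier_mat)
qed

lemma lower_block_0: "h \<in> carrier_mat n n \<Longrightarrow> lower_block n 0 h = h"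
  by (rule eq_matI) (auto simp: lower_block_def)

lemma comp_dim_ge: "6 \<le> comp_dim c"
proof -
  have "2 ^ 1 \<le> (2::nat) ^ level c" using level_ge[of c] by (intro power_increasing) auto
  then show ?thesis by (simp add: comp_dim_def block_size_def)
qed

text \<open>The fixed vector theorem with m = 0 gives a nonzero vector fixed by the whole component.
  The component is normal in \<Gamma>, so its fixed vectors form an invariant subspace, which
  irreducibility makes the full space.\<close>

lemma small_irr_rep_component_trivial:
  assumes irr: "irr_mat_rep \<Gamma> d r" and small: "d < 2 ^ (comp_dim c - 2)" and A: "A \<in> carrier (GL (comp_dim c))"
  shows "r (at_component c A) = 1\<^sub>m d"
proof -
  interpret \<Gamma>: group \<Gamma> by (rule \<Gamma>_group)
  have rep: "mat_rep \<Gamma> d r" and d: "1 \<le> d" using irr by (auto simp: irr_mat_rep_def)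
  note rc = rep_carrier[OF rep]
  obtain v where v: "v \<in> carrier_vec d" "v \<noteq> 0\<^sub>v d"
    "\<And>h. h \<in> carrier (GL (comp_dim c - 2 * 0)) \<Longrightarrow> r (at_component c (lower_block (comp_dim c) (2 * 0) h)) *\<^sub>v v = v"
    using small_dim_GL_fixed_vector[OF at_component_rep[OF rep] d, of 0 c] small comp_dim_ge[of c] by auto
  define W where "W = {w \<in> carrier_vec d. \<forall>A\<in>carrier (GL (comp_dim c)). r (at_component c A) *\<^sub>v w = w}"
  have vW: "v \<in> W" using v by (auto simp: W_def lower_block_0 GL_carrier_mat)
  have "invariant_subspace \<Gamma> d r W"
    unfolding invariant_subspace_def
  proof (intro conjI allI ballI)
    show "W \<subseteq> carrier_vec d" by (auto simp: W_def)
    have rc': "r (at_component c A) \<in> carrier_mat d d" if "A \<in> carrier (GL (comp_dim c))" for A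
      using rc[OF at_component_in_\<Gamma>[OF that]] .
    have "M *\<^sub>v 0\<^sub>v d = 0\<^sub>v d" if "M \<in> carrier_mat d d" for M :: "complex mat" using that by auto
    then show "0\<^sub>v d \<in> W" using rc' by (simp add: W_def)
    show "x + y \<in> W" if "x \<in> W" "y \<in> W" for x y
      using that rc' by (auto simp: W_def mult_add_distrib_mat_vec[of _ d d])
    show "a \<cdot>\<^sub>v x \<in> W" if "x \<in> W" for a x
      using that rc' by (auto simp: W_def mult_mat_vec[of _ d d])
    fix g w assume g: "g \<in> carrier \<Gamma>" and w: "w \<in> W"
    have wc: "w \<in> carrier_vec d" using w by (auto simp: W_def)
    have "r (at_component c A) *\<^sub>v (r g *\<^sub>v w) = r g *\<^sub>v w" if A: "A \<in> carrier (GL (comp_dim c))" for A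
    proof -
      have gc: "g c \<in> carrier (GL (comp_dim c))" by (rule \<Gamma>_component[OF g])
      obtain B where B: "B \<in> carrier (GL (comp_dim c))" "g c * B = 1\<^sub>m (comp_dim c)" using GL_E[OF gc] by metis
      \<comment> \<open>The conjugate of A by the component of g, so that A g = g A' in
        \<Gamma>.\<close>
      define A' where "A' = B * (A * g c)"
      have A': "A' \<in> carrier (GL (comp_dim c))" unfolding A'_def by (intro GL_mult A B(1) gc)
      note m = GL_carrier_mat[OF A] GL_carrier_mat[OF gc] GL_carrier_mat[OF B(1)]
      have "g c * A' = A * g c" unfolding A'_def
        using assoc_mult_mat[OF m(2,3) mult_carrier_mat[OF m(1,2)]] B(2) left_mult_one_mat[OF mult_carrier_mat[OF m(1,2)]] by simp
      moreover have "1\<^sub>m (comp_dim c') * g c' = g c' * 1\<^sub>m (comp_dim c')" for c'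
        using left_mult_one_mat[OF GL_carrier_mat[OF \<Gamma>_component[OF g]]]
          right_mult_one_mat[OF GL_carrier_mat[OF \<Gamma>_component[OF g]]] by simp
      ultimately have "(\<lambda>c'. at_component c A c' * g c') = (\<lambda>c'. g c' * at_component c A' c')"
        by (intro ext) (auto simp: at_component_def)
      then have "r (at_component c A) * r g = r g * r (at_component c A')"
        using rep_mult[OF rep at_component_in_\<Gamma>[OF A] g] rep_mult[OF rep g at_component_in_\<Gamma>[OF A']] by simp
      then have "r (at_component c A) *\<^sub>v (r g *\<^sub>v w) = r g *\<^sub>v (r (at_component c A') *\<^sub>v w)"
        using assoc_mult_mat_vec[OF rc'[OF A] rc[OF g] wc] assoc_mult_mat_vec[OF rc[OF g] rc'[OF A'] wc] by simp
      also have "r (at_component c A') *\<^sub>v w = w" using w A' by (auto simp: W_def)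
      finally show ?thesis .
    qed
    then show "r g *\<^sub>v w \<in> W" using rc[OF g] wc by (auto simp: W_def)
  qed
  then have "W = {0\<^sub>v d} \<or> W = carrier_vec d" using irr by (auto simp: irr_mat_rep_def)
  then have W: "W = carrier_vec d" using vW v(2) by auto
  have rA: "r (at_component c A) \<in> carrier_mat d d" using rc at_component_in_\<Gamma>[OF A] by blast
  show ?thesis
  proof (rule mat_col_eqI)
    fix k assume "k < dim_col (1\<^sub>m d :: complex mat)"
    then have k: "k < d" by simp
    have "unit_vec d k \<in> W" unfolding W by simp
    then have "r (at_component c A) *\<^sub>v unit_vec d k = unit_vec d k" using A by (simp add: W_def)
    moreover have "r (at_component c A) *\<^sub>v unit_vec d k = col (r (at_component c A)) k"
      using rA k by (intro eq_vecI) auto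
    ultimately show "col (r (at_component c A)) k = col (1\<^sub>m d) k" using k by simp
  qed (use rA in auto)
qed

text \<open>The level k' at which the representation factors depends on the representation; the
  components from k to k' are removed one at a time because they act trivially in dimension
  d.\<close>

lemma irr_rep_truncate:
  assumes irr: "irr_mat_rep \<Gamma> d r" and small: "\<And>c. k \<le> c \<Longrightarrow> d < 2 ^ (comp_dim c - 2)" and f: "f \<in> carrier \<Gamma>"
  shows "r f = r (truncate k f)"
proof -
  have rep: "mat_rep \<Gamma> d r" using irr by (auto simp: irr_mat_rep_def)
  obtain k' where k': "\<And>f. f \<in> carrier \<Gamma> \<Longrightarrow> r f = r (truncate k' f)"
    using rep_factors_through_truncate[OF rep] by blast
  have t: "truncate j f \<in> carrier \<Gamma>" for j using truncate_in_\<Gamma>[OF \<Gamma>_in_product_group[OF f]] .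
  have step: "r (truncate (Suc c) f) = r (truncate c f)" if "k \<le> c" for c
  proof -
    have "f c' \<in> carrier_mat (comp_dim c') (comp_dim c')" for c' using \<Gamma>_component[OF f] GL_carrier_mat by blast
    then have "r (truncate (Suc c) f) = r (truncate c f) * r (at_component c (f c))"
      using truncate_Suc[of f c] rep_mult[OF rep t at_component_in_\<Gamma>[OF \<Gamma>_component[OF f]]] by simp
    then show ?thesis
      using small_irr_rep_component_trivial[OF irr small[OF that] \<Gamma>_component[OF f]]
        right_mult_one_mat[OF rep_carrier[OF rep t]] by simp
  qed
  show ?thesis
  proof (cases "k' \<le> k")
    case True
    then have "truncate k' (truncate k f) = truncate k' f" by (auto simp: truncate_def)
    then show ?thesis using k'[OF f] k'[OF t, of k] by simp
  next
    case False
    have "r (truncate (k + j) f) = r (truncate k f)" for j by (induction j) (auto simp: step)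
    from this[of "k' - k"] show ?thesis using k'[OF f] False by simp
  qed
qed

section \<open>Counting irreducible representations\<close>

text \<open>The product of the first k components, realised as a subgroup of \<Gamma> so that
  representations restrict to it; it is finite, which orthogonality requires.\<close>

definition truncated_group :: "nat \<Rightarrow> (nat \<Rightarrow> bit mat) monoid" where
  "truncated_group k = \<Gamma>\<lparr>carrier := {f \<in> carrier \<Gamma>. \<forall>c\<ge>k. f c = 1\<^sub>m (comp_dim c)}\<rparr>"

lemma truncated_group_simps [simp]:
  "f \<in> carrier (truncated_group k) \<longleftrightarrow> f \<in> carrier \<Gamma> \<and> (\<forall>c\<ge>k. f c = 1\<^sub>m (comp_dim c))"
  "f \<otimes>\<^bsub>truncated_group k\<^esub> g = (\<lambda>c. f c * g c)" "\<one>\<^bsub>truncated_group k\<^esub> = (\<lambda>c. 1\<^sub>m (comp_dim c))"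
  by (simp_all add: truncated_group_def)

lemma truncate_in_truncated_group: "f \<in> carrier \<Gamma> \<Longrightarrow> truncate k f \<in> carrier (truncated_group k)"
  using truncate_in_\<Gamma>[OF \<Gamma>_in_product_group] by (simp add: truncate_def)

lemma truncated_group_group: "group (truncated_group k)"
proof -
  interpret \<Gamma>: group \<Gamma> by (rule \<Gamma>_group)
  have "subgroup {f \<in> carrier \<Gamma>. \<forall>c\<ge>k. f c = 1\<^sub>m (comp_dim c)} \<Gamma>"
  proof (rule \<Gamma>.subgroupI)
    show "{f \<in> carrier \<Gamma>. \<forall>c\<ge>k. f c = 1\<^sub>m (comp_dim c)} \<noteq> {}"
      using \<Gamma>_one by blast
  next
    fix f assume f: "f \<in> {f \<in> carrier \<Gamma>. \<forall>c\<ge>k. f c = 1\<^sub>m (comp_dim c)}"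
    have i: "inv\<^bsub>\<Gamma>\<^esub> f \<in> carrier \<Gamma>" using f by simp
    have "(inv\<^bsub>\<Gamma>\<^esub> f) c = 1\<^sub>m (comp_dim c)" if "k \<le> c" for c
    proof -
      have "f \<otimes>\<^bsub>\<Gamma>\<^esub> inv\<^bsub>\<Gamma>\<^esub> f = \<one>\<^bsub>\<Gamma>\<^esub>" using f by (intro \<Gamma>.r_inv) simp
      then have "f c * (inv\<^bsub>\<Gamma>\<^esub> f) c = 1\<^sub>m (comp_dim c)" by (simp add: fun_eq_iff)
      then show ?thesis using f that left_mult_one_mat[OF GL_carrier_mat[OF \<Gamma>_component[OF i]]] by simp
    qed
    then show "inv\<^bsub>\<Gamma>\<^esub> f \<in> {f \<in> carrier \<Gamma>. \<forall>c\<ge>k. f c = 1\<^sub>m (comp_dim c)}" using i by simp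
  qed (auto simp: \<Gamma>_mult)
  then show ?thesis unfolding truncated_group_def by (rule \<Gamma>.subgroup_imp_group)
qed

text \<open>2^(N^2) is the number of all N by N matrices, and each step of \<open>level\<close> adds
  exactly this N^2 to the exponent of the block size.\<close>

lemma prod_component_cards_le: "(\<Prod>c<a. 2 ^ (comp_dim c * comp_dim c)) \<le> block_size a"
proof -
  have "(\<Prod>c<a. 2 ^ (comp_dim c * comp_dim c)) * 2 \<le> block_size a"
  proof (induction a)
    case (Suc a)
    have "block_size (Suc a) = block_size a * 2 ^ (comp_dim a * comp_dim a)"
      by (simp add: block_size_def comp_dim_def power_add power2_eq_square)
    then show ?case using Suc by simp
  qed (simp add: block_size_def)
  then show ?thesis by linarith
qed

lemma card_restrict_truncated_group:
  fixes a k :: nat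
  defines "\<rho> \<equiv> \<lambda>f :: nat \<Rightarrow> bit mat. restrict f {..<a}"
  shows finite_restrict_truncated_group: "finite (\<rho> ` carrier (truncated_group k))"
    and card_restrict_truncated_group_le: "card (\<rho> ` carrier (truncated_group k)) \<le> block_size a"
proof -
  let ?P = "PiE {..<a} (\<lambda>c. carrier_mat (comp_dim c) (comp_dim c) :: bit mat set)"
  have sub: "\<rho> ` carrier (truncated_group k) \<subseteq> ?P"
    using \<Gamma>_component GL_carrier_mat by (auto simp: \<rho>_def)
  have fin: "finite ?P" by (intro finite_PiE) (auto intro: finite_carrier_mat_bit)
  then show "finite (\<rho> ` carrier (truncated_group k))" using sub by (rule rev_finite_subset)
  have "card (\<rho> ` carrier (truncated_group k)) \<le> card ?P" by (rule card_mono[OF fin sub])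
  also have "\<dots> = (\<Prod>c<a. card (carrier_mat (comp_dim c) (comp_dim c) :: bit mat set))" by (simp add: card_PiE)
  also have "\<dots> \<le> (\<Prod>c<a. 2 ^ (comp_dim c * comp_dim c))"
    by (intro prod_mono) (auto intro: card_carrier_mat_bit_le)
  also have "\<dots> \<le> block_size a" by (rule prod_component_cards_le)
  finally show "card (\<rho> ` carrier (truncated_group k)) \<le> block_size a" .
qed

lemma finite_truncated_group: "finite (carrier (truncated_group k))"
proof (rule inj_on_finite[OF _ subset_refl finite_restrict_truncated_group])
  show "inj_on (\<lambda>f. restrict f {..<k}) (carrier (truncated_group k))"
  proof (rule inj_onI)
    fix f g assume fg: "f \<in> carrier (truncated_group k)" "g \<in> carrier (truncated_group k)"
      and eq: "restrict f {..<k} = restrict g {..<k}"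
    show "f = g"
    proof
      fix c show "f c = g c"
        using fg fun_cong[OF eq, of c] by (cases "c < k") auto
    qed
  qed
qed

text \<open>By \<open>small\<close>, no component after a acts nontrivially in dimension at most
  D.\<close>

locale irreps_family =
  fixes I :: "'i set" and n :: "'i \<Rightarrow> nat" and r :: "'i \<Rightarrow> (nat \<Rightarrow> bit mat) \<Rightarrow> complex mat" and a D :: nat
  assumes fin: "finite I"
    and irr: "\<And>i. i \<in> I \<Longrightarrow> irr_mat_rep \<Gamma> (n i) (r i)"
    and bounded: "\<And>i. i \<in> I \<Longrightarrow> n i \<le> D"
    and ineq: "\<And>i j. i \<in> I \<Longrightarrow> j \<in> I \<Longrightarrow> i \<noteq> j \<Longrightarrow> n i = n j \<Longrightarrow> \<not> equiv_reps \<Gamma> (n i) (r i) (r j)"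
    and small: "\<And>c. a < c \<Longrightarrow> D < 2 ^ (comp_dim c - 2)"
begin

lemma rep_i: "i \<in> I \<Longrightarrow> mat_rep \<Gamma> (n i) (r i)"
  using irr by (simp add: irr_mat_rep_def)

lemma truncate_i: "i \<in> I \<Longrightarrow> f \<in> carrier \<Gamma> \<Longrightarrow> r i f = r i (truncate (Suc a) f)"
  using irr_rep_truncate[OF irr, of i "Suc a"] small bounded by (meson Suc_le_eq le_less_trans)

text \<open>The representations live on the finite product of the components 0 to a. The key records
  the components before a completely, with at most \<open>block_size a\<close> values, and the
  component a only through \<kappa>.\<close>

lemma card_le:
  fixes \<kappa> :: "bit mat \<Rightarrow> 'k"
  assumes K: "finite K" "\<And>g. g \<in> carrier (GL (comp_dim a)) \<Longrightarrow> \<kappa> g \<in> K"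
    and Y: "\<And>i. i \<in> I \<Longrightarrow> \<exists>p<n i. \<exists>q<n i. Y i p q \<noteq> 0"
    and key: "\<And>i f g. i \<in> I \<Longrightarrow> f \<in> carrier \<Gamma> \<Longrightarrow> g \<in> carrier \<Gamma> \<Longrightarrow> (\<And>c. c \<noteq> a \<Longrightarrow> f c = g c) \<Longrightarrow>
      \<kappa> (f a) = \<kappa> (g a) \<Longrightarrow>
      (\<Sum>p<n i. \<Sum>q<n i. r i f $$ (p, q) * Y i p q) = (\<Sum>p<n i. \<Sum>q<n i. r i g $$ (p, q) * Y i p q)"
  shows "card I \<le> block_size a * card K"
proof -
  let ?G = "truncated_group (Suc a)"
  define \<kappa>' where "\<kappa>' f = (restrict f {..<a}, \<kappa> (f a))" for f
  have "card I \<le> card (\<kappa>' ` carrier ?G)"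
  proof (rule card_irreps_le[OF truncated_group_group finite_truncated_group fin _ _ Y])
    fix i assume i: "i \<in> I"
    show "irr_mat_rep ?G (n i) (r i)"
      unfolding irr_mat_rep_def
    proof (intro conjI allI impI)
      show "mat_rep ?G (n i) (r i)" using rep_i[OF i] by (auto simp: mat_rep_def)
      show "1 \<le> n i" using irr[OF i] by (simp add: irr_mat_rep_def)
      fix W assume W: "invariant_subspace ?G (n i) (r i) W"
      have "r i g *\<^sub>v w \<in> W" if "g \<in> carrier \<Gamma>" "w \<in> W" for g w
        using W truncate_i[OF i that(1)] truncate_in_truncated_group[OF that(1), of "Suc a"] that(2)
        by (simp only: invariant_subspace_def)
      then have "invariant_subspace \<Gamma> (n i) (r i) W" using W unfolding invariant_subspace_def by blast
      then show "W = {0\<^sub>v (n i)} \<or> W = carrier_vec (n i)" using irr[OF i] by (simp add: irr_mat_rep_def)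
    qed
  next
    fix i j assume ij: "i \<in> I" "j \<in> I" "i \<noteq> j" "n i = n j"
    show "\<not> equiv_reps ?G (n i) (r i) (r j)"
    proof
      assume "equiv_reps ?G (n i) (r i) (r j)"
      then obtain P where P: "P \<in> carrier_mat (n i) (n i)" "invertible_mat P"
        "\<And>g. g \<in> carrier ?G \<Longrightarrow> P * r i g = r j g * P" unfolding equiv_reps_def by blast
      have "P * r i g = r j g * P" if g: "g \<in> carrier \<Gamma>" for g
        using P(3)[OF truncate_in_truncated_group[OF g]] truncate_i[OF ij(1) g] truncate_i[OF ij(2) g] by simp
      then show False using ineq[OF ij] P(1,2) unfolding equiv_reps_def by blast
    qed
  next
    fix i f g assume i: "i \<in> I" and fg: "f \<in> carrier ?G" "g \<in> carrier ?G" and eq: "\<kappa>' f = \<kappa>' g"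
    have "f c = g c" if "c \<noteq> a" for c
    proof (cases "c < a")
      case True
      have "restrict f {..<a} = restrict g {..<a}" using eq by (simp add: \<kappa>'_def)
      then show ?thesis using True by (metis lessThan_iff restrict_apply')
    qed (use fg that in auto)
    then show "(\<Sum>p<n i. \<Sum>q<n i. r i f $$ (p, q) * Y i p q) = (\<Sum>p<n i. \<Sum>q<n i. r i g $$ (p, q) * Y i p q)"
      using fg eq by (intro key[OF i]) (auto simp: \<kappa>'_def)
  qed
  also have "\<dots> \<le> card ((\<lambda>f. restrict f {..<a}) ` carrier ?G \<times> K)"
    using K \<Gamma>_component finite_restrict_truncated_group
    by (intro card_mono) (auto simp: \<kappa>'_def)
  also have "\<dots> \<le> block_size a * card K"
    unfolding card_cartesian_product by (intro mult_right_mono card_restrict_truncated_group_le) simp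
  finally show ?thesis .
qed

lemma replace_component:
  assumes fg: "f \<in> carrier \<Gamma>" "g \<in> carrier \<Gamma>" "\<And>c. c \<noteq> a \<Longrightarrow> f c = g c"
    and pq: "p \<in> carrier (GL (comp_dim a))" "q \<in> carrier (GL (comp_dim a))" "g a = p * f a * q"
  shows "g = (\<lambda>c. at_component a p c * (f c * at_component a q c))"
proof
  fix c
  note m = GL_carrier_mat[OF \<Gamma>_component[OF fg(1), of c]] GL_carrier_mat[OF pq(1)] GL_carrier_mat[OF pq(2)]
  show "g c = at_component a p c * (f c * at_component a q c)"
  proof (cases "c = a")
    case True
    then show ?thesis using pq(3) assoc_mult_mat[OF m(2) m(1)[unfolded True] m(3)] by (simp add: at_component_def)
  next
    case False
    then show ?thesis using fg(3) left_mult_one_mat[OF m(1)] right_mult_one_mat[OF m(1)] by (simp add: at_component_def)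
  qed
qed

text \<open>With \<open>Y\<close> the identity matrix the functional is the trace, which does not
  change under conjugation in the component a.\<close>

lemma card_le_classes: "card I \<le> block_size a * 4 ^ comp_dim a"
proof -
  obtain \<kappa> :: "bit mat \<Rightarrow> bit mat" where \<kappa>: "\<And>g. g \<in> carrier (GL (comp_dim a)) \<Longrightarrow> block_companion (comp_dim a) (\<kappa> g)"
    "\<And>g g'. g \<in> carrier (GL (comp_dim a)) \<Longrightarrow> g' \<in> carrier (GL (comp_dim a)) \<Longrightarrow> \<kappa> g = \<kappa> g' \<Longrightarrow>
      \<exists>p\<in>carrier (GL (comp_dim a)). \<exists>q\<in>carrier (GL (comp_dim a)). p * q = 1\<^sub>m (comp_dim a) \<and> g' = p * g * q"
    by (rule block_companion_representatives[of "comp_dim a"]) blast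
  have "card I \<le> block_size a * card {M. block_companion (comp_dim a) M}"
  proof (rule card_le[where \<kappa> = \<kappa> and Y = "\<lambda>i p q. of_bool (p = q)"])
    show "finite {M. block_companion (comp_dim a) M}" by (rule finite_block_companion)
    show "\<kappa> g \<in> {M. block_companion (comp_dim a) M}" if "g \<in> carrier (GL (comp_dim a))" for g
      using \<kappa>(1)[OF that] by simp
    show "\<exists>p<n i. \<exists>q<n i. of_bool (p = q) \<noteq> (0::complex)" if "i \<in> I" for i
      using irr[OF that] by (intro exI[of _ 0]) (auto simp: irr_mat_rep_def)
  next
    fix i f g assume i: "i \<in> I" and fg: "f \<in> carrier \<Gamma>" "g \<in> carrier \<Gamma>" "\<And>c. c \<noteq> a \<Longrightarrow> f c = g c"
      and eq: "\<kappa> (f a) = \<kappa> (g a)"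
    obtain p q where pq: "p \<in> carrier (GL (comp_dim a))" "q \<in> carrier (GL (comp_dim a))"
      "p * q = 1\<^sub>m (comp_dim a)" "g a = p * f a * q"
      using \<kappa>(2)[OF \<Gamma>_component[OF fg(1)] \<Gamma>_component[OF fg(2)] eq] by blast
    have qp: "q * p = 1\<^sub>m (comp_dim a)"
      by (rule mat_mult_left_right_inverse[OF GL_carrier_mat[OF pq(1)] GL_carrier_mat[OF pq(2)] pq(3)])
    note in_\<Gamma> = at_component_in_\<Gamma>[OF pq(1)] at_component_in_\<Gamma>[OF pq(2)]
    note rm = rep_mult[OF rep_i[OF i]] and rc = rep_carrier[OF rep_i[OF i]]
    note c = rc[OF in_\<Gamma>(1)] rc[OF fg(1)] rc[OF in_\<Gamma>(2)]
    have rg: "r i g = r i (at_component a p) * (r i f * r i (at_component a q))"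
    proof -
      have "r i g = r i (\<lambda>c. at_component a p c * (f c * at_component a q c))"
        by (rule arg_cong[OF replace_component[OF fg pq(1,2,4)]])
      then show ?thesis using in_\<Gamma> fg(1) by (simp add: rm \<Gamma>_mult)
    qed
    have "(\<lambda>c. at_component a q c * at_component a p c) = (\<lambda>c. 1\<^sub>m (comp_dim c))"
      using qp by (auto simp: at_component_def)
    then have inv: "r i (at_component a q) * r i (at_component a p) = 1\<^sub>m (n i)"
      using rm[OF in_\<Gamma>(2,1)] rep_one[OF rep_i[OF i]] by simp
    have tr: "(\<Sum>x<n i. (A * B) $$ (x, x)) = (\<Sum>x<n i. (B * A) $$ (x, x))"
      if AB: "A \<in> carrier_mat (n i) (n i)" "B \<in> carrier_mat (n i) (n i)" for A B :: "complex mat"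
    proof -
      have "(\<Sum>x<n i. (A * B) $$ (x, x)) = (\<Sum>x<n i. \<Sum>k<n i. A $$ (x, k) * B $$ (k, x))"
        using index_mult_mat_sum[OF AB] by (intro sum.cong) auto
      also have "\<dots> = (\<Sum>k<n i. \<Sum>x<n i. B $$ (k, x) * A $$ (x, k))" by (subst sum.swap) (simp add: mult.commute)
      also have "\<dots> = (\<Sum>x<n i. (B * A) $$ (x, x))"
        using index_mult_mat_sum[OF AB(2,1)] by (intro sum.cong) auto
      finally show ?thesis .
    qed
    have "(\<Sum>x<n i. r i g $$ (x, x)) = (\<Sum>x<n i. (r i f * r i (at_component a q) * r i (at_component a p)) $$ (x, x))"
      unfolding rg by (rule tr[OF c(1) mult_carrier_mat[OF c(2,3)]])
    also have "r i f * r i (at_component a q) * r i (at_component a p) = r i f"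
      using assoc_mult_mat[OF c(2,3,1)] inv right_mult_one_mat[OF c(2)] by simp
    finally show "(\<Sum>p<n i. \<Sum>q<n i. r i f $$ (p, q) * of_bool (p = q)) = (\<Sum>p<n i. \<Sum>q<n i. r i g $$ (p, q) * of_bool (p = q))"
      by (simp add: of_bool_def if_distrib cong: if_cong)
  qed
  also have "\<dots> \<le> block_size a * 4 ^ comp_dim a"
    by (intro mult_left_mono card_block_companion_le) simp
  finally show ?thesis .
qed

text \<open>The function used is coordinate x of the sum over h of r(h f) v, h in the block
  subgroup. Summation makes it left invariant, the fixed vector v makes it right invariant, and at
  the identity it is the order of the subgroup times a nonzero coordinate of v. The exponent is 5
  k^2 with k = 2m.\<close>

lemma card_le_double_cosets:
  assumes m: "2 * (m + 1) \<le> comp_dim a" "2 * (2 * m) \<le> comp_dim a"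
    and D: "D < 2 ^ ((m + 1) * (comp_dim a - 2 * (m + 1)))"
  shows "card I \<le> block_size a * 2 ^ (20 * m ^ 2)"
proof -
  let ?N = "comp_dim a" and ?k = "2 * m"
  let ?K = "carrier (GL (?N - ?k))"
  obtain \<kappa> :: "bit mat \<Rightarrow> (nat \<times> nat) set \<times> (nat \<times> nat) set"
    where \<kappa>: "\<And>g. \<kappa> g \<in> Pow ({..<2 * ?k} \<times> {..<?k}) \<times> Pow ({..<?k} \<times> {..<3 * ?k})"
    "\<And>g g'. g \<in> carrier (GL ?N) \<Longrightarrow> g' \<in> carrier (GL ?N) \<Longrightarrow> \<kappa> g = \<kappa> g' \<Longrightarrow>
      \<exists>h\<in>?K. \<exists>h'\<in>?K. g' = lower_block ?N ?k h * g * lower_block ?N ?k h'"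
    by (rule lower_block_double_cosets[OF m(2)]) blast
  have kN: "?k \<le> ?N" using m by simp
  define L where "L h = at_component a (lower_block ?N ?k h)" for h
  have LG: "lower_block ?N ?k h \<in> carrier (GL ?N)" if "h \<in> ?K" for h using lower_block_GL[OF that kN] .
  have L\<Gamma>: "L h \<in> carrier \<Gamma>" if "h \<in> ?K" for h unfolding L_def by (rule at_component_in_\<Gamma>[OF LG[OF that]])
  have Lm: "L (h * h') = (\<lambda>c. L h c * L h' c)" if "h \<in> ?K" "h' \<in> ?K" for h h'
    unfolding L_def lower_block_mult[OF GL_carrier_mat[OF that(1)] GL_carrier_mat[OF that(2)] kN, symmetric]
    by (rule at_component_mult) auto
  have finK: "finite ?K" by (rule finite_subset[OF _ finite_carrier_mat_bit]) (use GL_carrier_mat in blast)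
  have "\<exists>v x. v \<in> carrier_vec (n i) \<and> x < n i \<and> v $ x \<noteq> 0 \<and> (\<forall>h\<in>?K. r i (L h) *\<^sub>v v = v)" if i: "i \<in> I" for i
  proof -
    have "n i < 2 ^ ((m + 1) * (?N - 2 * (m + 1)))" using bounded[OF i] D by simp
    moreover have "1 \<le> n i" using irr[OF i] by (simp add: irr_mat_rep_def)
    ultimately obtain v where v: "v \<in> carrier_vec (n i)" "v \<noteq> 0\<^sub>v (n i)" "\<forall>h\<in>?K. r i (L h) *\<^sub>v v = v"
      using small_dim_GL_fixed_vector[OF at_component_rep[OF rep_i[OF i]] _ m(1)] unfolding L_def by blast
    then obtain x where "x < n i" "v $ x \<noteq> 0" by (metis carrier_vecD eq_vecI index_zero_vec)
    then show ?thesis using v by blast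
  qed
  then obtain v x where vx: "\<And>i. i \<in> I \<Longrightarrow> v i \<in> carrier_vec (n i)" "\<And>i. i \<in> I \<Longrightarrow> x i < n i"
    "\<And>i. i \<in> I \<Longrightarrow> v i $ x i \<noteq> 0" "\<And>i h. i \<in> I \<Longrightarrow> h \<in> ?K \<Longrightarrow> r i (L h) *\<^sub>v v i = v i" by metis
  define S where "S i p = (\<Sum>h\<in>?K. r i (L h) $$ (x i, p))" for i p
  define Y where "Y i p q = S i p * v i $ q" for i p q
  define F where "F i f = (\<Sum>h\<in>?K. (r i (\<lambda>c. L h c * f c) *\<^sub>v v i) $ x i)" for i f
  have FY: "F i f = (\<Sum>p<n i. \<Sum>q<n i. r i f $$ (p, q) * Y i p q)" if i: "i \<in> I" and f: "f \<in> carrier \<Gamma>" for i f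
  proof -
    note rm = rep_mult[OF rep_i[OF i]] and rc = rep_carrier[OF rep_i[OF i]]
    have "F i f = (\<Sum>h\<in>?K. \<Sum>p<n i. r i (L h) $$ (x i, p) * (\<Sum>q<n i. r i f $$ (p, q) * v i $ q))"
      unfolding F_def
    proof (intro sum.cong refl)
      fix h assume h: "h \<in> ?K"
      have fv: "r i f *\<^sub>v v i \<in> carrier_vec (n i)" using rc[OF f] vx(1)[OF i] by simp
      have "(r i (\<lambda>c. L h c * f c) *\<^sub>v v i) $ x i = (r i (L h) *\<^sub>v (r i f *\<^sub>v v i)) $ x i"
        unfolding rm[OF L\<Gamma>[OF h] f] using assoc_mult_mat_vec[OF rc[OF L\<Gamma>[OF h]] rc[OF f] vx(1)[OF i]] by simp
      also have "\<dots> = (\<Sum>p<n i. r i (L h) $$ (x i, p) * (r i f *\<^sub>v v i) $ p)"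
        by (rule index_mult_vec_sum[OF rc[OF L\<Gamma>[OF h]] fv vx(2)[OF i]])
      also have "\<dots> = (\<Sum>p<n i. r i (L h) $$ (x i, p) * (\<Sum>q<n i. r i f $$ (p, q) * v i $ q))"
        using index_mult_vec_sum[OF rc[OF f] vx(1)[OF i]] by (intro sum.cong) auto
      finally show "(r i (\<lambda>c. L h c * f c) *\<^sub>v v i) $ x i = (\<Sum>p<n i. r i (L h) $$ (x i, p) * (\<Sum>q<n i. r i f $$ (p, q) * v i $ q))" .
    qed
    also have "\<dots> = (\<Sum>p<n i. S i p * (\<Sum>q<n i. r i f $$ (p, q) * v i $ q))"
      unfolding S_def by (subst sum.swap) (simp add: sum_distrib_right)
    also have "\<dots> = (\<Sum>p<n i. \<Sum>q<n i. r i f $$ (p, q) * Y i p q)"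
      unfolding Y_def by (simp add: sum_distrib_left mult_ac)
    finally show ?thesis .
  qed
  have card_keys: "card (Pow ({..<2 * ?k} \<times> {..<?k}) \<times> Pow ({..<?k} \<times> {..<3 * ?k})) = 2 ^ (20 * m ^ 2)"
    by (simp add: card_cartesian_product card_Pow power_add[symmetric] power2_eq_square)
  have "card I \<le> block_size a * card (Pow ({..<2 * ?k} \<times> {..<?k}) \<times> Pow ({..<?k} \<times> {..<3 * ?k}))"
  proof (rule card_le[where \<kappa> = \<kappa> and Y = Y])
    show "finite (Pow ({..<2 * ?k} \<times> {..<?k}) \<times> Pow ({..<?k} \<times> {..<3 * ?k}))" by simp
    show "\<kappa> g \<in> Pow ({..<2 * ?k} \<times> {..<?k}) \<times> Pow ({..<?k} \<times> {..<3 * ?k})" for g by (rule \<kappa>(1))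
  next
    fix i assume i: "i \<in> I"
    show "\<exists>p<n i. \<exists>q<n i. Y i p q \<noteq> 0"
    proof (rule ccontr)
      assume "\<not> ?thesis"
      then have "F i (\<lambda>c. 1\<^sub>m (comp_dim c)) = 0" unfolding FY[OF i \<Gamma>_one] by (intro sum.neutral) auto
      moreover have "F i (\<lambda>c. 1\<^sub>m (comp_dim c)) = of_nat (card ?K) * v i $ x i"
      proof -
        have "(r i (\<lambda>c. L h c * 1\<^sub>m (comp_dim c)) *\<^sub>v v i) $ x i = v i $ x i" if h: "h \<in> ?K" for h
        proof -
          have "L h c * 1\<^sub>m (comp_dim c) = L h c" for c
            using right_mult_one_mat[OF GL_carrier_mat[OF \<Gamma>_component[OF L\<Gamma>[OF h]]]] .
          then show ?thesis using vx(4)[OF i h] by simp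
        qed
        then show ?thesis by (simp add: F_def)
      qed
      moreover have "card ?K \<noteq> 0" using finK GL_one[of "?N - ?k"] by (metis card_0_eq empty_iff)
      ultimately show False using vx(3)[OF i] by simp
    qed
  next
    fix i f g assume i: "i \<in> I" and fg: "f \<in> carrier \<Gamma>" "g \<in> carrier \<Gamma>" "\<And>c. c \<noteq> a \<Longrightarrow> f c = g c"
      and eq: "\<kappa> (f a) = \<kappa> (g a)"
    note rm = rep_mult[OF rep_i[OF i]] and rc = rep_carrier[OF rep_i[OF i]]
    obtain h h' where h: "h \<in> ?K" "h' \<in> ?K" "g a = lower_block ?N ?k h * f a * lower_block ?N ?k h'"
      using \<kappa>(2)[OF \<Gamma>_component[OF fg(1)] \<Gamma>_component[OF fg(2)] eq] by blast
    have g: "g = (\<lambda>c. L h c * (f c * L h' c))"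
      unfolding L_def by (rule replace_component[OF fg LG[OF h(1)] LG[OF h(2)] h(3)])
    have "F i g = (\<Sum>h0\<in>?K. (r i (\<lambda>c. L (h0 * h) c * f c) *\<^sub>v v i) $ x i)"
      unfolding F_def
    proof (intro sum.cong refl)
      fix h0 assume h0: "h0 \<in> ?K"
      have Lh0h: "L (h0 * h) \<in> carrier \<Gamma>" by (rule L\<Gamma>[OF GL_mult[OF h0 h(1)]])
      have e: "r i (\<lambda>c. L h0 c * g c) = r i (\<lambda>c. L (h0 * h) c * f c) * r i (L h')"
      proof -
        note c = rc[OF L\<Gamma>[OF h0]] rc[OF L\<Gamma>[OF h(1)]] rc[OF fg(1)] rc[OF L\<Gamma>[OF h(2)]]
        have "r i (\<lambda>c. L h0 c * g c) = r i (L h0) * (r i (L h) * (r i f * r i (L h')))"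
          unfolding rm[OF L\<Gamma>[OF h0] fg(2)] unfolding g using L\<Gamma>[OF h(1)] L\<Gamma>[OF h(2)] fg(1) by (simp add: rm \<Gamma>_mult)
        also have "\<dots> = r i (L h0) * r i (L h) * (r i f * r i (L h'))"
          by (rule assoc_mult_mat[OF c(1,2) mult_carrier_mat[OF c(3,4)], symmetric])
        also have "\<dots> = r i (L h0) * r i (L h) * r i f * r i (L h')"
          by (rule assoc_mult_mat[OF mult_carrier_mat[OF c(1,2)] c(3,4), symmetric])
        also have "r i (L h0) * r i (L h) = r i (L (h0 * h))"
          unfolding Lm[OF h0 h(1)] by (rule rm[OF L\<Gamma>[OF h0] L\<Gamma>[OF h(1)], symmetric])
        also have "r i (L (h0 * h)) * r i f = r i (\<lambda>c. L (h0 * h) c * f c)"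
          by (rule rm[OF Lh0h fg(1), symmetric])
        finally show ?thesis .
      qed
      have "r i (\<lambda>c. L h0 c * g c) *\<^sub>v v i = r i (\<lambda>c. L (h0 * h) c * f c) *\<^sub>v (r i (L h') *\<^sub>v v i)"
        unfolding e by (rule assoc_mult_mat_vec[OF rc[OF \<Gamma>_mult[OF Lh0h fg(1)]] rc[OF L\<Gamma>[OF h(2)]] vx(1)[OF i]])
      then show "(r i (\<lambda>c. L h0 c * g c) *\<^sub>v v i) $ x i = (r i (\<lambda>c. L (h0 * h) c * f c) *\<^sub>v v i) $ x i"
        using vx(4)[OF i h(2)] by simp
    qed
    also have "\<dots> = F i f"
      unfolding F_def
    proof (rule sum.reindex_bij_betw)
      obtain h1 where h1: "h1 \<in> ?K" "h * h1 = 1\<^sub>m (?N - ?k)" "h1 * h = 1\<^sub>m (?N - ?k)" using GL_E[OF h(1)] by metis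
      note hc = GL_carrier_mat[OF h(1)] GL_carrier_mat[OF h1(1)]
      show "bij_betw (\<lambda>h0. h0 * h) ?K ?K"
      proof (rule bij_betw_byWitness[where f' = "\<lambda>h0. h0 * h1"])
        show "\<forall>h0\<in>?K. h0 * h * h1 = h0"
          using assoc_mult_mat[OF GL_carrier_mat hc] h1(2) right_mult_one_mat[OF GL_carrier_mat] by simp
        show "\<forall>h0\<in>?K. h0 * h1 * h = h0"
          using assoc_mult_mat[OF GL_carrier_mat hc(2,1)] h1(3) right_mult_one_mat[OF GL_carrier_mat] by simp
      qed (use GL_mult h(1) h1(1) in auto)
    qed
    finally show "(\<Sum>p<n i. \<Sum>q<n i. r i f $$ (p, q) * Y i p q) = (\<Sum>p<n i. \<Sum>q<n i. r i g $$ (p, q) * Y i p q)"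
      using FY[OF i fg(1)] FY[OF i fg(2)] by simp
  qed
  then show ?thesis unfolding card_keys .
qed

end

lemma comp_dim_gt: "c < comp_dim c - 2"
proof -
  have "c + 1 < 2 ^ (c + 1)" by (rule less_exp)
  also have "\<dots> \<le> (2::nat) ^ level c" using level_ge[of c] by (intro power_increasing) auto
  finally show ?thesis by (simp add: comp_dim_def block_size_def)
qed

section \<open>Representation growth\<close>

text \<open>A definition cannot quantify over index types, so the type is fixed to pairs of a
  dimension and a class, by which the irreducibles are enumerated later.\<close>

definition bounded_families :: "('g, 'b) monoid_scheme \<Rightarrow> nat \<Rightarrow> nat \<Rightarrow> bool" where
  "bounded_families G D B \<longleftrightarrow> (\<forall>(I :: (nat \<times> ('g \<Rightarrow> complex mat) set) set) n r. finite I \<longrightarrow>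
     (\<forall>i\<in>I. irr_mat_rep G (n i) (r i) \<and> n i \<le> D) \<longrightarrow>
     (\<forall>i\<in>I. \<forall>j\<in>I. i \<noteq> j \<longrightarrow> n i = n j \<longrightarrow> \<not> equiv_reps G (n i) (r i) (r j)) \<longrightarrow> card I \<le> B)"

section \<open>From families of inequivalent representations to isomorphism classes\<close>

lemma index_mult_mat_row:
  "B \<in> carrier_mat n b \<Longrightarrow> i < dim_row A \<Longrightarrow> j < b \<Longrightarrow> (A * B) $$ (i, j) = (\<Sum>l<n. row A i $ l * B $$ (l, j))"
  by (auto simp: scalar_prod_def lessThan_atLeast0 intro!: sum.cong)

text \<open>Matrices in the classes of \<^const>\<open>rep_iso\<close> may have a wrong number of columns, so associativity
  is needed without an assumption on the leftmost factor.\<close>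

lemma assoc_mult_mat_right:
  fixes A :: "'a::semiring_0 mat"
  assumes "B \<in> carrier_mat n n" "C \<in> carrier_mat n n"
  shows "A * B * C = A * (B * C)"
proof (rule eq_matI)
  fix i j assume "i < dim_row (A * (B * C))" "j < dim_col (A * (B * C))"
  then have ij: "i < dim_row A" "j < n" using assms by auto
  have AB: "A * B \<in> carrier_mat (dim_row A) n" using assms by auto
  have "(A * B * C) $$ (i, j) = (\<Sum>k<n. (\<Sum>l<n. row A i $ l * B $$ (l, k)) * C $$ (k, j))"
    unfolding index_mult_mat_sum[OF AB assms(2) ij]
    using index_mult_mat_row[OF assms(1) ij(1)] by (intro sum.cong) auto
  also have "\<dots> = (\<Sum>l<n. row A i $ l * (\<Sum>k<n. B $$ (l, k) * C $$ (k, j)))"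
    unfolding sum_distrib_left sum_distrib_right by (subst sum.swap) (simp add: mult.assoc)
  also have "\<dots> = (\<Sum>l<n. row A i $ l * (B * C) $$ (l, j))"
    using index_mult_mat_sum[OF assms _ ij(2)] by (intro sum.cong) auto
  also have "\<dots> = (A * (B * C)) $$ (i, j)"
    by (rule index_mult_mat_row[OF mult_carrier_mat[OF assms] ij, symmetric])
  finally show "(A * B * C) $$ (i, j) = (A * (B * C)) $$ (i, j)" .
qed (use assms in auto)

lemma invertible_matE:
  assumes "invertible_mat P" "P \<in> carrier_mat n n"
  obtains Q where "Q \<in> carrier_mat n n" "P * Q = 1\<^sub>m n" "Q * P = 1\<^sub>m n"
proof -
  obtain Q where Q: "P * Q = 1\<^sub>m n" "Q * P = 1\<^sub>m (dim_row Q)"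
    using assms unfolding invertible_mat_def inverts_mat_def by auto
  have "Q \<in> carrier_mat n n"
  proof (rule carrier_matI)
    show "dim_col Q = n" using arg_cong[OF Q(1), of dim_col] by simp
    show "dim_row Q = n" using arg_cong[OF Q(2), of dim_col] assms(2) by simp
  qed
  then show ?thesis using that Q by simp
qed

lemma equiv_reps_sym:
  assumes r: "\<And>g. g \<in> carrier G \<Longrightarrow> r g \<in> carrier_mat k k" and s: "\<And>g. g \<in> carrier G \<Longrightarrow> s g \<in> carrier_mat k k"
    and eq: "equiv_reps G k r s"
  shows "equiv_reps G k s r"
proof -
  obtain P where P: "P \<in> carrier_mat k k" "invertible_mat P" "\<And>g. g \<in> carrier G \<Longrightarrow> P * r g = s g * P"
    using eq unfolding equiv_reps_def by blast
  obtain Q where Q: "Q \<in> carrier_mat k k" "P * Q = 1\<^sub>m k" "Q * P = 1\<^sub>m k" using invertible_matE[OF P(2,1)] by blast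
  have "Q * s g = r g * Q" if g: "g \<in> carrier G" for g
  proof -
    note c = r[OF g] s[OF g]
    have "Q * s g = Q * (s g * (P * Q))" using Q(2) right_mult_one_mat[OF c(2)] by simp
    also have "s g * (P * Q) = P * r g * Q" using assoc_mult_mat[OF c(2) P(1) Q(1)] P(3)[OF g] by simp
    also have "Q * (P * r g * Q) = Q * P * (r g * Q)"
      using assoc_mult_mat[OF P(1) c(1) Q(1)] assoc_mult_mat[OF Q(1) P(1) mult_carrier_mat[OF c(1) Q(1)]] by simp
    also have "\<dots> = r g * Q" unfolding Q(3) by (rule left_mult_one_mat[OF mult_carrier_mat[OF c(1) Q(1)]])
    finally show ?thesis .
  qed
  then show ?thesis unfolding equiv_reps_def using Q P(1) invertible_matI[of Q k P] by blast
qed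

text \<open>\<open>rep_iso\<close> relates arbitrary functions, so t need not be a representation;
  classes are compared by composing the intertwining matrices directly.\<close>

lemma rep_iso_image_subset:
  assumes r: "\<And>g. g \<in> carrier G \<Longrightarrow> r g \<in> carrier_mat k k" and s: "\<And>g. g \<in> carrier G \<Longrightarrow> s g \<in> carrier_mat k k"
    and eq: "equiv_reps G k r s"
  shows "rep_iso G k `` {s} \<subseteq> rep_iso G k `` {r}"
proof
  fix t assume "t \<in> rep_iso G k `` {s}"
  then obtain P where P: "P \<in> carrier_mat k k" "invertible_mat P" "\<And>g. g \<in> carrier G \<Longrightarrow> P * s g = t g * P"
    by (auto simp: rep_iso_def)
  obtain Q where Q: "Q \<in> carrier_mat k k" "invertible_mat Q" "\<And>g. g \<in> carrier G \<Longrightarrow> Q * r g = s g * Q"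
    using eq unfolding equiv_reps_def by blast
  obtain P' where P': "P' \<in> carrier_mat k k" "P * P' = 1\<^sub>m k" using invertible_matE[OF P(2,1)] by metis
  obtain Q' where Q': "Q' \<in> carrier_mat k k" "Q * Q' = 1\<^sub>m k" using invertible_matE[OF Q(2,1)] by metis
  have PQ: "P * Q \<in> carrier_mat k k" and QP': "Q' * P' \<in> carrier_mat k k" using P(1) Q(1) P'(1) Q'(1) by auto
  have "P * Q * (Q' * P') = P * (Q * Q' * P')"
    using assoc_mult_mat[OF P(1) Q(1) QP'] assoc_mult_mat[OF Q(1) Q'(1) P'(1)] by simp
  also have "\<dots> = 1\<^sub>m k" unfolding Q'(2) using left_mult_one_mat[OF P'(1)] P'(2) by simp
  finally have one: "P * Q * (Q' * P') = 1\<^sub>m k" .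
  have inv: "invertible_mat (P * Q)"
    by (rule invertible_matI[OF PQ QP' one mat_mult_left_right_inverse[OF PQ QP' one]])
  have "P * Q * r g = t g * (P * Q)" if g: "g \<in> carrier G" for g
  proof -
    have "P * Q * r g = P * (s g * Q)" using assoc_mult_mat[OF P(1) Q(1) r[OF g]] Q(3)[OF g] by simp
    also have "\<dots> = t g * P * Q" using assoc_mult_mat[OF P(1) s[OF g] Q(1)] P(3)[OF g] by simp
    also have "\<dots> = t g * (P * Q)" by (rule assoc_mult_mat_right[OF P(1) Q(1)])
    finally show ?thesis .
  qed
  then show "t \<in> rep_iso G k `` {r}" using PQ inv by (auto simp: rep_iso_def)
qed

lemma irred_rep_irr_mat_rep: "irred_rep G k r \<Longrightarrow> irr_mat_rep G k r"
  unfolding irred_rep_def irr_mat_rep_def is_rep_def mat_rep_def by blast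

text \<open>A set all of whose finite subsets have at most B elements is finite with at most B
  elements, so one bound on finite families gives both finiteness of the classes and the bound on
  \<open>R_count\<close>.\<close>

lemma bounded_families_R_count:
  assumes "bounded_families G D B"
  shows "(\<forall>k\<in>{1..D}. finite (irr_classes G k)) \<and> R_count G D \<le> B"
proof -
  define S where "S = Sigma {1..D} (irr_classes G)"
  have "\<forall>x\<in>S. \<exists>r. irred_rep G (fst x) r \<and> snd x = rep_iso G (fst x) `` {r}"
    by (auto simp: S_def irr_classes_def elim!: quotientE)
  then obtain r where r: "\<And>x. x \<in> S \<Longrightarrow> irred_rep G (fst x) (r x)" "\<And>x. x \<in> S \<Longrightarrow> snd x = rep_iso G (fst x) `` {r x}"
    by metis
  have irr: "irr_mat_rep G (fst x) (r x)" if "x \<in> S" for x using r(1)[OF that] by (rule irred_rep_irr_mat_rep)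
  have c: "r x g \<in> carrier_mat (fst x) (fst x)" if "x \<in> S" "g \<in> carrier G" for x g
    using irr[OF that(1)] mat_repD(1) that(2) by (auto simp: irr_mat_rep_def)
  have ineq: "\<not> equiv_reps G (fst x) (r x) (r y)" if "x \<in> S" "y \<in> S" "x \<noteq> y" "fst x = fst y" for x y
  proof
    assume eq: "equiv_reps G (fst x) (r x) (r y)"
    have cx: "\<And>g. g \<in> carrier G \<Longrightarrow> r x g \<in> carrier_mat (fst x) (fst x)" using c[OF that(1)] .
    have cy: "\<And>g. g \<in> carrier G \<Longrightarrow> r y g \<in> carrier_mat (fst x) (fst x)" using c[OF that(2)] that(4) by simp
    have "snd x = snd y"
      using rep_iso_image_subset[OF cx cy eq] rep_iso_image_subset[OF cy cx equiv_reps_sym[OF cx cy eq]]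
        r(2)[OF that(1)] r(2)[OF that(2)] that(4) by auto
    then show False using that(3,4) by (simp add: prod_eq_iff)
  qed
  have "finite S \<and> card S \<le> B"
  proof (rule finite_if_finite_subsets_card_bdd)
    fix I assume I: "I \<subseteq> S" "finite I"
    have "\<forall>i\<in>I. irr_mat_rep G (fst i) (r i) \<and> fst i \<le> D" using I irr by (auto simp: S_def)
    moreover have "\<forall>i\<in>I. \<forall>j\<in>I. i \<noteq> j \<longrightarrow> fst i = fst j \<longrightarrow> \<not> equiv_reps G (fst i) (r i) (r j)"
      using ineq I(1) by blast
    ultimately show "card I \<le> B" using assms I(2) unfolding bounded_families_def by blast
  qed
  then have S: "finite S" "card S \<le> B" by auto
  have fin: "finite (irr_classes G k)" if "k \<in> {1..D}" for k
  proof (rule inj_on_finite[OF _ _ S(1)])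
    show "inj_on (Pair k) (irr_classes G k)" by (auto intro: inj_onI)
    show "Pair k ` irr_classes G k \<subseteq> S" using that by (auto simp: S_def)
  qed
  have "card S = R_count G D"
    unfolding S_def R_count_def r_count_def using fin by (intro card_SigmaI) auto
  then show ?thesis using fin S(2) by simp
qed

text \<open>Representations are pulled back along \<phi>; irreducibility and equivalence depend only
  on the matrices attained on the carrier.\<close>

lemma bounded_families_iso:
  assumes \<phi>: "\<phi> \<in> iso G H" and G: "group G" and H: "group H"
    and bound: "\<And>(I :: (nat \<times> ('h \<Rightarrow> complex mat) set) set) n r. finite I \<Longrightarrow> (\<And>i. i \<in> I \<Longrightarrow> irr_mat_rep G (n i) (r i)) \<Longrightarrow>
      (\<And>i. i \<in> I \<Longrightarrow> n i \<le> D) \<Longrightarrow>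
      (\<And>i j. i \<in> I \<Longrightarrow> j \<in> I \<Longrightarrow> i \<noteq> j \<Longrightarrow> n i = n j \<Longrightarrow> \<not> equiv_reps G (n i) (r i) (r j)) \<Longrightarrow> card I \<le> B"
  shows "bounded_families (H :: ('h, 'c) monoid_scheme) D B"
  unfolding bounded_families_def
proof (intro allI impI)
  fix I :: "(nat \<times> ('h \<Rightarrow> complex mat) set) set" and n r
  assume fin: "finite I" and irr: "\<forall>i\<in>I. irr_mat_rep H (n i) (r i) \<and> n i \<le> D"
    and ineq: "\<forall>i\<in>I. \<forall>j\<in>I. i \<noteq> j \<longrightarrow> n i = n j \<longrightarrow> \<not> equiv_reps H (n i) (r i) (r j)"
  have im: "\<phi> ` carrier G = carrier H" and hom: "\<phi> \<in> hom G H"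
    using \<phi> by (auto simp: iso_def bij_betw_def)
  have one: "\<phi> \<one>\<^bsub>G\<^esub> = \<one>\<^bsub>H\<^esub>" by (rule hom_one[OF hom G H])
  have cl: "\<phi> x \<in> carrier H" if "x \<in> carrier G" for x using im that by blast
  show "card I \<le> B"
  proof (rule bound[OF fin, of n "\<lambda>i. r i \<circ> \<phi>"])
    fix i assume i: "i \<in> I"
    show "n i \<le> D" using irr i by blast
    have r: "mat_rep H (n i) (r i)" using irr i by (simp add: irr_mat_rep_def)
    show "irr_mat_rep G (n i) (r i \<circ> \<phi>)"
      unfolding irr_mat_rep_def
    proof (intro conjI allI impI)
      show "mat_rep G (n i) (r i \<circ> \<phi>)"
        using mat_repD[OF r] cl one unfolding mat_rep_def by (simp add: hom_mult[OF hom] Pi_iff)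
      show "1 \<le> n i" using irr i by (simp add: irr_mat_rep_def)
      fix W assume "invariant_subspace G (n i) (r i \<circ> \<phi>) W"
      then have "invariant_subspace H (n i) (r i) W" unfolding invariant_subspace_def im[symmetric] by auto
      then show "W = {0\<^sub>v (n i)} \<or> W = carrier_vec (n i)" using irr i by (simp add: irr_mat_rep_def)
    qed
  next
    fix i j assume ij: "i \<in> I" "j \<in> I" "i \<noteq> j" "n i = n j"
    show "\<not> equiv_reps G (n i) (r i \<circ> \<phi>) (r j \<circ> \<phi>)"
      using ineq ij unfolding equiv_reps_def im[symmetric] by auto
  qed
qed

text \<open>The crude choice a = D: every later component is large enough to act trivially in
  dimension D. This gives finiteness in each dimension; the growth estimate chooses a
  optimally.\<close>

lemma irreps_of_\<Gamma>_le:
  assumes "finite I" "\<And>i. i \<in> I \<Longrightarrow> irr_mat_rep \<Gamma> (n i) (r i)" "\<And>i. i \<in> I \<Longrightarrow> n i \<le> D"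
    and "\<And>i j. i \<in> I \<Longrightarrow> j \<in> I \<Longrightarrow> i \<noteq> j \<Longrightarrow> n i = n j \<Longrightarrow> \<not> equiv_reps \<Gamma> (n i) (r i) (r j)"
  shows "card I \<le> block_size D * 4 ^ comp_dim D"
proof -
  interpret irreps_family I n r D D
  proof
    fix c assume "D < c"
    also have "c < comp_dim c - 2" by (rule comp_dim_gt)
    also have "\<dots> < 2 ^ (comp_dim c - 2)" by (rule less_exp)
    finally show "D < 2 ^ (comp_dim c - 2)" .
  qed (use assms in auto)
  show ?thesis by (rule card_le_classes)
qed

text \<open>For dimensions below \<open>2 ^ ((m + 1) * (N - 2 * (m + 1)))\<close> the double coset bound is used, above it
  the bound by conjugacy classes; here \<open>m\<close> only depends on \<open>\<epsilon>\<close>.\<close>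

lemma irreps_of_\<Gamma>_subpolynomial:
  assumes \<epsilon>: "0 < (\<epsilon>::real)"
  shows "\<exists>D0. \<forall>D\<ge>D0. \<forall>(I :: 'i set) n r. finite I \<longrightarrow> (\<forall>i\<in>I. irr_mat_rep \<Gamma> (n i) (r i)) \<longrightarrow> (\<forall>i\<in>I. n i \<le> D) \<longrightarrow>
    (\<forall>i\<in>I. \<forall>j\<in>I. i \<noteq> j \<longrightarrow> n i = n j \<longrightarrow> \<not> equiv_reps \<Gamma> (n i) (r i) (r j)) \<longrightarrow>
    real (card I) \<le> real D powr \<epsilon>"
proof -
  define L where "L = ln (2::real)"
  have L: "L > 0" by (simp add: L_def)
  \<comment> \<open>For D above the threshold, D^\<epsilon> has to exceed 2^(3N) >= N * 4^N. Since N
    - 2(m + 1) >= N / 2, a factor \<epsilon> * (m + 1) >= 8 in the exponent is enough.\<close>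
  obtain m :: nat where m: "8 / \<epsilon> < real m" using reals_Archimedean2 by blast
  \<comment> \<open>Below the threshold only D >= 2^(N - 2) is available, which bounds \<epsilon> ln
    D below by 2\<delta>(N - 2). One \<delta>N absorbs ln N, the other the constants;
    \<open>B\<close> is the value of N from which the latter works.\<close>
  define \<delta> where "\<delta> = \<epsilon> * L / 2"
  have \<delta>: "\<delta> > 0" using \<epsilon> L by (simp add: \<delta>_def)
  define B where "B = (20 * real m ^ 2 * L - ln \<delta> + 4 * \<delta>) / \<delta>"
  obtain a0 :: nat where a0: "B + real (4 * (m + 1)) < real a0" using reals_Archimedean2 by blast
  define a1 where "a1 = a0 + 4 * (m + 1)"
  show ?thesis
  proof (intro exI[of _ "2 ^ (comp_dim a1 - 2)"] allI impI)
    fix D :: nat and I :: "'i set" and n r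
    assume D: "2 ^ (comp_dim a1 - 2) \<le> D" and fin: "finite I" and irr: "\<forall>i\<in>I. irr_mat_rep \<Gamma> (n i) (r i)"
      and nD: "\<forall>i\<in>I. n i \<le> D"
      and ineq: "\<forall>i\<in>I. \<forall>j\<in>I. i \<noteq> j \<longrightarrow> n i = n j \<longrightarrow> \<not> equiv_reps \<Gamma> (n i) (r i) (r j)"
    have bd: "c \<le> D" if "2 ^ (comp_dim c - 2) \<le> D" for c
    proof -
      have "c < comp_dim c - 2" by (rule comp_dim_gt)
      also have "\<dots> < 2 ^ (comp_dim c - 2)" by (rule less_exp)
      finally show ?thesis using that by simp
    qed
    \<comment> \<open>The last component that can act nontrivially in dimension D; it is at least
      \<open>a1\<close>, so N is as large as both cases require.\<close>
    define a where "a = (GREATEST c. 2 ^ (comp_dim c - 2) \<le> D)"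
    have a: "2 ^ (comp_dim a - 2) \<le> D" unfolding a_def
      by (rule GreatestI_nat[where P = "\<lambda>c. 2 ^ (comp_dim c - 2) \<le> D" and b = D, OF D bd])
    have amax: "c \<le> a" if "2 ^ (comp_dim c - 2) \<le> D" for c unfolding a_def
      by (rule Greatest_le_nat[where P = "\<lambda>c. 2 ^ (comp_dim c - 2) \<le> D" and b = D, OF that bd])
    interpret irreps_family I n r a D
    proof
      show "D < 2 ^ (comp_dim c - 2)" if "a < c" for c using amax[of c] that by (meson not_le)
    qed (use fin irr nD ineq in auto)
    define N where "N = comp_dim a"
    have "a1 \<le> a" using amax D by blast
    then have "a1 < N" using comp_dim_gt[of a] by (simp add: N_def)
    then have N1: "B \<le> real N" "4 * (m + 1) \<le> N" using a0 by (auto simp: a1_def)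
    have N0: "0 < N" using N1(2) by simp
    have D0: "0 < real D" using less_le_trans[OF _ a, of 0] by simp
    have bs: "real (block_size a) \<le> real N" by (simp add: N_def comp_dim_def)
    have lnD: "real k * L \<le> ln (real D)" if "2 ^ k \<le> D" for k
    proof -
      have "(2::real) ^ k \<le> real D" using of_nat_mono[OF that, where 'a = real] by simp
      then have "ln ((2::real) ^ k) \<le> ln (real D)" using D0 by (subst ln_le_cancel_iff) auto
      then show ?thesis by (simp add: ln_realpow L_def)
    qed
    have goal: "real (card I) \<le> real D powr \<epsilon>" if C: "real (card I) \<le> real N * C" "C > 0" "ln (real N) + ln C \<le> \<epsilon> * ln (real D)" for C
    proof -
      have "real N * C = exp (ln (real N) + ln C)" using N0 C(2) by (simp add: exp_add)
      also have "\<dots> \<le> exp (\<epsilon> * ln (real D))" using C(3) by simp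
      also have "\<dots> = real D powr \<epsilon>" using D0 by (simp add: powr_def)
      finally show ?thesis using C(1) by simp
    qed
    show "real (card I) \<le> real D powr \<epsilon>"
    proof (cases "D < 2 ^ ((m + 1) * (N - 2 * (m + 1)))")
      case True
      have c: "card I \<le> block_size a * 2 ^ (20 * m ^ 2)"
        by (rule card_le_double_cosets) (use True N1(2) in \<open>auto simp: N_def\<close>)
      then have "real (card I) \<le> real (block_size a) * 2 ^ (20 * m ^ 2)"
        using of_nat_mono[OF c, where 'a = real] by simp
      also have "\<dots> \<le> real N * 2 ^ (20 * m ^ 2)" using bs by (intro mult_right_mono) auto
      finally have 1: "real (card I) \<le> real N * 2 ^ (20 * m ^ 2)" .
      have "ln (\<delta> * real N) \<le> \<delta> * real N - 1" using \<delta> N0 by (intro ln_le_minus_one) simp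
      then have "ln (real N) \<le> \<delta> * real N - ln \<delta>" using \<delta> N0 by (simp add: ln_mult)
      moreover have "20 * real m ^ 2 * L - ln \<delta> + 4 * \<delta> \<le> \<delta> * real N"
        using N1(1) \<delta> by (simp add: B_def pos_divide_le_eq mult.commute)
      moreover have "\<epsilon> * (real (N - 2) * L) \<le> \<epsilon> * ln (real D)"
        using lnD[of "N - 2"] a \<epsilon> by (intro mult_left_mono) (auto simp: N_def)
      moreover have "\<epsilon> * (real (N - 2) * L) = 2 * \<delta> * real N - 4 * \<delta>"
        using N1(2) by (simp add: \<delta>_def of_nat_diff algebra_simps)
      moreover have "ln ((2::real) ^ (20 * m ^ 2)) = 20 * real m ^ 2 * L"
        by (subst ln_realpow) (auto simp: L_def)
      ultimately have "ln (real N) + ln ((2::real) ^ (20 * m ^ 2)) \<le> \<epsilon> * ln (real D)" by linarith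
      then show ?thesis using 1 by (intro goal) auto
    next
      case False
      have c: "card I \<le> block_size a * 4 ^ N" unfolding N_def by (rule card_le_classes)
      then have "real (card I) \<le> real (block_size a) * 4 ^ N"
        using of_nat_mono[OF c, where 'a = real] by simp
      also have "\<dots> \<le> real N * 4 ^ N" using bs by (intro mult_right_mono) auto
      finally have 1: "real (card I) \<le> real N * 4 ^ N" .
      have "real N \<le> 2 ^ N" using less_exp[of N] by (metis less_imp_le of_nat_le_iff of_nat_numeral of_nat_power)
      then have "ln (real N) \<le> ln ((2::real) ^ N)" using N0 by (subst ln_le_cancel_iff) auto
      then have lnN: "ln (real N) \<le> real N * L" by (simp add: ln_realpow L_def)
      have "ln (4::real) = 2 * L" using ln_realpow[of "2::real" 2] by (simp add: L_def)
      then have ln4: "ln ((4::real) ^ N) = 2 * (real N * L)" by (simp add: ln_realpow)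
      have "real ((m + 1) * (N - 2 * (m + 1))) * L \<le> ln (real D)" using False by (intro lnD) simp
      then have "\<epsilon> * (real ((m + 1) * (N - 2 * (m + 1))) * L) \<le> \<epsilon> * ln (real D)" using \<epsilon> by (intro mult_left_mono) auto
      moreover have "3 * (real N * L) \<le> \<epsilon> * (real ((m + 1) * (N - 2 * (m + 1))) * L)"
      proof -
        have "8 \<le> \<epsilon> * real m" using m \<epsilon> by (simp add: pos_divide_less_eq mult.commute)
        then have e8: "8 \<le> \<epsilon> * real (m + 1)" using \<epsilon> by (simp add: distrib_left)
        have "N \<le> 2 * (N - 2 * (m + 1))" using N1(2) by simp
        then have "real N \<le> 2 * real (N - 2 * (m + 1))" by (metis of_nat_le_iff of_nat_mult of_nat_numeral)
        then have "3 * real N \<le> 8 * real (N - 2 * (m + 1))" by linarith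
        also have "\<dots> \<le> \<epsilon> * real (m + 1) * real (N - 2 * (m + 1))" using e8 by (intro mult_right_mono) auto
        finally have "3 * real N * L \<le> \<epsilon> * real (m + 1) * real (N - 2 * (m + 1)) * L" using L by (intro mult_right_mono) auto
        then show ?thesis by (simp only: of_nat_mult mult.assoc)
      qed
      ultimately have "ln (real N) + ln ((4::real) ^ N) \<le> \<epsilon> * ln (real D)" using lnN ln4 by linarith
      then show ?thesis using 1 by (intro goal) auto
    qed
  qed
qed

section \<open>Countability of \<Gamma> and transport along isomorphisms\<close>

lemma countable_generate:
  assumes G: "group G" and S: "S \<subseteq> carrier G" "countable S"
  shows "countable (generate G S)"
proof -
  interpret group G by fact
  define T where "T = S \<union> m_inv G ` S"
  have T: "T \<subseteq> carrier G" using S by (auto simp: T_def)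
  define ev where "ev = foldr (mult G)"
  have ev_closed: "set l \<subseteq> T \<Longrightarrow> ev l \<one>\<^bsub>G\<^esub> \<in> carrier G" for l
    using T by (induction l) (auto simp: ev_def)
  have ev_append: "set l \<subseteq> T \<Longrightarrow> set l' \<subseteq> T \<Longrightarrow> ev (l @ l') \<one>\<^bsub>G\<^esub> = ev l \<one>\<^bsub>G\<^esub> \<otimes>\<^bsub>G\<^esub> ev l' \<one>\<^bsub>G\<^esub>" for l l'
  proof (induction l)
    case Nil
    then show ?case using ev_closed[of l'] by (simp add: ev_def)
  next
    case (Cons x l)
    then show ?case using ev_closed[of l] ev_closed[of l'] T by (simp add: ev_def m_assoc subset_iff)
  qed
  have "generate G S \<subseteq> (\<lambda>l. ev l \<one>\<^bsub>G\<^esub>) ` lists T"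
  proof
    fix x assume "x \<in> generate G S"
    then show "x \<in> (\<lambda>l. ev l \<one>\<^bsub>G\<^esub>) ` lists T"
    proof (induction rule: generate.induct)
      case one
      then show ?case by (intro image_eqI[of _ _ "[]"]) (auto simp: ev_def)
    next
      case (incl h)
      then show ?case using S by (intro image_eqI[of _ _ "[h]"]) (auto simp: ev_def T_def)
    next
      case (inv h)
      then show ?case using S by (intro image_eqI[of _ _ "[inv\<^bsub>G\<^esub> h]"]) (auto simp: ev_def T_def)
    next
      case (eng h1 h2)
      then obtain l1 l2 where "l1 \<in> lists T" "l2 \<in> lists T" "h1 = ev l1 \<one>\<^bsub>G\<^esub>" "h2 = ev l2 \<one>\<^bsub>G\<^esub>" by auto
      then show ?case using ev_append[of l1 l2] by (intro image_eqI[of _ _ "l1 @ l2"]) (auto simp: subset_iff in_lists_conv_set)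
    qed
  qed
  moreover have "countable (lists T)" using S(2) by (auto simp: T_def)
  ultimately show ?thesis by (meson countable_image countable_subset)
qed

text \<open>The preimage M of N is the kernel of the map from H to the quotient of G by N, so the
  cosets of M inject into those of N.\<close>

lemma residually_finite_iso:
  assumes \<phi>: "\<phi> \<in> iso G H" and G: "group G" and H: "group H" and rf: "residually_finite G"
  shows "residually_finite H"
  unfolding residually_finite_def
proof (intro ballI impI)
  define \<psi> where "\<psi> = inv_into (carrier G) \<phi>"
  have \<psi>: "\<psi> \<in> iso H G" unfolding \<psi>_def by (rule group.iso_set_sym[OF G \<phi>])
  interpret \<psi>: group_hom H G \<psi>
    using \<psi> G H by (intro group_hom.intro group_hom_axioms.intro) (auto simp: iso_def)
  have inj: "inj_on \<psi> (carrier H)" using \<psi> by (auto simp: iso_def bij_betw_def)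
  fix h assume h: "h \<in> carrier H" "h \<noteq> \<one>\<^bsub>H\<^esub>"
  then have "\<psi> h \<noteq> \<one>\<^bsub>G\<^esub>" using inj_onD[OF inj, of h "\<one>\<^bsub>H\<^esub>"] by auto
  then obtain N where N: "N \<lhd> G" "finite (rcosets\<^bsub>G\<^esub> N)" "\<psi> h \<notin> N"
    using rf h(1) \<psi>.hom_closed unfolding residually_finite_def by blast
  interpret N: normal N G by fact
  define M where "M = {x \<in> carrier H. \<psi> x \<in> N}"
  have hom: "(\<lambda>x. N #>\<^bsub>G\<^esub> \<psi> x) \<in> hom H (G Mod N)"
    using hom_compose[OF \<psi>.homh N.r_coset_hom_Mod] by (simp add: comp_def)
  interpret c: group_hom H "G Mod N" "\<lambda>x. N #>\<^bsub>G\<^esub> \<psi> x"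
    using hom N.factorgroup_is_group H by (intro group_hom.intro group_hom_axioms.intro) auto
  have coset: "N #>\<^bsub>G\<^esub> y = N \<longleftrightarrow> y \<in> N" if "y \<in> carrier G" for y
    using \<psi>.H.coset_join1[OF _ that N.subgroup_axioms] \<psi>.H.coset_join2[OF that N.subgroup_axioms] by blast
  have M: "M = kernel H (G Mod N) (\<lambda>x. N #>\<^bsub>G\<^esub> \<psi> x)"
    using coset[OF \<psi>.hom_closed] by (simp add: M_def kernel_def FactGroup_def cong: conj_cong)
  have "M \<lhd> H" unfolding M by (rule c.normal_kernel)
  moreover have "finite (rcosets\<^bsub>H\<^esub> M)"
  proof (rule inj_on_finite[OF _ _ N(2)])
    show "inj_on (\<lambda>C. the_elem ((\<lambda>x. N #>\<^bsub>G\<^esub> \<psi> x) ` C)) (rcosets\<^bsub>H\<^esub> M)"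
      using c.FactGroup_inj_on unfolding M FactGroup_def by simp
    show "(\<lambda>C. the_elem ((\<lambda>x. N #>\<^bsub>G\<^esub> \<psi> x) ` C)) ` (rcosets\<^bsub>H\<^esub> M) \<subseteq> rcosets\<^bsub>G\<^esub> N"
      using c.FactGroup_hom unfolding M FactGroup_def hom_def by auto
  qed
  moreover have "h \<notin> M" using N(3) by (simp add: M_def)
  ultimately show "\<exists>N. N \<lhd> H \<and> finite (rcosets\<^bsub>H\<^esub> N) \<and> h \<notin> N" by blast
qed

lemma finitely_generated_group_iso:
  assumes \<phi>: "\<phi> \<in> iso G H" and G: "group G" and H: "group H" and fg: "finitely_generated_group G"
  shows "finitely_generated_group H"
proof -
  interpret group_hom G H \<phi>
    using \<phi> G H by (intro group_hom.intro group_hom_axioms.intro) (auto simp: iso_def)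
  obtain S where S: "finite S" "S \<subseteq> carrier G" "generate G S = carrier G"
    using fg unfolding finitely_generated_group_def by blast
  have "\<phi> ` carrier G = carrier H" using \<phi> by (auto simp: iso_def bij_betw_def)
  then have "generate H (\<phi> ` S) = carrier H" using generate_img[OF S(2)] S(3) by simp
  moreover have "finite (\<phi> ` S)" "\<phi> ` S \<subseteq> carrier H" using S by auto
  ultimately show ?thesis unfolding finitely_generated_group_def by blast
qed

text \<open>The exponent 1 gives polynomial boundedness, which selects the limsup branch of
  \<open>rep_growth\<close>; the other exponents show that the quotients converge to 0.\<close>

lemma rep_growth_zeroI:
  fixes G :: "('g, 'b) monoid_scheme"
  assumes fin: "\<And>D. \<exists>B. bounded_families G D B"
    and sub: "\<And>\<epsilon>::real. 0 < \<epsilon> \<Longrightarrow> \<exists>D0. \<forall>D\<ge>D0. \<exists>B. bounded_families G D B \<and> real B \<le> real D powr \<epsilon>"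
  shows "rep_growth G = 0"
proof -
  have f: "finite (irr_classes G k)" if "1 \<le> k" for k
    using fin[of k] bounded_families_R_count[of G k] that by auto
  have R: "\<exists>D0. \<forall>D\<ge>D0. real (R_count G D) \<le> real D powr \<epsilon>" if e: "0 < \<epsilon>" for \<epsilon>
  proof -
    obtain D0 where D0: "\<And>D. D0 \<le> D \<Longrightarrow> \<exists>B. bounded_families G D B \<and> real B \<le> real D powr \<epsilon>"
      using sub[OF e] by blast
    have "real (R_count G D) \<le> real D powr \<epsilon>" if d: "D0 \<le> D" for D
    proof -
      obtain B where B: "bounded_families G D B" "real B \<le> real D powr \<epsilon>" using D0[OF d] by blast
      have "R_count G D \<le> B" using bounded_families_R_count[OF B(1)] by simp
      then show ?thesis using B(2) by linarith
    qed
    then show ?thesis by blast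
  qed
  obtain D1 where D1: "\<And>D. D1 \<le> D \<Longrightarrow> real (R_count G D) \<le> real D powr 1" using R[of 1] by auto
  \<comment> \<open>The sum in the constant takes care of the finitely many dimensions before the
    linear bound sets in.\<close>
  have "real (R_count G k) \<le> (1 + real (\<Sum>i<D1. R_count G i)) * real k powr 1" if "1 \<le> k" for k
  proof (cases "D1 \<le> k")
    case True
    have "real (R_count G k) \<le> real k powr 1" by (rule D1[OF True])
    also have "\<dots> = 1 * real k powr 1" by simp
    also have "\<dots> \<le> (1 + real (\<Sum>i<D1. R_count G i)) * real k powr 1"
      by (intro mult_right_mono) (auto intro: sum_nonneg)
    finally show ?thesis .
  next
    case False
    then have "R_count G k \<le> (\<Sum>i<D1. R_count G i)" by (intro member_le_sum) auto
    then have "real (R_count G k) \<le> real (\<Sum>i<D1. R_count G i)" by (simp only: of_nat_le_iff)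
    then have "real (R_count G k) \<le> (1 + real (\<Sum>i<D1. R_count G i)) * 1" by (simp del: of_nat_sum)
    also have "\<dots> \<le> (1 + real (\<Sum>i<D1. R_count G i)) * real k powr 1"
      using that by (intro mult_left_mono) (auto intro!: add_nonneg_nonneg sum_nonneg)
    finally show ?thesis .
  qed
  then have poly: "\<exists>C d::real. \<forall>n\<ge>1. real (R_count G n) \<le> C * real n powr d" by blast
  have lim: "(\<lambda>n. ln (real (R_count G n)) / ln (real n)) \<longlonglongrightarrow> 0"
  proof (rule LIMSEQ_I)
    fix e :: real assume e: "0 < e"
    obtain D0 where D0: "\<And>D. D0 \<le> D \<Longrightarrow> real (R_count G D) \<le> real D powr (e / 2)" using R[of "e / 2"] e by auto
    have "norm (ln (real (R_count G n)) / ln (real n) - 0) < e" if n: "max D0 2 \<le> n" for n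
    \<comment> \<open>If the count is 0, the quotient is 0 by the convention ln 0 = 0.\<close>
    proof (cases "R_count G n = 0")
      case False
      have ln: "0 < ln (real n)" using n by simp
      have "ln (real (R_count G n)) \<le> ln (real n powr (e / 2))"
        using D0[of n] n False by (subst ln_le_cancel_iff) auto
      also have "\<dots> = e / 2 * ln (real n)" using n by (simp add: ln_powr)
      finally have "ln (real (R_count G n)) / ln (real n) \<le> e / 2" using ln by (simp add: pos_divide_le_eq)
      moreover have "0 \<le> ln (real (R_count G n)) / ln (real n)" using ln False by (intro divide_nonneg_pos) auto
      ultimately show ?thesis using e unfolding real_norm_def by linarith
    qed (use e in simp)
    then show "\<exists>no. \<forall>n\<ge>no. norm (ln (real (R_count G n)) / ln (real n) - 0) < e" by blast
  qed
  then have "(\<lambda>n. ereal (ln (real (R_count G n)) / ln (real n))) \<longlonglongrightarrow> ereal 0" by (rule tendsto_ereal)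
  then have "limsup (\<lambda>n. ereal (ln (real (R_count G n)) / ln (real n))) = ereal 0"
    by (rule lim_imp_Limsup[OF trivial_limit_sequentially])
  then show ?thesis using f poly by (simp add: rep_growth_def zero_ereal_def)
qed

theorem theorem9p2:
  shows "\<exists>G :: nat monoid. group G \<and> finitely_generated_group G \<and> residually_finite G
           \<and> infinite (carrier G) \<and> rep_growth G = 0"
proof -
  \<comment> \<open>The group asked for has natural numbers as elements, so \<Gamma> is transported
    along an injection of its countable carrier.\<close>
  have "countable (carrier \<Gamma>)"
    using countable_generate[OF product_group_group elementary_generators_closed] finite_elementary_generators
    by (simp add: \<Gamma>_def countable_finite)
  then have inj: "inj_on (to_nat_on (carrier \<Gamma>)) (carrier \<Gamma>)" by (rule inj_on_to_nat_on)
  define G where "G = image_group (to_nat_on (carrier \<Gamma>)) \<Gamma>"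
  have iso: "to_nat_on (carrier \<Gamma>) \<in> iso \<Gamma> G" unfolding G_def by (rule inj_imp_image_group_iso[OF inj])
  have G: "group G" unfolding G_def by (rule group.inj_imp_image_group_is_group[OF \<Gamma>_group inj])
  have "infinite (carrier G)"
    using \<Gamma>_infinite inj by (simp add: G_def image_group_carrier finite_image_iff)
  moreover have "rep_growth G = 0"
  proof (rule rep_growth_zeroI)
    have "bounded_families G D (block_size D * 4 ^ comp_dim D)" for D
      by (rule bounded_families_iso[OF iso \<Gamma>_group G]) (rule irreps_of_\<Gamma>_le)
    then show "\<exists>B. bounded_families G D B" for D by blast
  next
    fix \<epsilon> :: real assume \<epsilon>: "0 < \<epsilon>"
    obtain D0 where D0: "\<forall>D\<ge>D0. \<forall>(I :: (nat \<times> (nat \<Rightarrow> complex mat) set) set) n r. finite I \<longrightarrow>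
      (\<forall>i\<in>I. irr_mat_rep \<Gamma> (n i) (r i)) \<longrightarrow> (\<forall>i\<in>I. n i \<le> D) \<longrightarrow>
      (\<forall>i\<in>I. \<forall>j\<in>I. i \<noteq> j \<longrightarrow> n i = n j \<longrightarrow> \<not> equiv_reps \<Gamma> (n i) (r i) (r j)) \<longrightarrow>
      real (card I) \<le> real D powr \<epsilon>"
      by (rule exE[OF irreps_of_\<Gamma>_subpolynomial[OF \<epsilon>]])
    have "\<exists>B. bounded_families G D B \<and> real B \<le> real D powr \<epsilon>" if D: "D0 \<le> D" for D
    \<comment> \<open>\<open>bounded_families\<close> takes a natural number as bound; the floor
      loses nothing as cardinalities are integers.\<close>
    proof (intro exI[of _ "nat \<lfloor>real D powr \<epsilon>\<rfloor>"] conjI bounded_families_iso[OF iso \<Gamma>_group G])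
      show "real (nat \<lfloor>real D powr \<epsilon>\<rfloor>) \<le> real D powr \<epsilon>" by simp
      fix I :: "(nat \<times> (nat \<Rightarrow> complex mat) set) set" and n r
      assume "finite I" "\<And>i. i \<in> I \<Longrightarrow> irr_mat_rep \<Gamma> (n i) (r i)" "\<And>i. i \<in> I \<Longrightarrow> n i \<le> D"
        "\<And>i j. i \<in> I \<Longrightarrow> j \<in> I \<Longrightarrow> i \<noteq> j \<Longrightarrow> n i = n j \<Longrightarrow> \<not> equiv_reps \<Gamma> (n i) (r i) (r j)"
      then have "real (card I) \<le> real D powr \<epsilon>"
        by (intro D0[rule_format, OF D, of I n r]) blast+
      then show "card I \<le> nat \<lfloor>real D powr \<epsilon>\<rfloor>" by (simp add: le_nat_floor)
    qed
    then show "\<exists>D0. \<forall>D\<ge>D0. \<exists>B. bounded_families G D B \<and> real B \<le> real D powr \<epsilon>" by blast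
  qed
  ultimately show ?thesis
    using G finitely_generated_group_iso[OF iso \<Gamma>_group G \<Gamma>_finitely_generated]
      residually_finite_iso[OF iso \<Gamma>_group G \<Gamma>_residually_finite] by blast
qed

end
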